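(* Let $g$ be a real analytic function on $(-1,1)$ whose Taylor coefficients $(g_n)_{n\ge 0}$ at $0$ are nonnegative, regularly varying of index $\gamma-1$, not summable, and tend to $0$ at infinity. If $\gamma=1$, assume further that $(g_n)_{n\ge0}$ is asymptotically equivalent to a monotone sequence. Let $F$ be a distribution function with negative mean $\mu$ and whose tail $\overline F=1-F$ is regularly varying with index $-\alpha$. If $1/\alpha<\gamma<1$, then the maximum $M$ of the corresponding $(g,F)$-process satisfies $$P\{M>t\}\sim \frac{(g^* )^\alpha}{\gamma}\,B\Bigl(\frac1\gamma,\alpha-\frac1\gamma\Bigr)\Bigl(\frac{\Gamma(1+\gamma)}{-\mu}\Bigr)^{1/\gamma}U(t)\,\overline F(t)$$ as $t\to\infty$.
   Context: $(g,F)$-process: let $g(x)=\sum_{i\ge0}g_ix^i$ on $(-1,1)$ and let $(X_n)_{n\ge1}$ be independent random variables with common distribution function $F$ (with finite mean $\mu$); set $S_n=\sum_{0\le i<n}g_iX_{n-i}$ for $n\ge 0$ (so $S_0=0$) and $M=\sup_{n\ge0}S_n$. A sequence $(g_n)$ is regularly varying of index $\gamma-1$ if it is ultimately positive and $g_{\lfloor\lambda n\rfloor}/g_n\to\lambda^{\gamma-1}$ as $n\to\infty$ for every $\lambda>0$. The tail $\overline F$ is regularly varying with index $-\alpha$ if $\overline F(\lambda t)/\overline F(t)\to\lambda^{-\alpha}$ as $t\to\infty$ for every $\lambda>0$. $g^*=\sup_{i\ge0}g_i$. $U$ is a regularly varying function of index $1/\gamma$ such that $g(1-1/U(t))\sim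 t$ as $t\to\infty$ (it exists and is unique up to asymptotic equivalence). $\Gamma$ is the gamma function and $B(p,q)=\int_0^1u^{p-1}(1-u)^{q-1}\,du$ is the beta function. *)

theory Defs
  imports "HOL-Probability.Probability" "HOL-Library.Landau_Symbols"
begin

unbundle asymp_equiv_syntax

definition regularly_varying_seq :: "(nat \<Rightarrow> real) \<Rightarrow> real \<Rightarrow> bool" where
  "regularly_varying_seq c \<rho> \<longleftrightarrow>
     (\<forall>\<^sub>F n in sequentially. c n > 0) \<and>
     (\<forall>l::real. l > 0 \<longrightarrow> (\<lambda>n. c (nat \<lfloor>l * real n\<rfloor>) / c n) \<longlonglongrightarrow> l powr \<rho>)"

definition regularly_varying :: "(real \<Rightarrow> real) \<Rightarrow> real \<Rightarrow> bool" where
  "regularly_varying f \<rho> \<longleftrightarrow>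
     (\<forall>\<^sub>F t in at_top. f t > 0) \<and>
     (\<forall>l::real. l > 0 \<longrightarrow> ((\<lambda>t. f (l * t) / f t) \<longlongrightarrow> l powr \<rho>) at_top)"

definition distribution_function :: "(real \<Rightarrow> real) \<Rightarrow> bool" where
  "distribution_function F \<longleftrightarrow>
     mono F \<and> (\<forall>x. continuous (at_right x) F) \<and>
     (F \<longlongrightarrow> 0) at_bot \<and> (F \<longlongrightarrow> 1) at_top"

text \<open>Integrability of the identity under the Lebesgue-Stieltjes measure of \<open>F\<close> is part of
  \<open>has_mean F \<mu>\<close>.\<close>

definition has_mean :: "(real \<Rightarrow> real) \<Rightarrow> real \<Rightarrow> bool" where
  "has_mean F \<mu> \<longleftrightarrow> has_bochner_integral (interval_measure F) (\<lambda>x. x) \<mu>"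

definition tail :: "(real \<Rightarrow> real) \<Rightarrow> real \<Rightarrow> real" where
  "tail F t = 1 - F t"

definition process :: "(nat \<Rightarrow> real) \<Rightarrow> (nat \<Rightarrow> 'a \<Rightarrow> real) \<Rightarrow> nat \<Rightarrow> 'a \<Rightarrow> real" where
  "process c X n \<omega> = (\<Sum>i<n. c i * X (n - i) \<omega>)"

text \<open>The supremum is taken in the extended reals, so that an unbounded path has supremum
  \<open>\<infinity>\<close>.\<close>

definition process_max :: "(nat \<Rightarrow> real) \<Rightarrow> (nat \<Rightarrow> 'a \<Rightarrow> real) \<Rightarrow> 'a \<Rightarrow> ereal" where
  "process_max c X \<omega> = (SUP n. ereal (process c X n \<omega>))"

text \<open>\<open>c\<close> is the sequence of Taylor coefficients of \<open>g\<close> at \<open>0\<close>, and the \<open>X n\<close> with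
  \<open>n \<ge> 1\<close> are the innovations; \<open>X 0\<close> is never used.\<close>

definition gF_process ::
  "'a measure \<Rightarrow> (real \<Rightarrow> real) \<Rightarrow> (nat \<Rightarrow> real) \<Rightarrow> (real \<Rightarrow> real) \<Rightarrow> (nat \<Rightarrow> 'a \<Rightarrow> real) \<Rightarrow> bool"
where
  "gF_process P g c F X \<longleftrightarrow>
     prob_space P \<and>
     (\<forall>x\<in>{-1<..<1}. (\<lambda>n. c n * x ^ n) sums g x) \<and>
     prob_space.indep_vars P (\<lambda>_. borel) X {1..} \<and>
     (\<forall>n\<ge>1. cdf (distr P borel (X n)) = F)"

text \<open>\<open>U\<close> is an asymptotic inverse of \<open>t \<mapsto> g (1 - 1/t)\<close>. A regularly varying function (in the
  usual sense, that is, measurable) of positive index tends to infinity. This is stated explicitly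
  in place of measurability; it also places \<open>1 - 1 / U t\<close> in the domain \<open>(-1, 1)\<close> of \<open>g\<close> for
  large \<open>t\<close>.\<close>

definition inverse_growth :: "(real \<Rightarrow> real) \<Rightarrow> real \<Rightarrow> (real \<Rightarrow> real) \<Rightarrow> bool" where
  "inverse_growth g \<gamma> U \<longleftrightarrow>
     regularly_varying U (1 / \<gamma>) \<and> filterlim U at_top at_top \<and>
     (\<lambda>t. g (1 - 1 / U t)) \<sim>[at_top] (\<lambda>t. t)"

end

theory Submission
  imports Defs "HOL-Real_Asymp.Real_Asymp"
begin

text \<open>One big jump. A large maximum is caused by a single innovation \<open>X k\<close>: by the law of large
  numbers the other innovations contribute about \<open>\<mu> * G n\<close>, where \<open>G n\<close> is the sum of the first
  \<open>n\<close> coefficients, so the process exceeds \<open>t\<close> soon after time \<open>k\<close> exactly when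
  \<open>c_sup * X k\<close> exceeds \<open>t - \<mu> * G k\<close>. Hence the probability is equivalent to the sum over \<open>k\<close> of
  \<open>tail F ((t - \<mu> * G k) / c_sup)\<close>. The Karamata-type relation between \<open>G\<close>, \<open>g\<close> and \<open>U\<close> gives
  \<open>G (v * U t) / t \<longlonglongrightarrow> v powr \<gamma> / Gamma (1 + \<gamma>)\<close>, and after the substitution \<open>k = v * U t\<close> dominated
  convergence turns the sum into a beta integral. For the upper bound, two large jumps are
  negligible because the sum squared is, and a deviation without a large jump is excluded by a
  Chernoff bound: for innovations truncated at \<open>\<epsilon> * T\<close> it is smaller than any prescribed power of
  \<open>T = t - \<mu> * G n\<close>, since the coefficients are bounded and their sum is of order \<open>T\<close>. The lower
  bound is Bonferroni's inequality together with a weak law of large numbers.\<close>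

section \<open>Regularly varying sequences\<close>

text \<open>The condition \<open>1 / \<alpha> < \<gamma>\<close> is what makes late jumps harmless:
  up to slowly varying factors \<open>G n\<close> grows like \<open>n powr \<gamma>\<close>, so for
  fixed \<open>t\<close> the tail at \<open>t - \<mu> * G n\<close> decays like
  \<open>n powr (- (\<alpha> * \<gamma>))\<close>, which is summable. The two parts of this level
  balance when \<open>G n\<close> is of order \<open>t\<close>, that is for \<open>n\<close> of
  order \<open>U t\<close>; hence the time scale. Since the coefficients themselves are regularly
  varying, the link between \<open>G\<close>, \<open>g\<close> and \<open>U\<close> is Abelian:
  \<open>G\<close> and \<open>g\<close> are both compared with \<open>x\<close> times the
  coefficient at \<open>x\<close>, by one limit theorem for series with a kernel.

  Two obstacles shape the probabilistic part. The variance may be infinite, so the innovations that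
  do not jump are controlled by a first moment and a tail bound of some order \<open>q > 1\<close>
  only. And all times \<open>n\<close> compete, so the deviation bounds must remain summable over
  \<open>n\<close> and over the position of the jump.

  The factor \<open>c_sup\<close> arises because, after a jump at time \<open>k\<close>, the process
  can be observed a fixed number \<open>i\<close> of steps later, with \<open>c i\<close> close to
  \<open>c_sup\<close>; meanwhile the drift changes by a bounded amount only.\<close>

text \<open>The uniform convergence theorem, by averaging: for \<open>x\<close> in \<open>[2 * m, 4 * m)\<close> the difference of
  \<open>h m\<close> and \<open>h p\<close> is at most the sum of their distances to \<open>h (nat \<lfloor>x\<rfloor>)\<close>, and the mean of each of
  these over \<open>x\<close> vanishes by dominated convergence.\<close>

lemma regularly_varying_seq_uniform:
  fixes c :: "nat \<Rightarrow> real"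
  assumes rv: "regularly_varying_seq c \<rho>" and eta: "\<eta> > 0"
  shows "\<exists>N. \<forall>m\<ge>N. \<forall>p. m \<le> p \<and> p \<le> 2 * m \<longrightarrow>
           \<bar>(ln (c p) - \<rho> * ln (real p)) - (ln (c m) - \<rho> * ln (real m))\<bar> \<le> \<eta>"
proof -
  define h where "h i = ln (c i) - \<rho> * ln (real i)" for i :: nat
  \<comment> \<open>For \<open>m \<le> p \<le> 2 * m\<close> the windows of \<open>m\<close> and of
    \<open>p\<close> both contain \<open>[2 * m, 4 * m)\<close>, so the two averages can be compared
    there. The cap at 1 supplies an integrable dominating function.\<close>
  define \<phi> where "\<phi> m x = indicator {real m..<4 * real m} x * min 1 \<bar>h (nat \<lfloor>x\<rfloor>) - h m\<bar>"
    for m :: nat and x :: real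
  define \<Phi> where "\<Phi> m = (\<integral>x. \<phi> m x \<partial>lborel)" for m
  have [measurable]: "\<phi> m \<in> borel_measurable borel" for m
    unfolding \<phi>_def by measurable
  have int: "integrable lborel (\<phi> m)" for m
    by (rule Bochner_Integration.integrable_bound[where f = "indicator {real m..<4 * real m} :: real \<Rightarrow> real"])
       (auto simp: \<phi>_def indicator_def)
  have pos: "\<forall>\<^sub>F n in sequentially. c n > 0"
    using rv by (simp add: regularly_varying_seq_def)
  have lim_h: "(\<lambda>m. h (nat \<lfloor>y * real m\<rfloor>) - h m) \<longlonglongrightarrow> 0" if y: "y \<ge> 1" for y
  proof -
    have "(\<lambda>n. c (nat \<lfloor>y * real n\<rfloor>) / c n) \<longlonglongrightarrow> y powr \<rho>"
      using rv y by (simp add: regularly_varying_seq_def)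
    hence 1: "(\<lambda>n. ln (c (nat \<lfloor>y * real n\<rfloor>) / c n)) \<longlonglongrightarrow> ln (y powr \<rho>)"
      using y by (intro tendsto_ln) auto
    have 2: "(\<lambda>n. real (nat \<lfloor>y * real n\<rfloor>) / real n) \<longlonglongrightarrow> y"
      using y by real_asymp
    hence 2: "(\<lambda>n. ln (real (nat \<lfloor>y * real n\<rfloor>) / real n)) \<longlonglongrightarrow> ln y"
      using y by (intro tendsto_ln) auto
    have 3: "(\<lambda>n. ln (c (nat \<lfloor>y * real n\<rfloor>) / c n)
               - \<rho> * ln (real (nat \<lfloor>y * real n\<rfloor>) / real n)) \<longlonglongrightarrow> ln (y powr \<rho>) - \<rho> * ln y"
      by (intro tendsto_intros 1 2)
    have fl: "filterlim (\<lambda>n. nat \<lfloor>y * real n\<rfloor>) sequentially sequentially"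
      using y by real_asymp
    have ev: "\<forall>\<^sub>F n in sequentially. c (nat \<lfloor>y * real n\<rfloor>) > 0"
      using eventually_compose_filterlim[OF pos fl] .
    have ev2: "\<forall>\<^sub>F n in sequentially. nat \<lfloor>y * real n\<rfloor> \<ge> 1"
      using fl unfolding filterlim_at_top by blast
    have "(\<lambda>m. h (nat \<lfloor>y * real m\<rfloor>) - h m) \<longlonglongrightarrow> ln (y powr \<rho>) - \<rho> * ln y"
    proof (rule Lim_transform_eventually[OF 3])
      show "\<forall>\<^sub>F n in sequentially. ln (c (nat \<lfloor>y * real n\<rfloor>) / c n)
               - \<rho> * ln (real (nat \<lfloor>y * real n\<rfloor>) / real n) = h (nat \<lfloor>y * real n\<rfloor>) - h n"
        using pos ev ev2 eventually_gt_at_top[of 0]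
      proof eventually_elim
        case (elim n)
        have "ln (c (nat \<lfloor>y * real n\<rfloor>) / c n) = ln (c (nat \<lfloor>y * real n\<rfloor>)) - ln (c n)"
          using elim by (intro ln_divide_pos)
        moreover have "ln (real (nat \<lfloor>y * real n\<rfloor>) / real n) = ln (real (nat \<lfloor>y * real n\<rfloor>)) - ln (real n)"
          using elim by (intro ln_divide_pos) linarith+
        ultimately show ?case by (simp only: h_def) (simp add: right_diff_distrib)
      qed
    qed
    thus ?thesis using y by (simp add: ln_powr)
  qed
  have "(\<lambda>m. \<integral>y. \<phi> m (0 + real m * y) \<partial>lborel) \<longlonglongrightarrow> (\<integral>y. 0 \<partial>(lborel :: real measure))"
  proof (rule integral_dominated_convergence[where w = "indicator {1..<4} :: real \<Rightarrow> real"])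
    show "AE y in lborel. (\<lambda>m. \<phi> m (0 + real m * y)) \<longlonglongrightarrow> 0"
    proof (rule AE_I2)
      fix y :: real
      show "(\<lambda>m. \<phi> m (0 + real m * y)) \<longlonglongrightarrow> 0"
      proof (cases "y \<ge> 1")
        case True
        have "(\<lambda>m. min 1 \<bar>h (nat \<lfloor>y * real m\<rfloor>) - h m\<bar>) \<longlonglongrightarrow> min 1 \<bar>0\<bar>"
          by (intro tendsto_intros tendsto_min lim_h True)
        hence "(\<lambda>m. min 1 \<bar>h (nat \<lfloor>y * real m\<rfloor>) - h m\<bar>) \<longlonglongrightarrow> 0" by simp
        thus ?thesis
          by (rule Lim_null_comparison[rotated])
             (auto simp: \<phi>_def indicator_def mult.commute intro!: always_eventually)
      next
        case False
        have "\<forall>\<^sub>F m in sequentially. 0 = \<phi> m (0 + real m * y)"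
          using eventually_gt_at_top[of 0] by eventually_elim (use False in \<open>auto simp: \<phi>_def\<close>)
        thus ?thesis by (rule Lim_transform_eventually[OF tendsto_const])
      qed
    qed
    show "AE x in lborel. norm (\<phi> m (0 + real m * x)) \<le> indicator {1..<4} x" for m
    proof (rule AE_I2)
      fix x :: real
      have "x \<in> {1..<4}" if "real m * x \<in> {real m..<4 * real m}"
      proof -
        have "real m > 0" using that by auto
        thus ?thesis using that mult_le_cancel_left_pos[of "real m" 1 x]
          mult_less_cancel_left_pos[of "real m" x 4] by (auto simp: mult.commute)
      qed
      thus "norm (\<phi> m (0 + real m * x)) \<le> indicator {1..<4} x"
        by (auto simp: \<phi>_def indicator_def)
    qed
  qed auto
  hence "(\<lambda>m. \<integral>y. \<phi> m (0 + real m * y) \<partial>lborel) \<longlonglongrightarrow> 0" by simp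
  \<comment> \<open>The two averages give \<open>k \<le> 3 / 2 * e\<close>, which is at most 1/2 for
    this choice; the cap in \<open>k\<close> is then inactive and can be removed.\<close>
  moreover define e where "e = min 1 \<eta> / 3"
  moreover have e: "e > 0" using eta by (simp add: e_def)
  ultimately have "\<forall>\<^sub>F m in sequentially. (\<integral>y. \<phi> m (0 + real m * y) \<partial>lborel) < e"
    using order_tendstoD(2) by blast
  hence "\<forall>\<^sub>F m in sequentially. \<Phi> m \<le> e * real m"
    using eventually_gt_at_top[of 0]
  proof eventually_elim
    case (elim m)
    have "\<Phi> m = real m * (\<integral>y. \<phi> m (0 + real m * y) \<partial>lborel)"
      unfolding \<Phi>_def using elim by (subst lborel_integral_real_affine[where c = "real m" and t = 0]) auto
    also have "\<dots> \<le> real m * e" using elim by (intro mult_left_mono) auto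
    finally show ?case by (simp add: mult.commute)
  qed
  then obtain N where N: "\<And>m. m \<ge> N \<Longrightarrow> \<Phi> m \<le> e * real m"
    by (auto simp: eventually_sequentially)
  show ?thesis
  proof (intro exI[of _ "max 1 N"] allI impI)
    fix m p :: nat assume m: "m \<ge> max 1 N" and p: "m \<le> p \<and> p \<le> 2 * m"
    define k where "k = min 1 \<bar>h p - h m\<bar>"
    have "2 * real m * k = (\<integral>x. indicator {2 * real m..<4 * real m} x * k \<partial>lborel)"
      by simp
    also have "\<dots> \<le> (\<integral>x. \<phi> m x + \<phi> p x \<partial>lborel)"
    proof (rule integral_mono)
      show "integrable lborel (\<lambda>x. \<phi> m x + \<phi> p x)" by (intro Bochner_Integration.integrable_add int)
      show "integrable lborel (\<lambda>x. indicator {2 * real m..<4 * real m} x * k)"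
        by (intro integrable_mult_left) auto
      show "indicator {2 * real m..<4 * real m} x * k \<le> \<phi> m x + \<phi> p x" for x
      proof (cases "x \<in> {2 * real m..<4 * real m}")
        case True
        have "real m \<le> real p" "real p \<le> 2 * real m" using p by linarith+
        hence "x \<in> {real m..<4 * real m}" "x \<in> {real p..<4 * real p}" using True p by auto
        thus ?thesis using True by (simp add: \<phi>_def k_def)
      next
        case False
        thus ?thesis by (auto simp: \<phi>_def indicator_def)
      qed
    qed
    also have "\<dots> = \<Phi> m + \<Phi> p" unfolding \<Phi>_def by (intro Bochner_Integration.integral_add int)
    also have "\<dots> \<le> e * real m + e * real p" using m p by (intro add_mono N) auto
    also have "e * real p \<le> e * (2 * real m)" using p e by (intro mult_left_mono) auto
    finally have "2 * real m * k \<le> 2 * real m * (3 / 2 * e)" by (simp add: algebra_simps)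
    hence "k \<le> 3 / 2 * e" using m by (subst (asm) mult_le_cancel_left_pos) auto
    hence "k \<le> min 1 \<eta> / 2" by (simp add: e_def)
    hence "\<bar>h p - h m\<bar> \<le> \<eta>" unfolding k_def using eta by linarith
    thus "\<bar>(ln (c p) - \<rho> * ln (real p)) - (ln (c m) - \<rho> * ln (real m))\<bar> \<le> \<eta>"
      by (simp add: h_def)
  qed
qed

text \<open>On the logarithmic scale, halving a large index lowers \<open>l\<close>, because \<rho>
  + \<beta> is positive. Repeated halving of \<open>n\<close> ends within a factor 2 of
  \<open>i\<close>, where uniform convergence bounds the oscillation by the constant
  \<open>B\<close>. The shift by 1 keeps the weight positive at index 0 and makes it dominate
  \<open>(x * y) powr \<beta>\<close>, for \<beta> > 0, when \<open>i\<close> is the integer part of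
  \<open>x * y\<close>.\<close>

lemma regularly_varying_seq_potter:
  fixes c :: "nat \<Rightarrow> real"
  assumes rv: "regularly_varying_seq c \<rho>" and beta: "\<beta> > - \<rho>" and nonneg: "\<And>n. c n \<ge> 0"
  shows "\<exists>A>0. \<exists>N. \<forall>n\<ge>N. c n > 0 \<and>
    (\<forall>i\<le>n. c i * (real i + 1) powr \<beta> \<le> A * (c n * (real n + 1) powr \<beta>))"
proof -
  \<comment> \<open>Half of the limiting gain \<open>(\<rho> + \<beta>) * ln 2\<close> of one
    doubling: the gain eventually exceeds the error \<eta> of the uniform convergence
    theorem.\<close>
  define \<eta> where "\<eta> = (\<rho> + \<beta>) * ln 2 / 2"
  have eta: "\<eta> > 0" using beta by (simp add: \<eta>_def)
  define l where "l n = ln (c n) + \<beta> * ln (real n + 1)" for n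
  define B where "B = \<eta> + \<bar>\<rho>\<bar> * ln 2 + \<bar>\<beta>\<bar> * ln 2"
  obtain N1 where N1: "\<And>m p. m \<ge> N1 \<Longrightarrow> m \<le> p \<Longrightarrow> p \<le> 2 * m \<Longrightarrow>
       \<bar>(ln (c p) - \<rho> * ln (real p)) - (ln (c m) - \<rho> * ln (real m))\<bar> \<le> \<eta>"
    using regularly_varying_seq_uniform[OF rv eta] by blast
  have pos: "\<forall>\<^sub>F n in sequentially. c n > 0"
    using rv by (simp add: regularly_varying_seq_def)
  then obtain N2 where N2: "\<And>n. n \<ge> N2 \<Longrightarrow> c n > 0"
    by (auto simp: eventually_sequentially)
  have "(\<lambda>n. \<rho> * ln (real n / real ((n + 1) div 2)) + \<beta> * ln ((real n + 1) / (real ((n + 1) div 2) + 1)))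
           \<longlonglongrightarrow> \<rho> * ln 2 + \<beta> * ln 2"
  proof -
    have eq: "real ((n + 1) div 2) = real_of_int \<lfloor>(real n + 1) / 2\<rfloor>" for n
      using floor_divide_of_nat_eq[of "n + 1" 2, where 'a = real] by (simp add: add.commute)
    have a: "(\<lambda>n. real n / real ((n + 1) div 2)) \<longlonglongrightarrow> 2"
      unfolding eq by real_asymp
    have b: "(\<lambda>n. (real n + 1) / (real ((n + 1) div 2) + 1)) \<longlonglongrightarrow> 2"
      unfolding eq by real_asymp
    show ?thesis by (intro tendsto_intros a b) auto
  qed
  moreover have "\<eta> < \<rho> * ln 2 + \<beta> * ln 2"
    using eta unfolding \<eta>_def by (simp add: algebra_simps)
  ultimately have "\<forall>\<^sub>F n in sequentially. \<rho> * ln (real n / real ((n + 1) div 2))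
        + \<beta> * ln ((real n + 1) / (real ((n + 1) div 2) + 1)) > \<eta>"
    by (rule order_tendstoD)
  then obtain N3 where N3: "\<And>n. n \<ge> N3 \<Longrightarrow> \<rho> * ln (real n / real ((n + 1) div 2))
        + \<beta> * ln ((real n + 1) / (real ((n + 1) div 2) + 1)) > \<eta>"
    by (auto simp: eventually_sequentially)
  define N where "N = max 1 (max N1 (max N2 N3))"
  have step: "l i \<le> l n + B" if "N \<le> i" "i \<le> n" for i n
    using that
  proof (induction n arbitrary: i rule: less_induct)
    case (less n)
    show ?case
    proof (cases "n \<le> 2 * i")
      case True
      have i: "i \<ge> 1" "i \<ge> N1" "n \<ge> i" using less.prems by (auto simp: N_def)
      have 1: "\<bar>(ln (c n) - \<rho> * ln (real n)) - (ln (c i) - \<rho> * ln (real i))\<bar> \<le> \<eta>"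
        using N1[of i n] i True by simp
      have "ln (real i) \<le> ln (real n)" using i by simp
      moreover have "ln (real n) \<le> ln (real i * 2)" using i True
        by (subst ln_le_cancel_iff) auto
      hence "ln (real n) \<le> ln (real i) + ln 2"
        using i by (simp add: ln_mult)
      ultimately have "\<bar>\<rho> * (ln (real n) - ln (real i))\<bar> \<le> \<bar>\<rho>\<bar> * ln 2"
        unfolding abs_mult by (intro mult_left_mono) auto
      moreover have "ln (real i + 1) \<le> ln (real n + 1)" using i by simp
      moreover have "ln (real n + 1) \<le> ln ((real i + 1) * 2)" using i True
        by (subst ln_le_cancel_iff) auto
      hence "ln (real n + 1) \<le> ln (real i + 1) + ln 2"
        using i by (subst (asm) ln_mult_pos) auto
      ultimately have "\<bar>\<beta> * (ln (real n + 1) - ln (real i + 1))\<bar> \<le> \<bar>\<beta>\<bar> * ln 2"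
        unfolding abs_mult by (intro mult_left_mono) auto
      thus ?thesis using 1 \<open>\<bar>\<rho> * (ln (real n) - ln (real i))\<bar> \<le> \<bar>\<rho>\<bar> * ln 2\<close>
        unfolding l_def B_def by (simp add: algebra_simps)
    next
      case False
      define m where "m = (n + 1) div 2"
      have m: "i \<le> m" "m < n" "n \<le> 2 * m" "m \<ge> 1"
        using False less.prems by (auto simp: m_def N_def)
      have "l i \<le> l m + B" using less.IH[of m i] m less.prems by simp
      also have "l m \<le> l n"
      proof -
        have "\<bar>(ln (c n) - \<rho> * ln (real n)) - (ln (c m) - \<rho> * ln (real m))\<bar> \<le> \<eta>"
          using N1[of m n] m less.prems by (simp add: N_def)
        moreover have "\<rho> * ln (real n / real m) + \<beta> * ln ((real n + 1) / (real m + 1)) > \<eta>"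
          using N3[of n] less.prems by (simp add: m_def N_def)
        moreover have "ln (real n / real m) = ln (real n) - ln (real m)"
          using m by (intro ln_divide_pos) auto
        moreover have "ln ((real n + 1) / (real m + 1)) = ln (real n + 1) - ln (real m + 1)"
          using m by (intro ln_divide_pos) auto
        ultimately have "\<bar>(ln (c n) - \<rho> * ln (real n)) - (ln (c m) - \<rho> * ln (real m))\<bar> \<le> \<eta>"
          "\<rho> * (ln (real n) - ln (real m)) + \<beta> * (ln (real n + 1) - ln (real m + 1)) > \<eta>"
          by metis+
        thus ?thesis unfolding l_def right_diff_distrib by linarith
      qed
      finally show ?thesis by simp
    qed
  qed
  define a where "a n = c n * (real n + 1) powr \<beta>" for n
  have a_exp: "a n = exp (l n)" if "n \<ge> N" for n
    using N2[of n] that by (simp add: a_def l_def exp_add powr_def N_def)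
  have a_nonneg: "a n \<ge> 0" for n by (simp add: a_def nonneg)
  define A where "A = exp B * (1 + (\<Sum>i<N. a i / a N))"
  have aN: "a N > 0" using a_exp[of N] by simp
  have S: "(\<Sum>i<N. a i / a N) \<ge> 0" using aN a_nonneg by (intro sum_nonneg) auto
  have main: "a i \<le> exp B * a n" if "N \<le> i" "i \<le> n" for i n
    using step[OF that] that a_exp[of i] a_exp[of n] by (simp flip: exp_add add: add.commute)
  have A0: "A > 0" unfolding A_def using S by (intro mult_pos_pos) auto
  have "a i \<le> A * a n" if n: "n \<ge> N" "i \<le> n" for i n
  proof (cases "i \<ge> N")
    case True
    have "a i \<le> exp B * a n" using main True n by auto
    also have "\<dots> = exp B * 1 * a n" by simp
    also have "\<dots> \<le> A * a n" unfolding A_def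
      using S a_nonneg by (intro mult_right_mono mult_left_mono) auto
    finally show ?thesis .
  next
    case False
    have "a i = (a i / a N) * a N" using aN by simp
    also have "\<dots> \<le> (\<Sum>i<N. a i / a N) * a N"
      using False aN a_nonneg by (intro mult_right_mono member_le_sum) auto
    also have "\<dots> \<le> (1 + (\<Sum>i<N. a i / a N)) * (exp B * a n)"
      using S n aN by (intro mult_mono main) auto
    finally show ?thesis by (simp add: A_def algebra_simps)
  qed
  thus ?thesis using A0 N2 by (intro exI[of _ A] conjI exI[of _ N]) (auto simp: a_def N_def)
qed

text \<open>Writing a series as the integral of a step function allows the substitution
  \<open>z = x * y\<close>: a limit of rescaled series becomes a limit of integrals over one fixed
  measure, where dominated convergence applies.\<close>

lemma nn_integral_nat_floor:
  fixes f :: "nat \<Rightarrow> real"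
  assumes nonneg: "\<And>n. f n \<ge> 0"
  shows "(\<integral>\<^sup>+(x::real). ennreal (indicator {0..} x * f (nat \<lfloor>x\<rfloor>)) \<partial>lborel) = (\<Sum>n. ennreal (f n))"
proof -
  have eq: "ennreal (indicator {0..} x * f (nat \<lfloor>x\<rfloor>)) =
      (\<Sum>n. ennreal (f n) * indicator {real n..<real n + 1} x)" for x :: real
  proof (cases "x \<ge> 0")
    case True
    have *: "x \<in> {real n..<real n + 1} \<longleftrightarrow> n = nat \<lfloor>x\<rfloor>" for n
    proof
      assume "x \<in> {real n..<real n + 1}"
      hence "\<lfloor>x\<rfloor> = int n" by (simp add: floor_eq_iff)
      thus "n = nat \<lfloor>x\<rfloor>" by simp
    next
      assume "n = nat \<lfloor>x\<rfloor>"
      thus "x \<in> {real n..<real n + 1}" using True by (simp add: of_nat_nat)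
    qed
    have "indicator {real n..<real n + 1} x = (if n = nat \<lfloor>x\<rfloor> then 1 else 0 :: ennreal)" for n
      by (simp only: indicator_def * of_bool_def)
    hence "(\<Sum>n. ennreal (f n) * indicator {real n..<real n + 1} x) =
          (\<Sum>n\<in>{nat \<lfloor>x\<rfloor>}. ennreal (f n) * (if n = nat \<lfloor>x\<rfloor> then 1 else 0))"
      by (simp only:) (rule suminf_finite, auto)
    thus ?thesis using True by simp
  next
    case False
    hence "x \<notin> {real n..<real n + 1}" for n by auto
    thus ?thesis using False by simp
  qed
  have "(\<integral>\<^sup>+(x::real). ennreal (indicator {0..} x * f (nat \<lfloor>x\<rfloor>)) \<partial>lborel) =
        (\<Sum>n. \<integral>\<^sup>+x. ennreal (f n) * indicator {real n..<real n + 1} x \<partial>lborel)"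
    unfolding eq by (rule nn_integral_suminf) auto
  also have "\<dots> = (\<Sum>n. ennreal (f n))"
    by (simp add: nn_integral_cmult_indicator)
  finally show ?thesis .
qed

lemma has_bochner_integral_nat_floor:
  fixes f :: "nat \<Rightarrow> real"
  assumes nonneg: "\<And>n. f n \<ge> 0" and "summable f"
  shows "has_bochner_integral lborel (\<lambda>x::real. indicator {0..} x * f (nat \<lfloor>x\<rfloor>)) (suminf f)"
proof (rule has_bochner_integral_nn_integral)
  show "(\<integral>\<^sup>+(x::real). ennreal (indicator {0..} x * f (nat \<lfloor>x\<rfloor>)) \<partial>lborel) = ennreal (suminf f)"
    unfolding nn_integral_nat_floor[of f, OF nonneg] using assms by (simp add: suminf_ennreal2)
  show "(\<lambda>x::real. indicator {0..} x * f (nat \<lfloor>x\<rfloor>)) \<in> borel_measurable lborel"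
    by measurable
qed (use nonneg suminf_nonneg[OF assms(2)] in auto)

text \<open>The definition only rescales integer indices. The integer parts of \<open>x * y\<close>
  and of \<open>y * nat \<lfloor>x\<rfloor>\<close> have ratio tending to 1, and the uniform
  convergence theorem shows that exchanging one for the other does not change the limit.\<close>

lemma regularly_varying_seq_real_index:
  fixes c :: "nat \<Rightarrow> real"
  assumes rv: "regularly_varying_seq c \<rho>" and y: "y > 0"
  shows "((\<lambda>x. c (nat \<lfloor>x * y\<rfloor>) / c (nat \<lfloor>x\<rfloor>)) \<longlongrightarrow> y powr \<rho>) at_top"
proof -
  define n where "n x = nat \<lfloor>x\<rfloor>" for x :: real
  define q where "q x = nat \<lfloor>y * real (n x)\<rfloor>" for x
  define p where "p x = nat \<lfloor>x * y\<rfloor>" for x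
  define h where "h i = ln (c i) - \<rho> * ln (real i)" for i :: nat
  have fn: "filterlim n at_top at_top" unfolding n_def by real_asymp
  have fq: "filterlim q at_top at_top" unfolding q_def n_def using y by real_asymp
  have fp: "filterlim p at_top at_top" unfolding p_def using y by real_asymp
  have pq: "((\<lambda>x. real (p x) / real (q x)) \<longlongrightarrow> 1) at_top"
    unfolding p_def q_def n_def using y by real_asymp
  have pos: "\<forall>\<^sub>F n in sequentially. c n > 0"
    using rv by (simp add: regularly_varying_seq_def)
  have cq: "\<forall>\<^sub>F x in at_top. c (q x) > 0" and cp: "\<forall>\<^sub>F x in at_top. c (p x) > 0"
    using eventually_compose_filterlim[OF pos fq] eventually_compose_filterlim[OF pos fp] .
  have q1: "\<forall>\<^sub>F x in at_top. q x \<ge> 1" and p1: "\<forall>\<^sub>F x in at_top. p x \<ge> 1"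
    using fq fp unfolding filterlim_at_top by blast+
  have pq2: "\<forall>\<^sub>F x in at_top. real (p x) / real (q x) < 2"
    using order_tendstoD(2)[OF pq, of 2] by simp
  have qp: "\<forall>\<^sub>F x in at_top. q x \<le> p x \<and> p x \<le> 2 * q x"
    using pq2 q1 eventually_ge_at_top[of 0]
  proof eventually_elim
    case (elim x)
    have "y * real (n x) \<le> x * y" unfolding n_def using elim y by (simp add: mult.commute)
    hence "q x \<le> p x" unfolding q_def p_def by (intro nat_mono floor_mono)
    moreover have "real (p x) < 2 * real (q x)" using elim by (simp add: divide_less_eq)
    ultimately show ?case by linarith
  qed
  have "((\<lambda>x. h (p x) - h (q x)) \<longlongrightarrow> 0) at_top"
  proof (rule tendstoI)
    fix e :: real assume e: "e > 0"
    then obtain N where N: "\<And>m p. m \<ge> N \<Longrightarrow> m \<le> p \<and> p \<le> 2 * m \<Longrightarrow> \<bar>h p - h m\<bar> \<le> e / 2"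
      using regularly_varying_seq_uniform[OF rv, of "e / 2"] unfolding h_def by auto
    have "\<forall>\<^sub>F x in at_top. q x \<ge> N" using fq unfolding filterlim_at_top by blast
    thus "\<forall>\<^sub>F x in at_top. dist (h (p x) - h (q x)) 0 < e"
      using qp by eventually_elim (use N e in \<open>fastforce simp: dist_real_def\<close>)
  qed
  hence "((\<lambda>x. exp ((h (p x) - h (q x)) + \<rho> * ln (real (p x) / real (q x)))) \<longlongrightarrow> exp (0 + \<rho> * ln 1)) at_top"
    using pq by (intro tendsto_intros) auto
  moreover have "\<forall>\<^sub>F x in at_top. exp ((h (p x) - h (q x)) + \<rho> * ln (real (p x) / real (q x))) = c (p x) / c (q x)"
    using cq cp q1 p1
  proof eventually_elim
    case (elim x)
    have "ln (real (p x) / real (q x)) = ln (real (p x)) - ln (real (q x))"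
      using elim by (intro ln_divide_pos) auto
    hence "(h (p x) - h (q x)) + \<rho> * ln (real (p x) / real (q x)) = ln (c (p x)) - ln (c (q x))"
      by (simp only: h_def) (simp add: right_diff_distrib)
    thus ?case using elim by (simp add: exp_diff)
  qed
  ultimately have 1: "((\<lambda>x. c (p x) / c (q x)) \<longlongrightarrow> 1) at_top"
    using Lim_transform_eventually by fastforce
  have "(\<lambda>n. c (nat \<lfloor>y * real n\<rfloor>) / c n) \<longlonglongrightarrow> y powr \<rho>"
    using rv y by (simp add: regularly_varying_seq_def)
  from filterlim_compose[OF this fn] have 2: "((\<lambda>x. c (q x) / c (n x)) \<longlongrightarrow> y powr \<rho>) at_top"
    by (simp add: q_def)
  have "((\<lambda>x. c (p x) / c (q x) * (c (q x) / c (n x))) \<longlongrightarrow> 1 * y powr \<rho>) at_top"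
    by (intro tendsto_mult 1 2)
  moreover have "\<forall>\<^sub>F x in at_top. c (p x) / c (q x) * (c (q x) / c (n x)) = c (p x) / c (n x)"
    using cq by eventually_elim simp
  ultimately show ?thesis
    unfolding p_def n_def using Lim_transform_eventually by fastforce
qed

lemma regularly_varying_seq_inverse:
  assumes "regularly_varying_seq c \<rho>"
  shows "regularly_varying_seq (\<lambda>n. 1 / c n) (- \<rho>)"
  unfolding regularly_varying_seq_def
proof (intro conjI allI impI)
  show "\<forall>\<^sub>F n in sequentially. 1 / c n > 0"
    using assms by (simp add: regularly_varying_seq_def)
  fix l :: real assume l: "l > 0"
  hence "(\<lambda>n. inverse (c (nat \<lfloor>l * real n\<rfloor>) / c n)) \<longlonglongrightarrow> inverse (l powr \<rho>)"
    using assms by (intro tendsto_inverse) (auto simp: regularly_varying_seq_def)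
  thus "(\<lambda>n. 1 / c (nat \<lfloor>l * real n\<rfloor>) / (1 / c n)) \<longlonglongrightarrow> l powr - \<rho>"
    by (simp add: powr_minus field_simps)
qed

section \<open>Abelian limits for partial sums and for the power series\<close>

lemma has_bochner_integral_Gamma:
  fixes z :: real
  assumes "z > 0"
  shows "has_bochner_integral lborel (\<lambda>y. indicator {0..} y * (y powr (z - 1) * exp (- y))) (Gamma z)"
proof (rule has_bochner_integral_nn_integral)
  have "integral\<^sup>N lborel (\<lambda>y. indicator {0..} y * (y powr (z - 1) / exp y)) = Gamma z"
    by (rule nn_integral_has_integral_lebesgue[OF _ Gamma_integral_real[OF assms]]) auto
  thus "(\<integral>\<^sup>+y. ennreal (indicator {0..} y * (y powr (z - 1) * exp (- y))) \<partial>lborel) = ennreal (Gamma z)"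
    by (simp add: exp_minus divide_inverse)
qed (use assms in \<open>auto intro: less_imp_le Gamma_real_pos\<close>)

lemma regularly_varying_seq_kernel_limit:
  fixes c :: "nat \<Rightarrow> real" and f :: "real \<Rightarrow> nat \<Rightarrow> real"
  assumes rv: "regularly_varying_seq c (\<gamma> - 1)" and gamma: "0 < \<gamma>" "\<gamma> < 1"
    and nonneg: "\<And>n. c n \<ge> 0"
    and f_nonneg: "\<forall>\<^sub>F x in at_top. \<forall>i. f x i \<ge> 0"
    and f_summable: "\<forall>\<^sub>F x in at_top. summable (\<lambda>i. c i * f x i)"
    and f_bound: "\<forall>\<^sub>F x in at_top. \<forall>y>0. f x (nat \<lfloor>x * y\<rfloor>) \<le> B * exp (- y)"
    and f_lim: "\<And>y. y > 0 \<Longrightarrow> y \<noteq> v \<Longrightarrow> ((\<lambda>x. f x (nat \<lfloor>x * y\<rfloor>)) \<longlongrightarrow> \<phi> y) at_top"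
    and [measurable]: "\<phi> \<in> borel_measurable borel"
  shows "((\<lambda>x. (\<Sum>i. c i * f x i) / (x * c (nat \<lfloor>x\<rfloor>))) \<longlongrightarrow>
           (\<integral>y. indicator {0..} y * (y powr (\<gamma> - 1) * \<phi> y) \<partial>lborel)) at_top"
proof -
  \<comment> \<open>Larger than \<open>1 - \<gamma>\<close>, as the Potter bound requires, and
    smaller than 1, so that \<open>y powr (- \<beta>)\<close> is integrable at 0.\<close>
  define \<beta> where "\<beta> = 1 - \<gamma> / 2"
  have beta: "\<beta> > - (\<gamma> - 1)" "\<beta> > 0" using gamma by (auto simp: \<beta>_def)
  obtain A N where A: "A > 0" and cpos: "\<And>n. n \<ge> N \<Longrightarrow> c n > 0"
    and below: "\<And>n i. n \<ge> N \<Longrightarrow> i \<le> n \<Longrightarrow>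
           c i * (real i + 1) powr \<beta> \<le> A * (c n * (real n + 1) powr \<beta>)"
    using regularly_varying_seq_potter[OF rv beta(1) nonneg] by blast
  \<comment> \<open>Applied to \<open>1 / c\<close>, whose index \<open>1 - \<gamma>\<close> is
    positive, the Potter bound with weight exponent 0 says that \<open>c\<close> is decreasing up to
    a constant factor. This serves for \<open>y\<close> beyond about 1.\<close>
  obtain A' N' where A': "A' > 0" and cpos': "\<And>n. n \<ge> N' \<Longrightarrow> 1 / c n > 0"
    and above: "\<And>n i. n \<ge> N' \<Longrightarrow> i \<le> n \<Longrightarrow>
           1 / c i * (real i + 1) powr 0 \<le> A' * (1 / c n * (real n + 1) powr 0)"
    using regularly_varying_seq_potter[OF regularly_varying_seq_inverse[OF rv], of 0] gamma nonneg
    by fastforce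
  have above': "c n \<le> A' * c i" if "i \<ge> max N N'" "i \<le> n" for i n
    using above[of n i] cpos[of n] cpos[of i] that by (simp add: field_simps)
  define s where "s x y = indicator {0..} y * (c (nat \<lfloor>x * y\<rfloor>) / c (nat \<lfloor>x\<rfloor>) * f x (nat \<lfloor>x * y\<rfloor>))"
    for x y
  have s_meas: "(\<lambda>y. s x y) \<in> borel_measurable lborel" for x
    unfolding s_def by measurable
  define w where "w y = A * 2 powr \<beta> * B * (indicator {0..} y * (y powr (\<gamma> / 2 - 1) * exp (- y)))
     + A' * B * (indicator {0..} y * (y powr (1 - 1) * exp (- y)))" for y :: real
  have fl: "filterlim (\<lambda>x::real. nat \<lfloor>x\<rfloor>) at_top at_top" by real_asymp
  have evN: "\<forall>\<^sub>F x::real in at_top. nat \<lfloor>x\<rfloor> \<ge> max N N'"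
    using fl unfolding filterlim_at_top by blast
  have "((\<lambda>x. \<integral>y. s x y \<partial>lborel) \<longlongrightarrow> (\<integral>y. indicator {0..} y * (y powr (\<gamma> - 1) * \<phi> y) \<partial>lborel)) at_top"
  proof (rule integral_dominated_convergence_at_top[where w = w])
    show "integrable lborel w"
      unfolding w_def
      using has_bochner_integral_Gamma[of "\<gamma> / 2"] has_bochner_integral_Gamma[of 1] gamma
      by (intro Bochner_Integration.integrable_add integrable_mult_right)
         (auto simp: has_bochner_integral_iff)
    show "AE y in lborel. ((\<lambda>x. s x y) \<longlongrightarrow> indicator {0..} y * (y powr (\<gamma> - 1) * \<phi> y)) at_top"
      using AE_lborel_singleton[of 0] AE_lborel_singleton[of v]
    proof eventually_elim
      case (elim y)
      show ?case
      proof (cases "y > 0")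
        case True
        show ?thesis unfolding s_def
          using True elim by (intro tendsto_intros regularly_varying_seq_real_index[OF rv] f_lim) auto
      qed (use elim in \<open>auto simp: s_def\<close>)
    qed
    show "\<forall>\<^sub>F x in at_top. AE y in lborel. norm (s x y) \<le> w y"
      using f_nonneg f_bound evN eventually_ge_at_top[of 1]
    proof eventually_elim
      case (elim x)
      show ?case using AE_lborel_singleton[of 0]
      proof eventually_elim
        case y: (elim y)
        show ?case
        proof (cases "y > 0")
          case True
          define n i where "n = nat \<lfloor>x\<rfloor>" and "i = nat \<lfloor>x * y\<rfloor>"
          have n: "n \<ge> N" "n \<ge> N'" using elim by (auto simp: n_def)
          have cn: "c n > 0" using cpos n by auto
          have fB: "0 \<le> f x i" "f x i \<le> B * exp (- y)" using elim True by (auto simp: i_def)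
          have B0: "B \<ge> 0" using order_trans[OF fB] by (simp add: zero_le_mult_iff)
          have "c i / c n \<le> A * 2 powr \<beta> * y powr (- \<beta>) + A'"
          proof (cases "i \<le> n")
            case True
            have "real i + 1 \<ge> x * y" unfolding i_def by linarith
            hence "(x * y) powr \<beta> \<le> (real i + 1) powr \<beta>"
              using elim \<open>y > 0\<close> beta by (intro powr_mono2) auto
            hence "c i * (x * y) powr \<beta> \<le> c i * (real i + 1) powr \<beta>"
              using nonneg by (intro mult_left_mono) auto
            also have "\<dots> \<le> A * (c n * (real n + 1) powr \<beta>)" using below n True by auto
            also have "(real n + 1) powr \<beta> \<le> (2 * x) powr \<beta>"
              using elim beta unfolding n_def by (intro powr_mono2) linarith+
            finally have "c i * (x * y) powr \<beta> \<le> A * (c n * (2 * x) powr \<beta>)"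
              using A cn by (simp add: mult_left_mono)
            hence "c i * y powr \<beta> * x powr \<beta> \<le> A * c n * 2 powr \<beta> * x powr \<beta>"
              using elim \<open>y > 0\<close> by (simp add: powr_mult mult_ac)
            hence "c i * y powr \<beta> \<le> A * c n * 2 powr \<beta>"
              using elim by (subst (asm) mult_le_cancel_right_pos) auto
            hence "c i / c n \<le> A * 2 powr \<beta> * y powr (- \<beta>)"
              using cn \<open>y > 0\<close> by (simp add: powr_minus field_simps)
            thus ?thesis using A' by linarith
          next
            case False
            hence "c i / c n \<le> A'" using above'[of n i] n cn by (simp add: divide_le_eq)
            moreover have "0 \<le> A * 2 powr \<beta> * y powr (- \<beta>)" using A by simp
            ultimately show ?thesis by linarith
          qed
          hence "c i / c n * f x i \<le> (A * 2 powr \<beta> * y powr (- \<beta>) + A') * (B * exp (- y))"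
            using fB A A' by (intro mult_mono) auto
          also have "\<dots> = w y" using True
            by (simp add: w_def \<beta>_def algebra_simps)
          finally show ?thesis using True fB nonneg cn
            by (simp add: s_def n_def i_def abs_mult)
        qed (use y in \<open>auto simp: s_def w_def\<close>)
      qed
    qed
    show "s x \<in> borel_measurable lborel" for x by (rule s_meas)
  qed simp
  moreover have "\<forall>\<^sub>F x in at_top. (\<integral>y. s x y \<partial>lborel) = (\<Sum>i. c i * f x i) / (x * c (nat \<lfloor>x\<rfloor>))"
    using f_nonneg f_summable eventually_gt_at_top[of 0]
  proof eventually_elim
    case (elim x)
    have "(\<Sum>i. c i * f x i) = (\<integral>(z::real). indicator {0..} z * (c (nat \<lfloor>z\<rfloor>) * f x (nat \<lfloor>z\<rfloor>)) \<partial>lborel)"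
      using has_bochner_integral_nat_floor[of "\<lambda>i. c i * f x i"] elim nonneg
      by (simp add: has_bochner_integral_iff)
    also have "\<dots> = x * (\<integral>y. indicator {0..} (x * y) * (c (nat \<lfloor>x * y\<rfloor>) * f x (nat \<lfloor>x * y\<rfloor>)) \<partial>lborel)"
      using elim by (subst lborel_integral_real_affine[where c = x and t = 0]) auto
    also have "(\<integral>y. indicator {0..} (x * y) * (c (nat \<lfloor>x * y\<rfloor>) * f x (nat \<lfloor>x * y\<rfloor>)) \<partial>lborel)
             = (\<integral>y. indicator {0..} y * (c (nat \<lfloor>x * y\<rfloor>) * f x (nat \<lfloor>x * y\<rfloor>)) \<partial>lborel)"
      using elim by (intro Bochner_Integration.integral_cong) (auto simp: indicator_def zero_le_mult_iff)
    finally have "(\<Sum>i. c i * f x i) / (x * c (nat \<lfloor>x\<rfloor>)) =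
        (\<integral>y. indicator {0..} y * (c (nat \<lfloor>x * y\<rfloor>) * f x (nat \<lfloor>x * y\<rfloor>)) \<partial>lborel) / c (nat \<lfloor>x\<rfloor>)"
      using elim by simp
    also have "\<dots> = (\<integral>y. s x y \<partial>lborel)"
      unfolding s_def by (subst integral_divide_zero[symmetric]) (simp add: mult_ac)
    finally show ?case ..
  qed
  ultimately show ?thesis using Lim_transform_eventually by fast
qed

text \<open>The kernel limit for the indicator of \<open>i < nat \<lfloor>v * x\<rfloor>\<close>,
  whose rescaled limit is the indicator of \<open>y < v\<close>; the limit integral is that of
  \<open>y powr (\<gamma> - 1)\<close> over \<open>[0, v]\<close>. The bound
  \<open>exp v * exp (- y)\<close> is at least 1 wherever the kernel is nonzero.\<close>

lemma partial_sums_asymptotics: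
  fixes c :: "nat \<Rightarrow> real"
  assumes rv: "regularly_varying_seq c (\<gamma> - 1)" and gamma: "0 < \<gamma>" "\<gamma> < 1"
    and nonneg: "\<And>n. c n \<ge> 0" and v: "v > 0"
  shows "((\<lambda>x. (\<Sum>i<nat \<lfloor>v * x\<rfloor>. c i) / (x * c (nat \<lfloor>x\<rfloor>))) \<longlongrightarrow> v powr \<gamma> / \<gamma>) at_top"
proof -
  have sum_eq: "(\<Sum>i. c i * of_bool (i < nat \<lfloor>v * x\<rfloor>)) = (\<Sum>i<nat \<lfloor>v * x\<rfloor>. c i)" for x
    by (subst suminf_finite[of "{..<nat \<lfloor>v * x\<rfloor>}"]) auto
  have "((\<lambda>x. (\<Sum>i. c i * of_bool (i < nat \<lfloor>v * x\<rfloor>)) / (x * c (nat \<lfloor>x\<rfloor>))) \<longlongrightarrow>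
           (\<integral>y. indicator {0..} y * (y powr (\<gamma> - 1) * of_bool (y < v)) \<partial>lborel)) at_top"
  proof (rule regularly_varying_seq_kernel_limit[OF rv gamma nonneg, where B = "exp v" and v = v])
    show "\<forall>\<^sub>F x in at_top. \<forall>y>0. of_bool (nat \<lfloor>x * y\<rfloor> < nat \<lfloor>v * x\<rfloor>) \<le> exp v * exp (- y)"
      using eventually_gt_at_top[of 0]
    proof eventually_elim
      case (elim x)
      have "y < v" if "nat \<lfloor>x * y\<rfloor> < nat \<lfloor>v * x\<rfloor>" for y
      proof (rule ccontr)
        assume "\<not> y < v"
        hence "v * x \<le> x * y" using elim by (simp add: mult.commute)
        thus False using that by (meson floor_mono nat_mono not_le)
      qed
      thus ?case by (auto simp flip: exp_add intro: less_imp_le)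
    qed
    show "((\<lambda>x. of_bool (nat \<lfloor>x * y\<rfloor> < nat \<lfloor>v * x\<rfloor>) :: real) \<longlongrightarrow> of_bool (y < v)) at_top"
      if "y > 0" "y \<noteq> v" for y
    proof (cases "y < v")
      case True
      have "\<forall>\<^sub>F x in at_top. x \<ge> 1 / (v - y)" by (rule eventually_ge_at_top)
      hence "\<forall>\<^sub>F x in at_top. of_bool (y < v) = (of_bool (nat \<lfloor>x * y\<rfloor> < nat \<lfloor>v * x\<rfloor>) :: real)"
        using eventually_gt_at_top[of 0]
      proof eventually_elim
        case (elim x)
        hence "v * x \<ge> x * y + 1" using True by (simp add: field_simps)
        moreover have "x * y > 0" using elim that by simp
        ultimately have "nat \<lfloor>x * y\<rfloor> < nat \<lfloor>v * x\<rfloor>" by linarith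
        thus ?case using True by simp
      qed
      thus ?thesis by (rule Lim_transform_eventually[OF tendsto_const])
    next
      case False
      have "\<forall>\<^sub>F x in at_top. of_bool (y < v) = (of_bool (nat \<lfloor>x * y\<rfloor> < nat \<lfloor>v * x\<rfloor>) :: real)"
        using eventually_gt_at_top[of 0]
      proof eventually_elim
        case (elim x)
        hence "v * x \<le> x * y" using False by (simp add: mult.commute)
        hence "\<not> nat \<lfloor>x * y\<rfloor> < nat \<lfloor>v * x\<rfloor>" unfolding not_less by (intro nat_mono floor_mono)
        thus ?case using False by (simp only: of_bool_eq)
      qed
      thus ?thesis by (rule Lim_transform_eventually[OF tendsto_const])
    qed
    show "\<forall>\<^sub>F x in at_top. summable (\<lambda>i. c i * of_bool (i < nat \<lfloor>v * x\<rfloor>))"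
      by (intro always_eventually allI summable_finite[of "{..<nat \<lfloor>v * _\<rfloor>}"]) auto
  qed auto
  moreover have "(\<integral>y. indicator {0..} y * (y powr (\<gamma> - 1) * of_bool (y < v)) \<partial>lborel) = v powr \<gamma> / \<gamma>"
  proof -
    have "((\<lambda>y. y powr (\<gamma> - 1)) has_integral (v powr (\<gamma> - 1 + 1) / (\<gamma> - 1 + 1))) {0..v}"
      using gamma v by (intro has_integral_powr_from_0) auto
    hence "(\<integral>\<^sup>+y. ennreal (indicator {0..v} y * y powr (\<gamma> - 1)) \<partial>lborel) = ennreal (v powr \<gamma> / \<gamma>)"
      using nn_integral_has_integral_lebesgue[of "{0..v}" "\<lambda>y. y powr (\<gamma> - 1)"] by simp
    hence "has_bochner_integral lborel (\<lambda>y. indicator {0..v} y * y powr (\<gamma> - 1)) (v powr \<gamma> / \<gamma>)"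
      using gamma by (intro has_bochner_integral_nn_integral) auto
    hence "(\<integral>y. indicator {0..v} y * y powr (\<gamma> - 1) \<partial>lborel) = v powr \<gamma> / \<gamma>"
      by (simp add: has_bochner_integral_iff)
    moreover have "(\<integral>y. indicator {0..} y * (y powr (\<gamma> - 1) * of_bool (y < v)) \<partial>lborel) =
        (\<integral>y. indicator {0..v} y * y powr (\<gamma> - 1) \<partial>lborel)"
      using AE_lborel_singleton[of v]
      by (intro integral_cong_AE) (auto simp: indicator_def elim: eventually_mono)
    ultimately show ?thesis by simp
  qed
  ultimately show ?thesis by (simp add: sum_eq)
qed

text \<open>The kernel \<open>(1 - 1 / x) ^ i\<close> tends to \<open>exp (- y)\<close> at
  \<open>i = nat \<lfloor>x * y\<rfloor>\<close>, and the limit integral is Euler's integral for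
  \<open>Gamma \<gamma>\<close>. The factor \<open>exp 1\<close> in the bound compensates for the
  rounding of \<open>x * y\<close>.\<close>

lemma power_series_asymptotics:
  fixes c :: "nat \<Rightarrow> real"
  assumes rv: "regularly_varying_seq c (\<gamma> - 1)" and gamma: "0 < \<gamma>" "\<gamma> < 1"
    and nonneg: "\<And>n. c n \<ge> 0"
    and sums: "\<And>x. x \<in> {-1<..<1} \<Longrightarrow> (\<lambda>n. c n * x ^ n) sums g x"
  shows "((\<lambda>x. g (1 - 1 / x) / (x * c (nat \<lfloor>x\<rfloor>))) \<longlongrightarrow> Gamma \<gamma>) at_top"
proof -
  have in01: "1 - 1 / x \<in> {-1<..<1}" "1 - 1 / x \<ge> 0" if "x > 1" for x :: real
    using that by (auto simp: field_simps)
  have lim: "((\<lambda>x. (\<Sum>i. c i * (1 - 1 / x) ^ i) / (x * c (nat \<lfloor>x\<rfloor>))) \<longlongrightarrow>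
           (\<integral>y. indicator {0..} y * (y powr (\<gamma> - 1) * exp (- y)) \<partial>lborel)) at_top"
  proof (rule regularly_varying_seq_kernel_limit[OF rv gamma nonneg, where B = "exp 1" and v = 0])
    show "\<forall>\<^sub>F x::real in at_top. \<forall>i. (1 - 1 / x) ^ i \<ge> 0"
      using eventually_gt_at_top[of 1] by eventually_elim (use in01 in auto)
    show "\<forall>\<^sub>F x in at_top. summable (\<lambda>i. c i * (1 - 1 / x) ^ i)"
      using eventually_gt_at_top[of 1]
      by eventually_elim (use in01 sums in \<open>blast intro: sums_summable\<close>)
    show "\<forall>\<^sub>F x::real in at_top. \<forall>y>0. (1 - 1 / x) ^ nat \<lfloor>x * y\<rfloor> \<le> exp 1 * exp (- y)"
      using eventually_gt_at_top[of 1]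
    proof (eventually_elim, intro allI impI)
      fix x y :: real assume x: "x > 1" and y: "y > 0"
      have "(1 - 1 / x) ^ nat \<lfloor>x * y\<rfloor> \<le> exp (- (1 / x)) ^ nat \<lfloor>x * y\<rfloor>"
        using in01(2)[OF x] exp_ge_add_one_self[of "- (1 / x)"] by (intro power_mono) auto
      also have "\<dots> = exp (- (real (nat \<lfloor>x * y\<rfloor>) / x))"
        by (simp flip: exp_of_nat_mult)
      finally have *: "(1 - 1 / x) ^ nat \<lfloor>x * y\<rfloor> \<le> exp (- (real (nat \<lfloor>x * y\<rfloor>) / x))" .
      have "real (nat \<lfloor>x * y\<rfloor>) \<ge> x * y - 1" by linarith
      hence "real (nat \<lfloor>x * y\<rfloor>) / x \<ge> (x * y - 1) / x" using x by (intro divide_right_mono) auto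
      hence "real (nat \<lfloor>x * y\<rfloor>) / x \<ge> y - 1 / x" using x by (simp add: diff_divide_distrib)
      moreover have "1 / x \<le> 1" using x by simp
      ultimately have "exp (- (real (nat \<lfloor>x * y\<rfloor>) / x)) \<le> exp (1 + - y)"
        by (subst exp_le_cancel_iff) linarith
      with * show "(1 - 1 / x) ^ nat \<lfloor>x * y\<rfloor> \<le> exp 1 * exp (- y)" by (simp only: exp_add)
    qed
    show "((\<lambda>x::real. (1 - 1 / x) ^ nat \<lfloor>x * y\<rfloor>) \<longlongrightarrow> exp (- y)) at_top" if "y > 0" for y
    proof -
      have "((\<lambda>x::real. (1 - 1 / x) powr real (nat \<lfloor>x * y\<rfloor>)) \<longlongrightarrow> exp (- y)) at_top"
        using that by real_asymp
      moreover have "\<forall>\<^sub>F x::real in at_top. (1 - 1 / x) powr real (nat \<lfloor>x * y\<rfloor>) = (1 - 1 / x) ^ nat \<lfloor>x * y\<rfloor>"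
        using eventually_gt_at_top[of 1] by eventually_elim (simp add: powr_realpow)
      ultimately show ?thesis using Lim_transform_eventually by fast
    qed
  qed auto
  have int: "(\<integral>y. indicator {0..} y * (y powr (\<gamma> - 1) * exp (- y)) \<partial>lborel) = Gamma \<gamma>"
    using has_bochner_integral_Gamma[of \<gamma>] gamma by (simp add: has_bochner_integral_iff)
  have ev: "\<forall>\<^sub>F x in at_top. (\<Sum>i. c i * (1 - 1 / x) ^ i) / (x * c (nat \<lfloor>x\<rfloor>)) =
        g (1 - 1 / x) / (x * c (nat \<lfloor>x\<rfloor>))"
    using eventually_gt_at_top[of 1] by eventually_elim (use in01 sums in \<open>simp add: sums_iff\<close>)
  show ?thesis by (rule Lim_transform_eventually[OF lim[unfolded int] ev])
qed

text \<open>Dividing the two preceding limits cancels the common normalisation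
  \<open>x * c (nat \<lfloor>x\<rfloor>)\<close>; then \<open>x = U t\<close> is inserted, where
  \<open>g (1 - 1 / x)\<close> is equivalent to \<open>t\<close>. The constant comes from
  \<open>\<gamma> * Gamma \<gamma> = Gamma (1 + \<gamma>)\<close>.\<close>

lemma partial_sums_inverse_growth:
  fixes c :: "nat \<Rightarrow> real"
  assumes rv: "regularly_varying_seq c (\<gamma> - 1)" and gamma: "0 < \<gamma>" "\<gamma> < 1"
    and nonneg: "\<And>n. c n \<ge> 0"
    and sums: "\<And>x. x \<in> {-1<..<1} \<Longrightarrow> (\<lambda>n. c n * x ^ n) sums g x"
    and U: "inverse_growth g \<gamma> U" and v: "v > 0"
  shows "((\<lambda>t. (\<Sum>i<nat \<lfloor>v * U t\<rfloor>. c i) / t) \<longlongrightarrow> v powr \<gamma> / Gamma (1 + \<gamma>)) at_top"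
proof -
  have fU: "filterlim U at_top at_top" and gU: "(\<lambda>t. g (1 - 1 / U t)) \<sim>[at_top] (\<lambda>t. t)"
    using U by (auto simp: inverse_growth_def)
  have G0: "Gamma \<gamma> \<noteq> 0" using Gamma_real_pos[OF gamma(1)] by linarith
  have lim: "((\<lambda>x. ((\<Sum>i<nat \<lfloor>v * x\<rfloor>. c i) / (x * c (nat \<lfloor>x\<rfloor>))) / (g (1 - 1 / x) / (x * c (nat \<lfloor>x\<rfloor>))))
          \<longlongrightarrow> (v powr \<gamma> / \<gamma>) / Gamma \<gamma>) at_top"
    by (intro tendsto_divide partial_sums_asymptotics[OF rv gamma nonneg v]
        power_series_asymptotics[OF rv gamma nonneg sums] G0)
  have eq: "(v powr \<gamma> / \<gamma>) / Gamma \<gamma> = v powr \<gamma> / Gamma (1 + \<gamma>)"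
  proof -
    have "\<gamma> \<notin> \<int>\<^sub>\<le>\<^sub>0" using nonpos_Ints_nonpos[of \<gamma>] gamma by linarith
    hence "Gamma (1 + \<gamma>) = \<gamma> * Gamma \<gamma>" using Gamma_plus1[of \<gamma>] by (simp add: add.commute)
    thus ?thesis by simp
  qed
  have ev: "\<forall>\<^sub>F x in at_top. ((\<Sum>i<nat \<lfloor>v * x\<rfloor>. c i) / (x * c (nat \<lfloor>x\<rfloor>))) / (g (1 - 1 / x) / (x * c (nat \<lfloor>x\<rfloor>)))
        = (\<Sum>i<nat \<lfloor>v * x\<rfloor>. c i) / g (1 - 1 / x)"
  proof -
    have "filterlim (\<lambda>x::real. nat \<lfloor>x\<rfloor>) at_top at_top" by real_asymp
    moreover have "\<forall>\<^sub>F n in sequentially. c n > 0"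
      using rv by (simp add: regularly_varying_seq_def)
    ultimately have "\<forall>\<^sub>F x::real in at_top. c (nat \<lfloor>x\<rfloor>) > 0"
      using eventually_compose_filterlim by blast
    thus ?thesis using eventually_gt_at_top[of 0] by eventually_elim simp
  qed
  have "((\<lambda>x. (\<Sum>i<nat \<lfloor>v * x\<rfloor>. c i) / g (1 - 1 / x)) \<longlongrightarrow> v powr \<gamma> / Gamma (1 + \<gamma>)) at_top"
    by (rule Lim_transform_eventually[OF lim[unfolded eq] ev])
  from filterlim_compose[OF this fU]
  have 1: "((\<lambda>t. (\<Sum>i<nat \<lfloor>v * U t\<rfloor>. c i) / g (1 - 1 / U t)) \<longlongrightarrow> v powr \<gamma> / Gamma (1 + \<gamma>)) at_top" .
  have 2: "((\<lambda>t. g (1 - 1 / U t) / t) \<longlongrightarrow> 1) at_top"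
  proof (rule asymp_equivD_strong[OF gU])
    show "\<forall>\<^sub>F t in at_top. g (1 - 1 / U t) \<noteq> 0 \<or> t \<noteq> 0"
      using eventually_gt_at_top[of 0] by (rule eventually_mono) auto
  qed
  have lim': "((\<lambda>t. (\<Sum>i<nat \<lfloor>v * U t\<rfloor>. c i) / g (1 - 1 / U t) * (g (1 - 1 / U t) / t))
           \<longlongrightarrow> v powr \<gamma> / Gamma (1 + \<gamma>) * 1) at_top"
    by (intro tendsto_mult 1 2)
  have "\<forall>\<^sub>F t in at_top. g (1 - 1 / U t) \<noteq> 0"
    using order_tendstoD(1)[OF 2, of 0] by (auto elim!: eventually_mono)
  hence ev': "\<forall>\<^sub>F t in at_top. (\<Sum>i<nat \<lfloor>v * U t\<rfloor>. c i) / g (1 - 1 / U t) * (g (1 - 1 / U t) / t) =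
      (\<Sum>i<nat \<lfloor>v * U t\<rfloor>. c i) / t"
    by eventually_elim simp
  show ?thesis using Lim_transform_eventually[OF lim' ev'] by simp
qed

section \<open>Monotone regularly varying functions\<close>

text \<open>Potter bounds for monotone functions: the hypothesis on one doubling is iterated from
  \<open>x\<close> until \<open>y\<close> lies within a factor 2, and monotonicity bridges the last
  gap at the price of the factor \<open>2 powr \<beta>\<close>.\<close>

lemma doubling_lower_bound:
  fixes f :: "real \<Rightarrow> real"
  assumes "x0 > 0" "\<beta> \<ge> 0"
    and mono: "\<And>x y. x0 \<le> x \<Longrightarrow> x \<le> y \<Longrightarrow> f x \<le> f y"
    and pos: "\<And>x. x \<ge> x0 \<Longrightarrow> f x > 0"
    and dbl: "\<And>x. x \<ge> x0 \<Longrightarrow> 2 powr \<beta> * f x \<le> f (2 * x)"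
    and "x0 \<le> x" "x \<le> y"
  shows "(y / x) powr \<beta> * f x \<le> 2 powr \<beta> * f y"
proof -
  obtain k :: nat where k: "y / x < 2 ^ k"
    using real_arch_pow[of 2 "y / x"] by auto
  have "y < 2 ^ k * x" using k assms by (simp add: field_simps)
  thus ?thesis using \<open>x0 \<le> x\<close> \<open>x \<le> y\<close>
  proof (induction k arbitrary: x)
    case (Suc k)
    show ?case
    proof (cases "y \<le> 2 * x")
      case True
      have "(y / x) powr \<beta> \<le> 2 powr \<beta>"
        using Suc.prems True assms(1,2) by (intro powr_mono2) (auto simp: field_simps)
      thus ?thesis using mono[of x y] pos[of x] Suc.prems by (intro mult_mono) auto
    next
      case False
      have "(y / x) powr \<beta> * f x = (y / (2 * x)) powr \<beta> * (2 powr \<beta> * f x)"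
        using Suc.prems assms(1) False by (simp flip: powr_mult mult.assoc)
      also have "\<dots> \<le> (y / (2 * x)) powr \<beta> * f (2 * x)"
        using Suc.prems dbl by (intro mult_left_mono) auto
      also have "\<dots> \<le> 2 powr \<beta> * f y"
        using Suc.prems False assms(1) by (intro Suc.IH) auto
      finally show ?thesis .
    qed
  qed simp
qed

lemma doubling_upper_bound:
  fixes f :: "real \<Rightarrow> real"
  assumes "x0 > 0" "\<beta> \<ge> 0"
    and mono: "\<And>x y. x0 \<le> x \<Longrightarrow> x \<le> y \<Longrightarrow> f x \<le> f y"
    and pos: "\<And>x. x \<ge> x0 \<Longrightarrow> f x > 0"
    and dbl: "\<And>x. x \<ge> x0 \<Longrightarrow> f (2 * x) \<le> 2 powr \<beta> * f x"
    and "x0 \<le> x" "x \<le> y"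
  shows "f y \<le> 2 powr \<beta> * (y / x) powr \<beta> * f x"
proof -
  obtain k :: nat where k: "y / x < 2 ^ k"
    using real_arch_pow[of 2 "y / x"] by auto
  have "y < 2 ^ k * x" using k assms by (simp add: field_simps)
  thus ?thesis using \<open>x0 \<le> x\<close> \<open>x \<le> y\<close>
  proof (induction k arbitrary: x)
    case (Suc k)
    show ?case
    proof (cases "y \<le> 2 * x")
      case True
      have "f y \<le> f (2 * x)" using Suc.prems True by (intro mono) auto
      also have "\<dots> \<le> 2 powr \<beta> * 1 * f x" using dbl[of x] Suc.prems by simp
      also have "\<dots> \<le> 2 powr \<beta> * (y / x) powr \<beta> * f x"
        using Suc.prems pos[of x] assms(1,2)
        by (intro mult_right_mono mult_left_mono) (auto simp: ge_one_powr_ge_zero)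
      finally show ?thesis .
    next
      case False
      have "f y \<le> 2 powr \<beta> * (y / (2 * x)) powr \<beta> * f (2 * x)"
        using Suc.prems False assms(1) by (intro Suc.IH) auto
      also have "\<dots> \<le> 2 powr \<beta> * (y / (2 * x)) powr \<beta> * (2 powr \<beta> * f x)"
        using Suc.prems dbl by (intro mult_left_mono) auto
      also have "\<dots> = 2 powr \<beta> * ((y / (2 * x)) powr \<beta> * 2 powr \<beta>) * f x"
        by (simp only: mult_ac)
      also have "(y / (2 * x)) powr \<beta> * 2 powr \<beta> = (y / x) powr \<beta>"
        using Suc.prems assms(1) False by (simp flip: powr_mult)
      finally show ?thesis .
    qed
  qed simp
qed

lemma antimono_regularly_varying_pos:
  fixes h :: "real \<Rightarrow> real"
  assumes "antimono h" and "regularly_varying h \<rho>"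
  shows "h x > 0"
proof -
  have "\<forall>\<^sub>F t in at_top. h t > 0" using assms(2) by (simp add: regularly_varying_def)
  hence "\<forall>\<^sub>F t in at_top. t \<ge> x \<and> h t > 0"
    using eventually_ge_at_top[of x] by eventually_elim simp
  then obtain t where "t \<ge> x" "h t > 0"
    using eventually_happens'[OF trivial_limit_at_top_linorder] by blast
  thus ?thesis using antimonoD[OF assms(1) \<open>t \<ge> x\<close>] by linarith
qed

text \<open>The increasing function \<open>1 / h\<close> has doubling ratio tending to
  \<open>2 powr \<alpha>\<close>, hence eventually above \<open>2 powr \<beta>\<close>; only the
  scale factor 2 of regular variation enters, through \<open>doubling_lower_bound\<close>.\<close>

lemma antimono_regularly_varying_upper_bound:
  fixes h :: "real \<Rightarrow> real"
  assumes anti: "antimono h" and rv: "regularly_varying h (- \<alpha>)" and beta: "0 \<le> \<beta>" "\<beta> < \<alpha>"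
  shows "\<exists>x0>0. \<forall>x\<ge>x0. \<forall>y\<ge>x. h y \<le> 2 powr \<beta> * (y / x) powr (- \<beta>) * h x"
proof -
  note pos = antimono_regularly_varying_pos[OF anti rv]
  have "((\<lambda>t. h (2 * t) / h t) \<longlongrightarrow> 2 powr (- \<alpha>)) at_top"
    using rv by (simp add: regularly_varying_def)
  moreover have "2 powr (- \<alpha>) < 2 powr (- \<beta>)" using beta by simp
  ultimately have "\<forall>\<^sub>F t in at_top. h (2 * t) / h t < 2 powr (- \<beta>)" by (rule order_tendstoD)
  then obtain x1 where x1: "\<And>x. x \<ge> x1 \<Longrightarrow> h (2 * x) / h x < 2 powr (- \<beta>)"
    by (auto simp: eventually_at_top_linorder)
  define x0 where "x0 = max 1 x1"
  have "h y \<le> 2 powr \<beta> * (y / x) powr (- \<beta>) * h x" if "x \<ge> x0" "y \<ge> x" for x y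
  proof -
    have "(y / x) powr \<beta> * (1 / h x) \<le> 2 powr \<beta> * (1 / h y)"
    proof (rule doubling_lower_bound[of x0 \<beta> "\<lambda>x. 1 / h x" x y])
      show "1 / h x \<le> 1 / h y" if "x \<le> y" for x y
        using antimonoD[OF anti that] pos[of x] pos[of y] by (simp add: frac_le)
      show "2 powr \<beta> * (1 / h x) \<le> 1 / h (2 * x)" if "x \<ge> x0" for x
        using x1[of x] that pos[of x] pos[of "2 * x"]
        by (simp add: x0_def powr_minus field_simps less_imp_le)
    qed (use that pos beta in \<open>auto simp: x0_def\<close>)
    moreover define a b where "a = (y / x) powr \<beta>" and "b = 2 powr \<beta>"
    ultimately have "a * h y \<le> b * h x"
      using pos[of x] pos[of y] by (simp add: field_simps)
    moreover have "a > 0" using that by (simp add: a_def x0_def)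
    ultimately have "h y \<le> b * inverse a * h x" by (simp add: field_simps)
    thus ?thesis by (simp add: a_def b_def powr_minus)
  qed
  thus ?thesis by (intro exI[of _ x0]) (auto simp: x0_def)
qed

lemma antimono_regularly_varying_lower_bound:
  fixes h :: "real \<Rightarrow> real"
  assumes anti: "antimono h" and rv: "regularly_varying h (- \<alpha>)" and beta: "0 \<le> \<beta>" "\<alpha> < \<beta>"
  shows "\<exists>x0>0. \<forall>x\<ge>x0. \<forall>y\<ge>x. h x \<le> 2 powr \<beta> * (y / x) powr \<beta> * h y"
proof -
  note pos = antimono_regularly_varying_pos[OF anti rv]
  have "((\<lambda>t. h (2 * t) / h t) \<longlongrightarrow> 2 powr (- \<alpha>)) at_top"
    using rv by (simp add: regularly_varying_def)
  moreover have "2 powr (- \<beta>) < 2 powr (- \<alpha>)" using beta by simp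
  ultimately have "\<forall>\<^sub>F t in at_top. h (2 * t) / h t > 2 powr (- \<beta>)" by (rule order_tendstoD)
  then obtain x1 where x1: "\<And>x. x \<ge> x1 \<Longrightarrow> h (2 * x) / h x > 2 powr (- \<beta>)"
    by (auto simp: eventually_at_top_linorder)
  define x0 where "x0 = max 1 x1"
  have "h x \<le> 2 powr \<beta> * (y / x) powr \<beta> * h y" if "x \<ge> x0" "y \<ge> x" for x y
  proof -
    have "1 / h y \<le> 2 powr \<beta> * (y / x) powr \<beta> * (1 / h x)"
    proof (rule doubling_upper_bound[of x0 \<beta> "\<lambda>x. 1 / h x" x y])
      show "1 / h x \<le> 1 / h y" if "x \<le> y" for x y
        using antimonoD[OF anti that] pos[of x] pos[of y] by (simp add: frac_le)
      show "1 / h (2 * x) \<le> 2 powr \<beta> * (1 / h x)" if "x \<ge> x0" for x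
        using x1[of x] that pos[of x] pos[of "2 * x"]
        by (simp add: x0_def powr_minus field_simps less_imp_le)
    qed (use that pos beta in \<open>auto simp: x0_def\<close>)
    moreover define a where "a = 2 powr \<beta> * (y / x) powr \<beta>"
    ultimately show ?thesis
      using pos[of x] pos[of y] unfolding a_def[symmetric] by (simp add: field_simps)
  qed
  thus ?thesis by (intro exI[of _ x0]) (auto simp: x0_def)
qed

text \<open>Monotonicity replaces uniform convergence: the varying factor \<open>z t\<close> is
  squeezed by a constant \<open>l\<close> on either side of \<open>z0\<close>, and continuity of
  \<open>l powr \<rho>\<close> closes the gap.\<close>

lemma antimono_regularly_varying_compose:
  fixes h z :: "real \<Rightarrow> real"
  assumes anti: "antimono h" and rv: "regularly_varying h \<rho>"
    and z: "(z \<longlongrightarrow> z0) at_top" and z0: "z0 > 0"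
  shows "((\<lambda>t. h (z t * t) / h t) \<longlongrightarrow> z0 powr \<rho>) at_top"
proof -
  note pos = antimono_regularly_varying_pos[OF anti rv]
  have lim: "((\<lambda>t. h (l * t) / h t) \<longlongrightarrow> l powr \<rho>) at_top" if "l > 0" for l
    using rv that by (simp add: regularly_varying_def)
  have cont: "((\<lambda>l. l powr \<rho>) \<longlongrightarrow> z0 powr \<rho>) (at z0 within A)" for A
    using z0 by (intro tendsto_intros) auto
  show ?thesis
  proof (rule order_tendstoI)
    fix a assume "a < z0 powr \<rho>"
    hence "\<forall>\<^sub>F l in at_right z0. l powr \<rho> > a" by (rule order_tendstoD[OF cont])
    moreover have "\<forall>\<^sub>F l in at_right z0. l > z0" by (simp add: eventually_at_right_less)
    ultimately have "\<forall>\<^sub>F l in at_right z0. l powr \<rho> > a \<and> l > z0" by (rule eventually_conj)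
    then obtain l where l: "l powr \<rho> > a" "l > z0"
      using eventually_happens'[OF trivial_limit_at_right_real] by blast
    have "l > 0" using l z0 by linarith
    show "\<forall>\<^sub>F t in at_top. a < h (z t * t) / h t"
      using order_tendstoD(1)[OF lim[OF \<open>l > 0\<close>] l(1)] order_tendstoD(2)[OF z l(2)] eventually_gt_at_top[of 0]
    proof eventually_elim
      case (elim t)
      have "h (l * t) \<le> h (z t * t)" using elim by (intro antimonoD[OF anti] mult_right_mono) auto
      hence "h (l * t) / h t \<le> h (z t * t) / h t" using pos[of t] by (intro divide_right_mono) auto
      thus ?case using elim by linarith
    qed
  next
    fix a assume "a > z0 powr \<rho>"
    hence "\<forall>\<^sub>F l in at_left z0. l powr \<rho> < a" by (rule order_tendstoD[OF cont])
    moreover have "\<forall>\<^sub>F l in at_left z0. l \<in> {0<..<z0}"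
      using z0 by (intro eventually_at_leftI[of 0]) auto
    ultimately have "\<forall>\<^sub>F l in at_left z0. l powr \<rho> < a \<and> l \<in> {0<..<z0}" by (rule eventually_conj)
    then obtain l where l: "l powr \<rho> < a" "l < z0" "l > 0"
      using eventually_happens'[OF trivial_limit_at_left_real] by auto
    show "\<forall>\<^sub>F t in at_top. h (z t * t) / h t < a"
      using order_tendstoD(2)[OF lim[OF \<open>l > 0\<close>] l(1)] order_tendstoD(1)[OF z l(2)] eventually_gt_at_top[of 0]
    proof eventually_elim
      case (elim t)
      have "h (z t * t) \<le> h (l * t)" using elim by (intro antimonoD[OF anti] mult_right_mono) auto
      hence "h (z t * t) / h t \<le> h (l * t) / h t" using pos[of t] by (intro divide_right_mono) auto
      thus ?case using elim by linarith
    qed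
  qed
qed

text \<open>The substitution \<open>u = 1 / (1 + b * v powr \<gamma>)\<close> maps the positive
  half-line onto the unit interval. With \<open>q = 1 / \<gamma>\<close> all powers of
  \<open>v\<close> cancel, and \<open>p + q = \<alpha>\<close> leaves the exponent
  \<open>- \<alpha>\<close> of the denominator.\<close>

lemma has_bochner_integral_Beta_tail:
  fixes \<alpha> \<gamma> b :: real
  assumes "\<gamma> > 0" "1 / \<gamma> < \<alpha>" "b > 0"
  shows "has_bochner_integral lborel (\<lambda>v. indicator {0..} v * (1 + b * v powr \<gamma>) powr (- \<alpha>))
           (b powr (- (1 / \<gamma>)) / \<gamma> * Beta (1 / \<gamma>) (\<alpha> - 1 / \<gamma>))"
proof -
  define p where "p = \<alpha> - 1 / \<gamma>"
  define q where "q = 1 / \<gamma>"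
  have pq: "p > 0" "q > 0" using assms by (auto simp: p_def q_def)
  define f where "f u = u powr (p - 1) * (1 - u) powr (q - 1)" for u :: real
  define g where "g v = 1 / (1 + b * v powr \<gamma>)" for v :: real
  define g' where "g' v = - (b * (\<gamma> * v powr (\<gamma> - 1))) / (1 + b * v powr \<gamma>)\<^sup>2" for v :: real
  have den: "1 + b * v powr \<gamma> > 0" for v using assms by (intro add_pos_nonneg) auto
  have deriv: "(g has_field_derivative g' v) (at v within {0<..})" if "v \<in> {0<..}" for v
    unfolding g_def g'_def using that den[of v]
    by (auto intro!: derivative_eq_intros simp: power2_eq_square)
  have inj: "inj_on g {0<..}"
  proof (rule inj_onI)
    fix x y assume xy: "x \<in> {0<..}" "y \<in> {0<..}" "g x = g y"
    hence "x powr \<gamma> = y powr \<gamma>" using den[of x] den[of y] assms by (simp add: g_def field_simps)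
    hence "(x powr \<gamma>) powr (1 / \<gamma>) = (y powr \<gamma>) powr (1 / \<gamma>)" by simp
    thus "x = y" using xy assms by (simp add: powr_powr)
  qed
  have image: "g ` {0<..} = {0<..<1}"
  proof
    show "g ` {0<..} \<subseteq> {0<..<1}" using den assms by (auto simp: g_def)
    show "{0<..<1} \<subseteq> g ` {0<..}"
    proof
      fix u :: real assume u: "u \<in> {0<..<1}"
      define v where "v = ((1 / u - 1) / b) powr (1 / \<gamma>)"
      have *: "(1 / u - 1) / b > 0" using u assms by (auto simp: field_simps)
      have "v powr \<gamma> = ((1 / u - 1) / b) powr 1" using assms by (simp add: v_def powr_powr)
      also have "\<dots> = (1 / u - 1) / b" using * by (intro powr_one) auto
      finally have "b * v powr \<gamma> = 1 / u - 1" using assms by (simp only:) simp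
      hence "g v = u" by (simp add: g_def)
      moreover have "v > 0" unfolding v_def using * by (subst powr_gt_zero) auto
      ultimately show "u \<in> g ` {0<..}" by force
    qed
  qed
  have "(f has_integral Beta p q) {0<..<1}"
    using has_integral_Beta_real[OF pq] unfolding f_def[abs_def] has_integral_Icc_iff_Ioo .
  hence int: "f integrable_on {0<..<1}" "integral {0<..<1} f = Beta p q"
    by (simp_all only: has_integral_iff)
  have abs: "f absolutely_integrable_on {0<..<1}"
    by (rule nonnegative_absolutely_integrable_1[OF int(1)]) (simp add: f_def)
  have "(\<lambda>v. \<bar>g' v\<bar> * f (g v)) absolutely_integrable_on {0<..} \<and>
      integral {0<..} (\<lambda>v. \<bar>g' v\<bar> * f (g v)) = Beta p q"
    using has_absolute_integral_change_of_variables_1'[of "{0<..}" g g' f "Beta p q", OF _ deriv inj]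
      int(2) abs unfolding image by simp
  hence "((\<lambda>v. \<bar>g' v\<bar> * f (g v)) has_integral Beta p q) {0<..}"
    using set_lebesgue_integral_eq_integral(1) by (auto simp only: has_integral_iff)
  moreover have "\<bar>g' v\<bar> * f (g v) = b powr q * \<gamma> * (1 + b * v powr \<gamma>) powr (- \<alpha>)" if "v \<in> {0<..}" for v
  proof -
    define d where "d = 1 + b * v powr \<gamma>"
    have d: "d > 0" using den[of v] by (simp add: d_def)
    have v: "v > 0" using that by simp
    have "\<bar>g' v\<bar> = b * \<gamma> * v powr (\<gamma> - 1) * d powr (- 2)"
      using v assms d by (simp add: g'_def abs_mult powr_minus powr_realpow d_def[symmetric] divide_inverse)
    moreover have "1 - g v = b * v powr \<gamma> * d powr (- 1)"
      using d by (simp add: g_def d_def[symmetric] powr_minus field_simps)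
    moreover have "g v = d powr (- 1)" using d by (simp add: g_def d_def[symmetric] powr_minus divide_inverse)
    ultimately have "\<bar>g' v\<bar> * f (g v) = b * \<gamma> * v powr (\<gamma> - 1) * d powr (- 2) *
        ((d powr (- 1)) powr (p - 1) * (b * v powr \<gamma> * d powr (- 1)) powr (q - 1))"
      by (simp add: f_def)
    also have "(d powr (- 1)) powr (p - 1) = d powr (- (p - 1))"
      by (subst powr_powr) simp
    also have "(b * v powr \<gamma> * d powr (- 1)) powr (q - 1) =
        b powr (q - 1) * v powr (\<gamma> * (q - 1)) * d powr (- (q - 1))"
      using v d assms by (subst powr_mult powr_powr)+ simp
    also have "b * \<gamma> * v powr (\<gamma> - 1) * d powr (- 2) * (d powr (- (p - 1)) *
         (b powr (q - 1) * v powr (\<gamma> * (q - 1)) * d powr (- (q - 1)))) =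
         (b * b powr (q - 1)) * \<gamma> * (v powr (\<gamma> - 1) * v powr (\<gamma> * (q - 1))) *
         (d powr (- 2) * (d powr (- (p - 1)) * d powr (- (q - 1))))"
      by (simp only: mult_ac)
    also have "b * b powr (q - 1) = b powr (1 + (q - 1))"
      using assms by (subst powr_add) simp
    also have "b powr (1 + (q - 1)) * \<gamma> * (v powr (\<gamma> - 1) * v powr (\<gamma> * (q - 1))) *
         (d powr (- 2) * (d powr (- (p - 1)) * d powr (- (q - 1)))) = b powr q * \<gamma> * v powr 0 * d powr (- \<alpha>)"
    proof -
      have "(\<gamma> - 1) + \<gamma> * (q - 1) = 0" using assms by (simp add: q_def right_diff_distrib)
      moreover have "- 2 + (- (p - 1) + - (q - 1)) = - \<alpha>" by (simp add: p_def q_def)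
      ultimately show ?thesis by (simp only: powr_add[symmetric]) simp
    qed
    finally show ?thesis using v unfolding d_def by simp
  qed
  ultimately have "((\<lambda>v. b powr q * \<gamma> * (1 + b * v powr \<gamma>) powr (- \<alpha>)) has_integral Beta p q) {0<..}"
    by (rule has_integral_eq[rotated])
  from has_integral_mult_right[OF this, of "1 / (b powr q * \<gamma>)"]
  have "((\<lambda>v. 1 / (b powr q * \<gamma>) * (b powr q * \<gamma> * (1 + b * v powr \<gamma>) powr (- \<alpha>)))
         has_integral (1 / (b powr q * \<gamma>) * Beta p q)) {0<..}" .
  moreover have "1 / (b powr q * \<gamma>) * (b powr q * \<gamma> * x) = x" for x
    using assms by simp
  ultimately have "((\<lambda>v. (1 + b * v powr \<gamma>) powr (- \<alpha>)) has_integral (1 / (b powr q * \<gamma>) * Beta p q)) {0<..}"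
    by (simp only:)
  hence "integral\<^sup>N lborel (\<lambda>v. indicator {0<..} v * (1 + b * v powr \<gamma>) powr (- \<alpha>)) = 1 / (b powr q * \<gamma>) * Beta p q"
    by (rule nn_integral_has_integral_lebesgue[rotated]) auto
  also have "integral\<^sup>N lborel (\<lambda>v. ennreal (indicator {0<..} v * (1 + b * v powr \<gamma>) powr (- \<alpha>))) =
       integral\<^sup>N lborel (\<lambda>v. ennreal (indicator {0..} v * (1 + b * v powr \<gamma>) powr (- \<alpha>)))"
    using AE_lborel_singleton[of 0]
    by (intro nn_integral_cong_AE) (auto simp: indicator_def elim!: eventually_mono)
  finally have "has_bochner_integral lborel (\<lambda>v. indicator {0..} v * (1 + b * v powr \<gamma>) powr (- \<alpha>))
       (1 / (b powr q * \<gamma>) * Beta p q)"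
  proof (intro has_bochner_integral_nn_integral)
    have "Beta p q \<ge> 0" unfolding Beta_def using pq
      by (intro divide_nonneg_pos mult_nonneg_nonneg less_imp_le[OF Gamma_real_pos] Gamma_real_pos) auto
    thus "0 \<le> 1 / (b powr q * \<gamma>) * Beta p q" using assms by simp
  qed auto
  moreover have "1 / (b powr q * \<gamma>) * Beta p q = b powr (- q) / \<gamma> * Beta q p"
    by (simp add: powr_minus Beta_commute divide_inverse)
  ultimately show ?thesis by (simp only: p_def q_def)
qed

section \<open>The sum of the tails over all jump times\<close>

text \<open>The analytic half of the argument, free of probability: \<open>h\<close> stands for the
  tail of the innovations.\<close>

locale gF_asymptotics =
  fixes c :: "nat \<Rightarrow> real" and g U h :: "real \<Rightarrow> real" and \<alpha> \<gamma> :: real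
  assumes rv_c: "regularly_varying_seq c (\<gamma> - 1)"
    and c_nonneg: "\<And>n. c n \<ge> 0"
    and c_null: "c \<longlonglongrightarrow> 0"
    and g_sums: "\<And>x. x \<in> {-1<..<1} \<Longrightarrow> (\<lambda>n. c n * x ^ n) sums g x"
    and U_inverse: "inverse_growth g \<gamma> U"
    and h_anti: "antimono h"
    and rv_h: "regularly_varying h (- \<alpha>)"
    and alpha_pos: "\<alpha> > 0" and alpha_gamma: "1 / \<alpha> < \<gamma>" and gamma_less: "\<gamma> < 1"
begin

definition G :: "nat \<Rightarrow> real" where "G n = (\<Sum>i<n. c i)"

definition c_sup :: real where "c_sup = (SUP i. c i)"

text \<open>Here \<open>m\<close> is minus the mean, and \<theta> will be \<open>1 / c_sup\<close>
  up to a small error. The term of index \<open>k\<close> belongs to a jump at time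
  \<open>Suc k\<close>, since innovations start at time 1.\<close>

definition jump_sum :: "real \<Rightarrow> real \<Rightarrow> real \<Rightarrow> real" where
  "jump_sum m \<theta> t = (\<Sum>k. h (\<theta> * (t + m * G (Suc k))))"

section \<open>Power bounds for \<open>G\<close>, \<open>h\<close> and \<open>U\<close>\<close>

lemma gamma_pos: "\<gamma> > 0"
  using alpha_pos alpha_gamma by (meson divide_pos_pos order.strict_trans zero_less_one)

lemma alpha_gamma': "1 / \<gamma> < \<alpha>"
  using alpha_pos alpha_gamma gamma_pos by (auto simp: field_simps)

lemma Gamma_gamma_pos: "Gamma (1 + \<gamma>) > 0"
  using gamma_pos by (intro Gamma_real_pos) auto

text \<open>Potter bounds lose a little in each exponent; since
  \<open>\<alpha> * \<gamma> > 1\<close>, the losses can be chosen so that the product stays above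
  1. Both exponents are midpoints of the admissible intervals.\<close>

lemma exponents: "\<exists>a b. 0 < a \<and> a < \<alpha> \<and> 0 < b \<and> b < \<gamma> \<and> 1 < a * b"
proof -
  define a where "a = (\<alpha> + 1 / \<gamma>) / 2"
  have a: "1 / \<gamma> < a" "a < \<alpha>" using alpha_gamma' by (auto simp: a_def)
  have a0: "a > 0" using a gamma_pos by (meson divide_pos_pos order.strict_trans zero_less_one)
  define b where "b = (\<gamma> + 1 / a) / 2"
  have "1 / a < \<gamma>" using a a0 gamma_pos by (simp add: field_simps)
  hence b: "1 / a < b" "b < \<gamma>" by (auto simp: b_def)
  have b0: "b > 0" using b a0 by (meson divide_pos_pos order.strict_trans zero_less_one)
  have "1 < a * b" using b a0 by (simp add: field_simps)
  thus ?thesis using a a0 b b0 by blast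
qed

lemma c_bdd: "bdd_above (range c)"
  by (intro bounded_imp_bdd_above convergent_imp_bounded[OF c_null])

lemma c_le: "c n \<le> c_sup"
  unfolding c_sup_def by (rule cSUP_upper[OF _ c_bdd]) auto

lemma c_sup_pos: "c_sup > 0"
proof -
  have "\<forall>\<^sub>F n in sequentially. c n > 0" using rv_c by (simp add: regularly_varying_seq_def)
  then obtain n where "c n > 0" by (auto simp: eventually_sequentially)
  thus ?thesis using c_le[of n] by linarith
qed

lemma G_nonneg: "G n \<ge> 0"
  unfolding G_def by (intro sum_nonneg c_nonneg)

lemma G_Suc: "G (Suc n) = G n + c n"
  by (simp add: G_def)

lemma G_mono: "i \<le> j \<Longrightarrow> G i \<le> G j"
  unfolding G_def by (intro sum_mono2) (auto intro: c_nonneg)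

lemma h_pos: "h x > 0"
  by (rule antimono_regularly_varying_pos[OF h_anti rv_h])

lemma h_measurable [measurable]: "h \<in> borel_measurable borel"
proof -
  have "(\<lambda>x. - h x) \<in> borel_measurable borel"
    by (intro borel_measurable_mono monoI) (auto intro: antimonoD[OF h_anti])
  thus ?thesis by simp
qed

lemma U_at_top: "filterlim U at_top at_top"
  using U_inverse by (simp add: inverse_growth_def)

lemma G_U_limit: "v > 0 \<Longrightarrow> ((\<lambda>t. G (nat \<lfloor>v * U t\<rfloor>) / t) \<longlongrightarrow> v powr \<gamma> / Gamma (1 + \<gamma>)) at_top"
  unfolding G_def
  by (rule partial_sums_inverse_growth[OF rv_c gamma_pos gamma_less c_nonneg g_sums U_inverse])

text \<open>The quotient of the limits at \<open>v = 2\<close> and \<open>v = 1\<close> in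
  \<open>partial_sums_asymptotics\<close> gives the doubling ratio \<open>2 powr \<gamma>\<close>,
  which strictly exceeds \<open>2 powr \<beta>\<close>; iteration does the rest.\<close>

lemma G_potter:
  assumes beta: "0 \<le> \<beta>" "\<beta> < \<gamma>"
  shows "\<exists>x0>0. \<forall>x\<ge>x0. G (nat \<lfloor>x\<rfloor>) > 0 \<and>
           (\<forall>y\<ge>x. (y / x) powr \<beta> * G (nat \<lfloor>x\<rfloor>) \<le> 2 powr \<beta> * G (nat \<lfloor>y\<rfloor>))"
proof -
  have 1: "((\<lambda>x. G (nat \<lfloor>v * x\<rfloor>) / (x * c (nat \<lfloor>x\<rfloor>))) \<longlongrightarrow> v powr \<gamma> / \<gamma>) at_top" if "v > 0" for v
    unfolding G_def by (rule partial_sums_asymptotics[OF rv_c gamma_pos gamma_less c_nonneg that])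
  have "filterlim (\<lambda>x::real. nat \<lfloor>x\<rfloor>) at_top at_top" by real_asymp
  moreover have "\<forall>\<^sub>F n in sequentially. c n > 0"
    using rv_c by (simp add: regularly_varying_seq_def)
  ultimately have cpos: "\<forall>\<^sub>F x::real in at_top. c (nat \<lfloor>x\<rfloor>) > 0"
    using eventually_compose_filterlim by blast
  have lim1: "((\<lambda>x. G (nat \<lfloor>x\<rfloor>) / (x * c (nat \<lfloor>x\<rfloor>))) \<longlongrightarrow> 1 / \<gamma>) at_top"
    using 1[of 1] by simp
  have "((\<lambda>x. (G (nat \<lfloor>2 * x\<rfloor>) / (x * c (nat \<lfloor>x\<rfloor>))) / (G (nat \<lfloor>x\<rfloor>) / (x * c (nat \<lfloor>x\<rfloor>))))
           \<longlongrightarrow> (2 powr \<gamma> / \<gamma>) / (1 / \<gamma>)) at_top"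
    using gamma_pos by (intro tendsto_divide 1 lim1) auto
  moreover have "2 powr \<beta> < (2 powr \<gamma> / \<gamma>) / (1 / \<gamma>)" using beta gamma_pos by simp
  ultimately have ev2: "\<forall>\<^sub>F x in at_top. (G (nat \<lfloor>2 * x\<rfloor>) / (x * c (nat \<lfloor>x\<rfloor>))) / (G (nat \<lfloor>x\<rfloor>) / (x * c (nat \<lfloor>x\<rfloor>))) > 2 powr \<beta>"
    by (rule order_tendstoD)
  have ev1: "\<forall>\<^sub>F x in at_top. G (nat \<lfloor>x\<rfloor>) / (x * c (nat \<lfloor>x\<rfloor>)) > 0"
    using gamma_pos by (intro order_tendstoD(1)[OF lim1]) auto
  have "\<forall>\<^sub>F x::real in at_top. G (nat \<lfloor>x\<rfloor>) > 0 \<and> 2 powr \<beta> * G (nat \<lfloor>x\<rfloor>) \<le> G (nat \<lfloor>2 * x\<rfloor>)"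
    using ev1 ev2 cpos eventually_gt_at_top[of 0]
  proof eventually_elim
    case (elim x)
    define d where "d = x * c (nat \<lfloor>x\<rfloor>)"
    have d: "d > 0" using elim by (simp add: d_def)
    have "G (nat \<lfloor>x\<rfloor>) > 0" using elim(1) d by (simp add: d_def[symmetric] zero_less_divide_iff)
    moreover have "2 powr \<beta> < G (nat \<lfloor>2 * x\<rfloor>) / G (nat \<lfloor>x\<rfloor>)"
      using elim(2) d by (simp add: d_def[symmetric])
    ultimately show ?case by (simp add: less_divide_eq)
  qed
  then obtain x1 where x1: "\<And>x::real. x \<ge> x1 \<Longrightarrow> G (nat \<lfloor>x\<rfloor>) > 0 \<and> 2 powr \<beta> * G (nat \<lfloor>x\<rfloor>) \<le> G (nat \<lfloor>2 * x\<rfloor>)"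
    by (auto simp: eventually_at_top_linorder)
  define x0 where "x0 = max 1 x1"
  have "(y / x) powr \<beta> * G (nat \<lfloor>x\<rfloor>) \<le> 2 powr \<beta> * G (nat \<lfloor>y\<rfloor>)" if "x0 \<le> x" "x \<le> y" for x y
    by (rule doubling_lower_bound[of x0 \<beta> "\<lambda>x. G (nat \<lfloor>x\<rfloor>)" x y])
       (use that beta x1 in \<open>auto simp: x0_def intro!: G_mono nat_mono floor_mono\<close>)
  thus ?thesis using x1 by (intro exI[of _ x0]) (auto simp: x0_def)
qed

lemma G_power_lower_bound:
  assumes beta: "0 \<le> \<beta>" "\<beta> < \<gamma>"
  shows "\<exists>\<kappa>>0. \<forall>\<^sub>F x in at_top. \<kappa> * x powr \<beta> \<le> G (nat \<lfloor>x\<rfloor>)"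
proof -
  obtain x0 where x0: "x0 > 0" "G (nat \<lfloor>x0\<rfloor>) > 0"
    "\<And>y. y \<ge> x0 \<Longrightarrow> (y / x0) powr \<beta> * G (nat \<lfloor>x0\<rfloor>) \<le> 2 powr \<beta> * G (nat \<lfloor>y\<rfloor>)"
    using G_potter[OF beta] by blast
  define \<kappa> where "\<kappa> = x0 powr (- \<beta>) * G (nat \<lfloor>x0\<rfloor>) / 2 powr \<beta>"
  have "\<kappa> > 0" using x0 by (simp add: \<kappa>_def)
  moreover have "\<forall>\<^sub>F x in at_top. \<kappa> * x powr \<beta> \<le> G (nat \<lfloor>x\<rfloor>)"
    using eventually_ge_at_top[of x0]
  proof eventually_elim
    case (elim x)
    have "(x / x0) powr \<beta> = x powr \<beta> * x0 powr (- \<beta>)"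
      using elim x0(1) by (subst powr_divide) (simp_all add: powr_minus divide_inverse)
    thus ?case using x0(3)[OF elim] by (simp add: \<kappa>_def field_simps)
  qed
  ultimately show ?thesis by blast
qed

lemma h_power_upper_bound:
  assumes beta: "0 \<le> \<beta>" "\<beta> < \<alpha>"
  shows "\<exists>K>0. \<forall>\<^sub>F x in at_top. h x \<le> K * x powr (- \<beta>)"
proof -
  obtain x0 where x0: "x0 > 0" "\<And>y. y \<ge> x0 \<Longrightarrow> h y \<le> 2 powr \<beta> * (y / x0) powr (- \<beta>) * h x0"
    using antimono_regularly_varying_upper_bound[OF h_anti rv_h beta] by blast
  define K where "K = 2 powr \<beta> * x0 powr \<beta> * h x0"
  have "K > 0" using x0 h_pos by (simp add: K_def)
  moreover have "\<forall>\<^sub>F x in at_top. h x \<le> K * x powr (- \<beta>)"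
    using eventually_ge_at_top[of x0]
  proof eventually_elim
    case (elim x)
    have "(x / x0) powr (- \<beta>) = x powr (- \<beta>) * x0 powr \<beta>"
      using elim x0(1) by (simp add: powr_divide powr_minus field_simps)
    thus ?case using x0(2)[OF elim] by (simp add: K_def mult_ac)
  qed
  ultimately show ?thesis by blast
qed

lemma h_power_lower_bound: "\<exists>\<kappa>>0. \<forall>\<^sub>F x in at_top. \<kappa> * x powr (- (\<alpha> + 1)) \<le> h x"
proof -
  obtain x0 where x0: "x0 > 0" "\<And>y. y \<ge> x0 \<Longrightarrow> h x0 \<le> 2 powr (\<alpha> + 1) * (y / x0) powr (\<alpha> + 1) * h y"
    using antimono_regularly_varying_lower_bound[OF h_anti rv_h, of "\<alpha> + 1"] alpha_pos by auto
  define \<kappa> where "\<kappa> = h x0 * x0 powr (\<alpha> + 1) / 2 powr (\<alpha> + 1)"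
  have "\<kappa> > 0" using x0 h_pos by (simp add: \<kappa>_def)
  moreover have "\<forall>\<^sub>F x in at_top. \<kappa> * x powr (- (\<alpha> + 1)) \<le> h x"
    using eventually_ge_at_top[of x0]
  proof eventually_elim
    case (elim x)
    define p q r where "p = (2::real) powr (\<alpha> + 1)" and "q = x powr (\<alpha> + 1)" and "r = x0 powr (\<alpha> + 1)"
    have pos: "p > 0" "q > 0" "r > 0" using elim x0 by (auto simp: p_def q_def r_def)
    have "(x / x0) powr (\<alpha> + 1) = q / r"
      using elim x0(1) by (simp add: powr_divide q_def r_def)
    hence "h x0 \<le> p * (q / r) * h x" using x0(2)[OF elim] by (simp add: p_def)
    hence "h x0 * r / p * inverse q \<le> h x" using pos by (simp add: field_simps)
    moreover have "x powr (- (\<alpha> + 1)) = inverse q" unfolding q_def by (rule powr_minus)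
    ultimately show ?case unfolding \<kappa>_def p_def r_def by (simp only:)
  qed
  ultimately show ?thesis by blast
qed

text \<open>This makes remainders of order \<open>t powr (- (\<alpha> + 2))\<close> negligible
  against the main term \<open>U t * h t\<close>.\<close>

lemma U_h_lower_bound: "\<exists>\<kappa>>0. \<forall>\<^sub>F t in at_top. \<kappa> * t powr (- (\<alpha> + 1)) \<le> U t * h t"
proof -
  obtain \<kappa> where k: "\<kappa> > 0" "\<forall>\<^sub>F x in at_top. \<kappa> * x powr (- (\<alpha> + 1)) \<le> h x"
    using h_power_lower_bound by blast
  have "\<forall>\<^sub>F t in at_top. U t \<ge> 1" using U_at_top unfolding filterlim_at_top by blast
  hence "\<forall>\<^sub>F t in at_top. \<kappa> * t powr (- (\<alpha> + 1)) \<le> U t * h t"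
    using k(2)
  proof eventually_elim
    case (elim t)
    have "h t * 1 \<le> h t * U t" using elim h_pos[of t] by (intro mult_left_mono) auto
    thus ?case using elim by (simp add: mult.commute)
  qed
  thus ?thesis using k by blast
qed

text \<open>Since \<open>G\<close> at \<open>U t\<close> is of order \<open>t\<close> and
  \<open>G\<close> grows at least like the power \<open>b\<close>, \<open>U t\<close> is at most of
  order \<open>t powr (1 / b)\<close>, while \<open>h t\<close> is at most of order
  \<open>t powr (- a)\<close>; and \<open>a * b > 1\<close>. This is why squares of jump sums are
  negligible.\<close>

lemma U_h_tendsto_0: "((\<lambda>t. U t * h t) \<longlongrightarrow> 0) at_top"
proof -
  obtain a b where ab: "0 < a" "a < \<alpha>" "0 < b" "b < \<gamma>" "1 < a * b" using exponents by blast
  obtain K where K: "K > 0" "\<forall>\<^sub>F x in at_top. h x \<le> K * x powr (- a)"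
    using h_power_upper_bound[of a] ab by auto
  obtain \<kappa> where k: "\<kappa> > 0" "\<forall>\<^sub>F x in at_top. \<kappa> * x powr b \<le> G (nat \<lfloor>x\<rfloor>)"
    using G_power_lower_bound[of b] ab by auto
  define L where "L = (1 / Gamma (1 + \<gamma>) + 1) / \<kappa>"
  have L: "L > 0" using k Gamma_gamma_pos by (simp add: L_def add_pos_pos)
  have "((\<lambda>t. G (nat \<lfloor>1 * U t\<rfloor>) / t) \<longlongrightarrow> 1 powr \<gamma> / Gamma (1 + \<gamma>)) at_top"
    by (rule G_U_limit) simp
  hence "\<forall>\<^sub>F t in at_top. G (nat \<lfloor>1 * U t\<rfloor>) / t < 1 / Gamma (1 + \<gamma>) + 1"
    by (intro order_tendstoD(2)) auto
  moreover have "\<forall>\<^sub>F t in at_top. \<kappa> * U t powr b \<le> G (nat \<lfloor>U t\<rfloor>)"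
    using eventually_compose_filterlim[OF k(2) U_at_top] .
  moreover have "\<forall>\<^sub>F t in at_top. U t \<ge> 1" using U_at_top unfolding filterlim_at_top by blast
  ultimately have ev: "\<forall>\<^sub>F t in at_top. norm (U t * h t) \<le> L powr (1 / b) * K * t powr (1 / b - a)"
    using K(2) eventually_gt_at_top[of 0]
  proof eventually_elim
    case (elim t)
    have "\<kappa> * U t powr b \<le> (1 / Gamma (1 + \<gamma>) + 1) * t" using elim by (simp add: divide_less_eq)
    hence "U t powr b \<le> L * t" using k by (simp add: L_def field_simps)
    hence "(U t powr b) powr (1 / b) \<le> (L * t) powr (1 / b)" using ab by (intro powr_mono2) auto
    hence U: "U t \<le> L powr (1 / b) * t powr (1 / b)"
      using ab elim L by (simp add: powr_powr powr_mult)
    have "norm (U t * h t) = U t * h t" using elim h_pos[of t] by (simp add: abs_mult)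
    also have "\<dots> \<le> (L powr (1 / b) * t powr (1 / b)) * (K * t powr (- a))"
      using U elim h_pos[of t] by (intro mult_mono) auto
    also have "\<dots> = L powr (1 / b) * K * (t powr (1 / b) * t powr (- a))" by (simp only: mult_ac)
    also have "t powr (1 / b) * t powr (- a) = t powr (1 / b - a)"
      by (simp only: powr_add[symmetric]) simp
    finally show ?case .
  qed
  have "1 / b - a < 0" using ab by (simp add: field_simps)
  hence lim: "((\<lambda>t. L powr (1 / b) * K * t powr (1 / b - a)) \<longlongrightarrow> L powr (1 / b) * K * 0) at_top"
    by (intro tendsto_intros tendsto_neg_powr filterlim_ident)
  show ?thesis by (rule Lim_null_comparison[OF ev]) (use lim in simp)
qed

text \<open>The terms are at most of order \<open>k powr (- (a * b))\<close> with
  \<open>a * b > 1\<close>; this is where \<open>1 / \<alpha> < \<gamma>\<close> is felt.\<close>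

lemma jump_sum_summable:
  assumes "\<theta> > 0" "m > 0" "t \<ge> 0"
  shows "summable (\<lambda>k. h (\<theta> * (t + m * G (Suc k))))"
proof -
  obtain a b where ab: "0 < a" "a < \<alpha>" "0 < b" "b < \<gamma>" "1 < a * b" using exponents by blast
  obtain K where K: "K > 0" "\<forall>\<^sub>F x in at_top. h x \<le> K * x powr (- a)"
    using h_power_upper_bound[of a] ab by auto
  obtain \<kappa> where k: "\<kappa> > 0" "\<forall>\<^sub>F x in at_top. \<kappa> * x powr b \<le> G (nat \<lfloor>x\<rfloor>)"
    using G_power_lower_bound[of b] ab by auto
  define d where "d = \<theta> * m * \<kappa>"
  have d: "d > 0" using assms k by (simp add: d_def)
  have f1: "filterlim (\<lambda>k. real k) at_top sequentially" by (rule filterlim_real_sequentially)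
  have f2: "filterlim (\<lambda>k. d * real k powr b) at_top sequentially"
    using d ab by real_asymp
  have ev: "\<forall>\<^sub>F k in sequentially. norm (h (\<theta> * (t + m * G (Suc k)))) \<le> K * d powr (- a) * real k powr (- (a * b))"
    using eventually_compose_filterlim[OF K(2) f2] eventually_compose_filterlim[OF k(2) f1]
  proof eventually_elim
    case (elim k)
    have "\<kappa> * real k powr b \<le> G (Suc k)"
      using elim(2) G_mono[of k "Suc k"] by simp
    hence "\<theta> * (m * (\<kappa> * real k powr b)) \<le> \<theta> * (t + m * G (Suc k))"
      using assms by (intro mult_left_mono add_increasing mult_left_mono) auto
    hence "h (\<theta> * (t + m * G (Suc k))) \<le> h (d * real k powr b)"
      by (intro antimonoD[OF h_anti]) (simp add: d_def mult_ac)
    also have "\<dots> \<le> K * (d * real k powr b) powr (- a)" using elim by simp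
    also have "(d * real k powr b) powr (- a) = d powr (- a) * real k powr (- (a * b))"
      using d by (simp add: powr_mult powr_powr mult.commute)
    finally show ?case using h_pos[of "\<theta> * (t + m * G (Suc k))"] by (simp add: mult_ac)
  qed
  have "summable (\<lambda>k. real k powr (- (a * b)))"
    using ab by (subst summable_real_powr_iff) auto
  hence "summable (\<lambda>k. K * d powr (- a) * real k powr (- (a * b)))" by (rule summable_mult)
  thus ?thesis by (rule summable_comparison_test_ev[OF ev])
qed

text \<open>At \<open>k = nat \<lfloor>v * U t\<rfloor>\<close> the level divided by
  \<open>t\<close> tends to \<open>1 + w0 * v powr \<gamma>\<close>, so the integrand tends to a
  power of it. For \<open>v < 1\<close> the level is bounded below by \<open>t\<close>; for
  \<open>v \<ge> 1\<close> the Potter bounds for \<open>G\<close> and then for \<open>h\<close> give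
  the integrable majorant \<open>v powr (- (a * b))\<close>.\<close>

lemma jump_sum_asymptotics:
  assumes theta: "\<theta> > 0" and m: "m > 0"
  shows "((\<lambda>t. jump_sum m \<theta> t / (U t * h t)) \<longlongrightarrow>
     \<theta> powr (- \<alpha>) * ((m / Gamma (1 + \<gamma>)) powr (- (1 / \<gamma>)) / \<gamma> * Beta (1 / \<gamma>) (\<alpha> - 1 / \<gamma>))) at_top"
proof -
  define w0 where "w0 = m / Gamma (1 + \<gamma>)"
  have w0: "w0 > 0" using m Gamma_gamma_pos by (simp add: w0_def)
  define N where "N t v = Suc (nat \<lfloor>v * U t\<rfloor>)" for t v
  define s where "s t v = indicator {0..} v * (h (\<theta> * (t + m * G (N t v))) / h t)" for t v
  have [measurable]: "(\<lambda>v. s t v) \<in> borel_measurable borel" for t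
    unfolding s_def N_def by measurable
  obtain a b where ab: "0 < a" "a < \<alpha>" "0 < b" "b < \<gamma>" "1 < a * b" using exponents by blast
  obtain x0 where x0: "x0 > 0" "\<And>x y. x \<ge> x0 \<Longrightarrow> y \<ge> x \<Longrightarrow> h y \<le> 2 powr a * (y / x) powr (- a) * h x"
    using antimono_regularly_varying_upper_bound[OF h_anti rv_h, of a] ab by auto
  obtain y0 where y0: "y0 > 0" "\<And>x. x \<ge> y0 \<Longrightarrow> G (nat \<lfloor>x\<rfloor>) > 0"
       "\<And>x y. x \<ge> y0 \<Longrightarrow> y \<ge> x \<Longrightarrow> (y / x) powr b * G (nat \<lfloor>x\<rfloor>) \<le> 2 powr b * G (nat \<lfloor>y\<rfloor>)"
    using G_potter[of b] ab by auto
  \<comment> \<open>Twice the limit of \<open>h (\<theta> * t) / h t\<close>, hence an eventual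
    bound for this ratio.\<close>
  define K where "K = 2 * \<theta> powr (- \<alpha>)"
  have K: "K > 0" using theta by (simp add: K_def)
  \<comment> \<open>An eventual lower bound for \<open>m * G (N t v) / (t * v powr b)\<close> when
    \<open>v \<ge> 1\<close>: half of the limit \<open>1 / Gamma (1 + \<gamma>)\<close> of
    \<open>G (nat \<lfloor>U t\<rfloor>) / t\<close>, times the loss \<open>2 powr (- b)\<close> in
    the Potter bound.\<close>
  define \<kappa> where "\<kappa> = m * (2 powr (- b) / (2 * Gamma (1 + \<gamma>)))"
  have kappa: "\<kappa> > 0" using m Gamma_gamma_pos by (simp add: \<kappa>_def)
  define w where "w v = K * indicator {0..1} v + 2 powr a * K * \<kappa> powr (- a) * (indicator {1..} v * v powr (- (a * b)))"
    for v :: real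
  have U1: "\<forall>\<^sub>F t in at_top. U t \<ge> max y0 1" using U_at_top unfolding filterlim_at_top by blast
  have tpos: "\<forall>\<^sub>F t::real in at_top. t > 0" by (rule eventually_gt_at_top)
  have int_w: "integrable lborel w"
  proof -
    have "((\<lambda>v. v powr (- (a * b))) has_integral - (1 powr (- (a * b) + 1)) / (- (a * b) + 1)) {1..}"
      using ab by (intro has_integral_powr_to_inf) auto
    hence "integral\<^sup>N lborel (\<lambda>v. indicator {1..} v * v powr (- (a * b))) = ennreal (- (1 powr (- (a * b) + 1)) / (- (a * b) + 1))"
      by (rule nn_integral_has_integral_lebesgue[rotated]) auto
    hence "integral\<^sup>N lborel (\<lambda>v. indicator {1..} v * v powr (- (a * b))) < \<infinity>" by simp
    hence "integrable lborel (\<lambda>v::real. indicator {1..} v * v powr (- (a * b)))"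
      by (intro integrableI_nonneg) auto
    moreover have "integrable lborel (indicator {0..1} :: real \<Rightarrow> real)"
      by (rule integrable_real_indicator) auto
    ultimately show ?thesis
      unfolding w_def by (intro Bochner_Integration.integrable_add integrable_mult_right)
  qed
  have lim: "((\<lambda>t. \<integral>v. s t v \<partial>lborel) \<longlongrightarrow>
      (\<integral>v. \<theta> powr (- \<alpha>) * (indicator {0..} v * (1 + w0 * v powr \<gamma>) powr (- \<alpha>)) \<partial>lborel)) at_top"
  proof (rule integral_dominated_convergence_at_top[where w = w])
    show "AE v in lborel. ((\<lambda>t. s t v) \<longlongrightarrow> \<theta> powr (- \<alpha>) * (indicator {0..} v * (1 + w0 * v powr \<gamma>) powr (- \<alpha>))) at_top"
      using AE_lborel_singleton[of 0]
    proof eventually_elim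
      case (elim v)
      show ?case
      proof (cases "v > 0")
        case True
        \<comment> \<open>\<theta> times the level divided by \<open>t\<close>. The separate
          coefficient accounts for the successor in \<open>N\<close>; being bounded, it vanishes
          after division by \<open>t\<close>.\<close>
        define z where "z t = \<theta> * (1 + m * (G (nat \<lfloor>v * U t\<rfloor>) / t + c (nat \<lfloor>v * U t\<rfloor>) / t))" for t
        have "((\<lambda>t. c (nat \<lfloor>v * U t\<rfloor>) / t) \<longlongrightarrow> 0) at_top"
        proof (rule Lim_null_comparison)
          show "\<forall>\<^sub>F t in at_top. norm (c (nat \<lfloor>v * U t\<rfloor>) / t) \<le> c_sup / t"
            using tpos by eventually_elim (auto simp: c_nonneg intro!: divide_right_mono c_le)
          show "((\<lambda>t. c_sup / t) \<longlongrightarrow> 0) at_top"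
            by (intro tendsto_divide_0[OF tendsto_const] filterlim_at_top_imp_at_infinity filterlim_ident)
        qed
        hence "(z \<longlongrightarrow> \<theta> * (1 + m * (v powr \<gamma> / Gamma (1 + \<gamma>) + 0))) at_top"
          unfolding z_def by (intro tendsto_intros G_U_limit True)
        moreover have "\<theta> * (1 + m * (v powr \<gamma> / Gamma (1 + \<gamma>) + 0)) = \<theta> * (1 + w0 * v powr \<gamma>)"
          by (simp add: w0_def)
        moreover have pos: "\<theta> * (1 + w0 * v powr \<gamma>) > 0"
          using theta w0 by (intro mult_pos_pos add_pos_nonneg) auto
        ultimately have "((\<lambda>t. h (z t * t) / h t) \<longlongrightarrow> (\<theta> * (1 + w0 * v powr \<gamma>)) powr (- \<alpha>)) at_top"
          by (intro antimono_regularly_varying_compose[OF h_anti rv_h]) auto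
        moreover have "\<forall>\<^sub>F t in at_top. h (z t * t) / h t = s t v"
          using tpos
        proof eventually_elim
          case (elim t)
          have "z t * t = \<theta> * (t + m * G (N t v))"
            using elim by (simp add: z_def N_def G_Suc field_simps)
          thus ?case using True by (simp add: s_def)
        qed
        ultimately have "((\<lambda>t. s t v) \<longlongrightarrow> (\<theta> * (1 + w0 * v powr \<gamma>)) powr (- \<alpha>)) at_top"
          by (rule Lim_transform_eventually)
        moreover have "(\<theta> * (1 + w0 * v powr \<gamma>)) powr (- \<alpha>) =
            \<theta> powr (- \<alpha>) * (indicator {0..} v * (1 + w0 * v powr \<gamma>) powr (- \<alpha>))"
          using True theta w0 by (simp add: powr_mult)
        ultimately show ?thesis by (simp only:)
      qed (use elim in \<open>auto simp: s_def\<close>)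
    qed
    have "((\<lambda>t. h (\<theta> * t) / h t) \<longlongrightarrow> \<theta> powr (- \<alpha>)) at_top"
      using rv_h theta by (simp add: regularly_varying_def)
    hence hK: "\<forall>\<^sub>F t in at_top. h (\<theta> * t) / h t < K"
      using theta by (intro order_tendstoD(2)) (auto simp: K_def)
    have "((\<lambda>t. G (nat \<lfloor>1 * U t\<rfloor>) / t) \<longlongrightarrow> 1 powr \<gamma> / Gamma (1 + \<gamma>)) at_top"
      by (rule G_U_limit) simp
    hence GU: "\<forall>\<^sub>F t in at_top. G (nat \<lfloor>1 * U t\<rfloor>) / t > 1 / (2 * Gamma (1 + \<gamma>))"
      using Gamma_gamma_pos by (intro order_tendstoD(1)) (auto simp: field_simps)
    have tx: "\<forall>\<^sub>F t in at_top. t \<ge> x0 / \<theta>" by (rule eventually_ge_at_top)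
    show "\<forall>\<^sub>F t in at_top. AE v in lborel. norm (s t v) \<le> w v"
      using hK GU U1 tpos tx
    proof eventually_elim
      case (elim t)
      have tx0: "\<theta> * t \<ge> x0" using elim theta by (simp add: field_simps)
      have "norm (s t v) \<le> w v" for v
      proof -
        consider "v < 0" | "v \<in> {0..<1}" | "v \<ge> 1" by fastforce
        thus ?thesis
        proof cases
          case 1
          thus ?thesis by (simp add: s_def w_def)
        next
          case 2
          have "h (\<theta> * (t + m * G (N t v))) \<le> h (\<theta> * t)"
            using theta m G_nonneg[of "N t v"] by (intro antimonoD[OF h_anti] mult_left_mono) auto
          hence "h (\<theta> * (t + m * G (N t v))) / h t \<le> h (\<theta> * t) / h t"
            using h_pos[of t] by (intro divide_right_mono) auto
          thus ?thesis using 2 elim h_pos[of t] h_pos[of "\<theta> * (t + m * G (N t v))"] by (simp add: s_def w_def)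
        next
          case 3
          have "U t \<le> v * U t" using 3 elim by (simp add: mult_le_cancel_right1)
          hence "(v * U t / U t) powr b * G (nat \<lfloor>U t\<rfloor>) \<le> 2 powr b * G (nat \<lfloor>v * U t\<rfloor>)"
            using elim by (intro y0(3)) auto
          hence "v powr b * G (nat \<lfloor>U t\<rfloor>) \<le> 2 powr b * G (nat \<lfloor>v * U t\<rfloor>)"
            using elim by simp
          also have "\<dots> \<le> 2 powr b * G (N t v)" unfolding N_def by (intro mult_left_mono G_mono) auto
          finally have "2 powr (- b) * v powr b * G (nat \<lfloor>U t\<rfloor>) \<le> G (N t v)"
            by (simp add: powr_minus field_simps)
          moreover have "1 / (2 * Gamma (1 + \<gamma>)) * t \<le> G (nat \<lfloor>U t\<rfloor>)"
            using elim by (simp add: less_divide_eq)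
          hence "2 powr (- b) * v powr b * (1 / (2 * Gamma (1 + \<gamma>)) * t) \<le> 2 powr (- b) * v powr b * G (nat \<lfloor>U t\<rfloor>)"
            by (intro mult_left_mono) auto
          ultimately have "2 powr (- b) * v powr b * (1 / (2 * Gamma (1 + \<gamma>)) * t) \<le> G (N t v)" by linarith
          hence "m * (2 powr (- b) * v powr b * (1 / (2 * Gamma (1 + \<gamma>)) * t)) \<le> m * G (N t v)"
            using m by (intro mult_left_mono) auto
          hence "\<kappa> * v powr b * t \<le> m * G (N t v)" by (simp add: \<kappa>_def mult_ac)
          hence "\<kappa> * v powr b * t \<le> t + m * G (N t v)" using elim by linarith
          hence base: "\<kappa> * v powr b \<le> (\<theta> * (t + m * G (N t v))) / (\<theta> * t)"
            using elim theta by (simp add: le_divide_eq)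
          have "h (\<theta> * (t + m * G (N t v))) \<le>
              2 powr a * ((\<theta> * (t + m * G (N t v))) / (\<theta> * t)) powr (- a) * h (\<theta> * t)"
            using theta m G_nonneg[of "N t v"] by (intro x0(2)[OF tx0] mult_left_mono) auto
          also have "\<dots> \<le> 2 powr a * (\<kappa> * v powr b) powr (- a) * (K * h t)"
          proof (intro mult_mono mult_left_mono)
            show "((\<theta> * (t + m * G (N t v))) / (\<theta> * t)) powr (- a) \<le> (\<kappa> * v powr b) powr (- a)"
              using base kappa 3 ab by (intro powr_mono2') auto
            show "h (\<theta> * t) \<le> K * h t" using elim h_pos[of t] by (simp add: divide_less_eq)
          qed (use h_pos in \<open>auto intro: less_imp_le\<close>)
          also have "(\<kappa> * v powr b) powr (- a) = \<kappa> powr (- a) * v powr (- (a * b))"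
            using kappa by (simp add: powr_mult powr_powr mult.commute)
          finally have "h (\<theta> * (t + m * G (N t v))) / h t \<le> 2 powr a * (\<kappa> powr (- a) * v powr (- (a * b))) * K"
            using h_pos[of t] by (simp add: divide_le_eq mult_ac)
          also have "\<dots> \<le> w v" using 3 K by (simp add: w_def mult_ac)
          finally show ?thesis using 3 h_pos[of t] h_pos[of "\<theta> * (t + m * G (N t v))"] by (simp add: s_def)
        qed
      qed
      thus ?case by simp
    qed
  qed (use int_w in auto)
  have ev: "\<forall>\<^sub>F t in at_top. (\<integral>v. s t v \<partial>lborel) = jump_sum m \<theta> t / (U t * h t)"
    using U1 tpos
  proof eventually_elim
    case (elim t)
    define f where "f k = h (\<theta> * (t + m * G (Suc k)))" for k
    have "has_bochner_integral lborel (\<lambda>x::real. indicator {0..} x * f (nat \<lfloor>x\<rfloor>)) (suminf f)"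
      using jump_sum_summable[OF theta m, of t] elim h_pos
      by (intro has_bochner_integral_nat_floor) (auto simp: f_def less_imp_le)
    hence "jump_sum m \<theta> t = (\<integral>(x::real). indicator {0..} x * f (nat \<lfloor>x\<rfloor>) \<partial>lborel)"
      by (simp add: has_bochner_integral_iff jump_sum_def f_def[abs_def])
    also have "\<dots> = U t * (\<integral>v. indicator {0..} (U t * v) * f (nat \<lfloor>U t * v\<rfloor>) \<partial>lborel)"
      using elim by (subst lborel_integral_real_affine[where c = "U t" and t = 0]) auto
    also have "(\<integral>v. indicator {0..} (U t * v) * f (nat \<lfloor>U t * v\<rfloor>) \<partial>lborel) = (\<integral>v. h t * s t v \<partial>lborel)"
      using elim h_pos[of t]
      by (intro Bochner_Integration.integral_cong)
         (auto simp: indicator_def zero_le_mult_iff s_def f_def N_def mult.commute[of "U t"])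
    finally show ?case using elim h_pos[of t] by simp
  qed
  have int_eq: "(\<integral>v. \<theta> powr (- \<alpha>) * (indicator {0..} v * (1 + w0 * v powr \<gamma>) powr (- \<alpha>)) \<partial>lborel) =
     \<theta> powr (- \<alpha>) * (w0 powr (- (1 / \<gamma>)) / \<gamma> * Beta (1 / \<gamma>) (\<alpha> - 1 / \<gamma>))"
    using has_bochner_integral_Beta_tail[OF gamma_pos alpha_gamma' w0]
    by (subst integral_mult_right_zero) (simp add: has_bochner_integral_iff)
  show ?thesis
    using Lim_transform_eventually[OF lim ev] unfolding int_eq unfolding w0_def .
qed

end

section \<open>Weighted sums of innovations with negative mean\<close>

lemma exp_le_quadratic:
  fixes x :: real
  assumes "\<bar>x\<bar> \<le> 1"
  shows "exp x \<le> 1 + x + x\<^sup>2"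
proof (cases "x \<ge> 0")
  case True
  thus ?thesis using exp_bound[of x] assms by simp
next
  case False
  have "exp x * (1 - x) \<le> exp x * exp (- x)"
    using exp_ge_add_one_self[of "- x"] by (intro mult_left_mono) auto
  also have "\<dots> = 1" by (simp flip: exp_add)
  also have "1 \<le> (1 + x + x\<^sup>2) * (1 - x)"
  proof -
    have "(1 + x + x\<^sup>2) * (1 - x) = 1 - x * x\<^sup>2" by (simp add: algebra_simps power2_eq_square)
    moreover have "x * x\<^sup>2 \<le> 0" using False by (intro mult_nonpos_nonneg) auto
    ultimately show ?thesis by linarith
  qed
  finally show ?thesis using False by (subst (asm) mult_le_cancel_right_pos) auto
qed

text \<open>Replacing the square by \<open>\<xi> * \<bar>x\<bar>\<close> for small \<open>x\<close>
  makes the second-order term integrable under a first moment alone; values beyond \<xi> are charged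
  to their probability.\<close>

lemma exp_le_truncated:
  fixes x :: real
  assumes "- \<xi> \<le> x" "x \<le> b" "0 < \<xi>" "\<xi> \<le> 1"
  shows "exp x \<le> 1 + x + \<xi> * \<bar>x\<bar> + exp b * (if x > \<xi> then 1 else 0)"
proof (cases "x > \<xi>")
  case True
  have "exp x \<le> exp b" using assms by simp
  moreover have "\<xi> * \<bar>x\<bar> \<ge> 0" using assms by simp
  moreover have "(if x > \<xi> then 1 else 0) = (1 :: real)" using True by simp
  ultimately show ?thesis using True assms by (simp only: mult_1_right)
next
  case False
  have "x\<^sup>2 = \<bar>x\<bar> * \<bar>x\<bar>" by (simp add: power2_eq_square)
  also have "\<dots> \<le> \<xi> * \<bar>x\<bar>" using assms False by (intro mult_right_mono) auto
  finally have "x\<^sup>2 \<le> \<xi> * \<bar>x\<bar>" .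
  moreover have "exp x \<le> 1 + x + x\<^sup>2" using assms False by (intro exp_le_quadratic) auto
  ultimately show ?thesis using False by simp
qed

text \<open>The exponent is linear in the weight \<open>w\<close>, so that the bounds for
  independent summands multiply to one involving only the total weight. Its three terms are the
  error \<eta> in the mean left by truncation from below, the second-order term, and the
  contribution of innovations of size about \<open>\<xi> / s\<close>.\<close>

lemma (in real_distribution) truncated_mgf_bound:
  fixes K B m \<eta> \<xi> A C q s w cs x1 :: real
  assumes int: "integrable M (\<lambda>x. x)"
    and K: "K \<ge> 0" and B: "B \<ge> 0" and m: "m \<ge> 0"
    and EK: "expectation (\<lambda>x. max (- K) x) \<le> - m + \<eta>"
    and A: "expectation (\<lambda>x. \<bar>x\<bar>) + m \<le> A"
    and tail: "\<And>x. x \<ge> x1 \<Longrightarrow> prob {x<..} \<le> C * x powr (- q)"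
    and x1: "x1 > 0" and q: "q \<ge> 1" and C: "C \<ge> 0" and cs: "cs > 0"
    and s: "s > 0" and w: "0 \<le> w" "w \<le> cs" and xi: "0 < \<xi>" "\<xi> \<le> 1"
    and small: "s * cs * K \<le> \<xi>" "s * cs * m \<le> \<xi> / 2" "2 * s * cs * x1 \<le> \<xi>"
  shows "expectation (\<lambda>x. exp (s * (w * (max (- K) (min x B) + m)))) \<le>
    exp (w * (s * \<eta> + \<xi> * s * A + exp (s * cs * (B + m)) * C * (2 * s / \<xi>) powr q * cs powr (q - 1)))"
proof (cases "w = 0")
  case True
  thus ?thesis by (simp add: prob_space)
next
  case False
  hence w0: "w > 0" using w by simp
  have univ: "prob UNIV = 1" using prob_space by simp
  define u where "u = s * w"
  have u: "u > 0" "u \<le> s * cs" using w0 w s by (auto simp: u_def)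
  define Y where "Y x = max (- K) (min x B) + m" for x :: real
  define b where "b = s * cs * (B + m)"
  have [measurable]: "Y \<in> borel_measurable borel" unfolding Y_def by measurable
  have Y_abs: "\<bar>Y x\<bar> \<le> \<bar>x\<bar> + m" for x using K B m unfolding Y_def by (auto simp: min_def max_def)
  have Y_bounds: "- K \<le> Y x" "Y x \<le> B + m" for x using K B m unfolding Y_def by auto
  have int_abs: "integrable M (\<lambda>x. \<bar>x\<bar>)" using int by (rule integrable_abs)
  have int_Y: "integrable M Y"
    by (rule Bochner_Integration.integrable_bound[where f = "\<lambda>x. \<bar>x\<bar> + m"])
       (use int_abs Y_abs m in \<open>auto intro!: Bochner_Integration.integrable_add\<close>)
  have int_max: "integrable M (\<lambda>x. max (- K) x)" using int by (intro integrable_max) auto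
  have lower: "- \<xi> \<le> u * Y x" for x
  proof -
    have "u * (- K) \<le> u * Y x" using Y_bounds u by (intro mult_left_mono) auto
    moreover have "u * K \<le> s * cs * K" using u K by (intro mult_right_mono) auto
    ultimately show ?thesis using small by simp
  qed
  have upper: "u * Y x \<le> b" for x
  proof -
    have "u * Y x \<le> u * (B + m)" using Y_bounds u by (intro mult_left_mono) auto
    also have "\<dots> \<le> s * cs * (B + m)" using u B m by (intro mult_right_mono) auto
    finally show ?thesis by (simp add: b_def)
  qed
  have um: "u * m \<le> \<xi> / 2" using mult_right_mono[OF u(2) m] small by linarith
  \<comment> \<open>Here \<open>Y x > \<xi> / u\<close>, and the shift \<open>m\<close> is at most
    half of that bound, so the innovation itself exceeds the other half.\<close>
  have big: "x > \<xi> / (2 * u)" if "u * Y x > \<xi>" for x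
  proof -
    have "Y x > \<xi> / u" using that u by (simp add: divide_less_eq mult.commute)
    moreover have "\<xi> / u \<ge> 2 * m" using um u by (simp add: le_divide_eq mult_ac)
    moreover have "\<xi> / (2 * u) = \<xi> / u / 2" by simp
    ultimately show ?thesis using K m unfolding Y_def by (auto simp: max_def min_def split: if_splits)
  qed
  have "\<xi> / (2 * u) \<ge> x1"
  proof -
    have "2 * u * x1 \<le> 2 * (s * cs) * x1" using u x1 by (intro mult_right_mono mult_left_mono) auto
    hence "2 * u * x1 \<le> \<xi>" using small by simp
    thus ?thesis using u by (simp add: le_divide_eq mult_ac)
  qed
  note tail' = tail[OF this]
  have "expectation (\<lambda>x. exp (u * Y x)) \<le>
      expectation (\<lambda>x. 1 + u * Y x + \<xi> * (u * (\<bar>x\<bar> + m)) + exp b * indicator {\<xi> / (2 * u)<..} x)"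
  proof (rule integral_mono)
    show "integrable M (\<lambda>x. exp (u * Y x))"
      by (rule integrable_const_bound[where B = "exp b"]) (use upper in auto)
    show "integrable M (\<lambda>x. 1 + u * Y x + \<xi> * (u * (\<bar>x\<bar> + m)) + exp b * indicator {\<xi> / (2 * u)<..} x)"
      using int_Y int_abs by (intro Bochner_Integration.integrable_add integrable_mult_right)
        (auto simp: integrable_indicator_iff emeasure_eq_measure)
    fix x
    have "exp (u * Y x) \<le> 1 + u * Y x + \<xi> * \<bar>u * Y x\<bar> + exp b * (if u * Y x > \<xi> then 1 else 0)"
      by (rule exp_le_truncated[OF lower upper xi])
    also have "\<xi> * \<bar>u * Y x\<bar> \<le> \<xi> * (u * (\<bar>x\<bar> + m))"
      using Y_abs[of x] u xi by (simp add: abs_mult)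
    also have "exp b * (if u * Y x > \<xi> then 1 else 0) \<le> exp b * indicator {\<xi> / (2 * u)<..} x"
      using big[of x] by (intro mult_left_mono) (auto simp: indicator_def)
    finally show "exp (u * Y x) \<le> 1 + u * Y x + \<xi> * (u * (\<bar>x\<bar> + m)) + exp b * indicator {\<xi> / (2 * u)<..} x"
      by simp
  qed
  also have "\<dots> = 1 + u * expectation Y + \<xi> * (u * (expectation (\<lambda>x. \<bar>x\<bar>) + m)) + exp b * prob {\<xi> / (2 * u)<..}"
    using int_Y int_abs by (simp add: univ integrable_indicator_iff emeasure_eq_measure)
  also have "\<dots> \<le> 1 + u * \<eta> + \<xi> * (u * A) + exp b * (C * (\<xi> / (2 * u)) powr (- q))"
  proof (intro add_mono mult_left_mono)
    have "expectation Y \<le> expectation (\<lambda>x. max (- K) x + m)"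
      by (rule integral_mono) (use int_Y int_max K B in \<open>auto simp: Y_def\<close>)
    also have "\<dots> = expectation (\<lambda>x. max (- K) x) + m"
      using int_max by (simp add: univ)
    finally show "expectation Y \<le> \<eta>" using EK by linarith
  qed (use u xi A tail' in auto)
  also have "(\<xi> / (2 * u)) powr (- q) = (2 * s / \<xi>) powr q * w powr q"
  proof -
    have "(\<xi> / (2 * u)) powr (- q) = (2 * u / \<xi>) powr q"
      using u xi by (simp add: powr_minus powr_divide)
    also have "2 * u / \<xi> = (2 * s / \<xi>) * w" by (simp add: u_def)
    also have "\<dots> powr q = (2 * s / \<xi>) powr q * w powr q" by (rule powr_mult)
    finally show ?thesis .
  qed
  \<comment> \<open>Weights are bounded by \<open>cs\<close> and \<open>q \<ge> 1\<close>, so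
    \<open>w powr q\<close> is at most a constant times \<open>w\<close>; this gives linearity in
    the weight.\<close>
  also have "w powr q = w * w powr (q - 1)"
    using w0 powr_add[of w 1 "q - 1"] by simp
  also have "1 + u * \<eta> + \<xi> * (u * A) + exp b * (C * ((2 * s / \<xi>) powr q * (w * w powr (q - 1))))
     \<le> 1 + u * \<eta> + \<xi> * (u * A) + exp b * (C * ((2 * s / \<xi>) powr q * (w * cs powr (q - 1))))"
    using w w0 C q by (intro add_mono mult_left_mono powr_mono2 order_refl) auto
  also have "\<dots> = 1 + w * (s * \<eta> + \<xi> * s * A + exp b * C * (2 * s / \<xi>) powr q * cs powr (q - 1))"
    by (simp only: u_def distrib_left mult_ac add_ac)
  also have "\<dots> \<le> exp (w * (s * \<eta> + \<xi> * s * A + exp b * C * (2 * s / \<xi>) powr q * cs powr (q - 1)))"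
    by (rule exp_ge_add_one_self)
  finally show ?thesis by (simp only: u_def Y_def b_def mult.assoc)
qed

text \<open>Here \<open>X n + m\<close> is centred. The power bound on the right tail with some
  \<open>q > 1\<close> is all that is required beyond the mean; second moments may be
  infinite.\<close>

locale iid_negative_mean = prob_space M for M :: "'a measure" +
  fixes X :: "nat \<Rightarrow> 'a \<Rightarrow> real" and D :: "real measure" and m q C x1 :: real
  assumes indep: "indep_vars (\<lambda>_. borel) X {1..}"
    and distr_X: "\<And>n. n \<ge> 1 \<Longrightarrow> distr M borel (X n) = D"
    and integrable_D: "integrable D (\<lambda>x. x)"
    and mean_D: "(\<integral>x. x \<partial>D) = - m"
    and m_pos: "m > 0"
    and tail_D: "\<And>x. x \<ge> x1 \<Longrightarrow> measure D {x<..} \<le> C * x powr (- q)"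
    and q_gt_1: "q > 1" and x1_pos: "x1 > 0" and C_nonneg: "C \<ge> 0"
begin

lemma X_measurable: "n \<ge> 1 \<Longrightarrow> X n \<in> borel_measurable M"
  using indep unfolding indep_vars_def2 by auto

lemma D_real_distribution: "real_distribution D"
  using real_distribution_distr[OF X_measurable[of 1]] distr_X[of 1] by simp

sublocale D: real_distribution D
  by (rule D_real_distribution)

lemma expectation_X:
  assumes "n \<ge> 1" "f \<in> borel_measurable borel"
  shows "expectation (\<lambda>\<omega>. f (X n \<omega>)) = (\<integral>x. (f x :: real) \<partial>D)"
  using integral_distr[OF X_measurable[OF assms(1)] assms(2)] distr_X[OF assms(1)] by simp

lemma integrable_X:
  assumes "n \<ge> 1" "f \<in> borel_measurable borel" "integrable D (f :: real \<Rightarrow> real)"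
  shows "integrable M (\<lambda>\<omega>. f (X n \<omega>))"
  using integrable_distr_eq[OF X_measurable[OF assms(1)] assms(2)] distr_X[OF assms(1)] assms(3) by simp

lemma prob_X:
  assumes "n \<ge> 1" "A \<in> sets borel"
  shows "prob {\<omega> \<in> space M. X n \<omega> \<in> A} = measure D A"
proof -
  have "{\<omega> \<in> space M. X n \<omega> \<in> A} = X n -` A \<inter> space M" by auto
  thus ?thesis using measure_distr[OF X_measurable[OF assms(1)] assms(2)] distr_X[OF assms(1)] by simp
qed

text \<open>The left tail is controlled only through the mean. Raising values below
  \<open>- K\<close> keeps exponents bounded below, and by dominated convergence it costs
  arbitrarily little in the mean.\<close>

lemma truncated_mean:
  assumes "\<eta> > 0"
  shows "\<exists>K\<ge>0. D.expectation (\<lambda>x. max (- K) x) \<le> - m + \<eta>"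
proof -
  have "(\<lambda>n. D.expectation (\<lambda>x. max (- real n) x)) \<longlonglongrightarrow> D.expectation (\<lambda>x. x)"
  proof (rule integral_dominated_convergence[where w = "\<lambda>x. \<bar>x\<bar>"])
    show "AE x in D. (\<lambda>n. max (- real n) x) \<longlonglongrightarrow> x"
    proof (rule AE_I2)
      fix x :: real
      have "\<forall>\<^sub>F n in sequentially. x = max (- real n) x"
        using eventually_ge_at_top[of "nat \<lceil>- x\<rceil>"] by eventually_elim linarith
      thus "(\<lambda>n. max (- real n) x) \<longlonglongrightarrow> x" by (rule Lim_transform_eventually[OF tendsto_const])
    qed
    show "AE x in D. norm (max (- real n) x) \<le> \<bar>x\<bar>" for n
      by (rule AE_I2) (auto simp: max_def)
    show "integrable D (\<lambda>x. \<bar>x\<bar>)" using integrable_D by (rule integrable_abs)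
  qed simp_all
  moreover have "D.expectation (\<lambda>x. x) < - m + \<eta>" using mean_D assms by simp
  ultimately have "\<forall>\<^sub>F n in sequentially. D.expectation (\<lambda>x. max (- real n) x) < - m + \<eta>"
    by (rule order_tendstoD)
  then obtain n where "D.expectation (\<lambda>x. max (- real n) x) < - m + \<eta>"
    by (auto simp: eventually_sequentially)
  hence "0 \<le> real n \<and> D.expectation (\<lambda>x. max (- real n) x) \<le> - m + \<eta>" by simp
  thus ?thesis by blast
qed

text \<open>The truncation at \<open>- K\<close> only increases the sum, since the weights are
  nonnegative; so it may appear in the moment generating functions but not in the event.\<close>

lemma chernoff_truncated_sum:
  fixes w :: "nat \<Rightarrow> real"
  assumes J: "finite J" "J \<subseteq> {1..}" and s: "s > 0" and K: "K \<ge> 0" and B: "B \<ge> 0"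
    and mgf: "\<And>j. j \<in> J \<Longrightarrow> D.expectation (\<lambda>x. exp (s * (w j * (max (- K) (min x B) + m)))) \<le> exp (w j * Q)"
    and wn: "\<And>j. j \<in> J \<Longrightarrow> w j \<ge> 0"
  shows "prob {\<omega> \<in> space M. (\<Sum>j\<in>J. w j * (min (X j \<omega>) B + m)) \<ge> y} \<le> exp (- s * y + Q * (\<Sum>j\<in>J. w j))"
proof -
  define Z where "Z j x = exp (s * (w j * (max (- K) (min x B) + m)))" for j and x :: real
  have Z_meas [measurable]: "Z j \<in> borel_measurable borel" for j unfolding Z_def by measurable
  have int_Z: "integrable D (Z j)" if "j \<in> J" for j
  proof (rule D.integrable_const_bound)
    have "max (- K) (min x B) + m \<le> B + m" for x using K B by auto
    hence "s * (w j * (max (- K) (min x B) + m)) \<le> s * (w j * (B + m))" for x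
      using s wn[OF that] by (intro mult_left_mono) auto
    thus "AE x in D. norm (Z j x) \<le> exp (s * (w j * (B + m)))" by (auto simp: Z_def)
  qed simp
  have X_meas: "X j \<in> borel_measurable M" if "j \<in> J" for j
    using X_measurable J that by auto
  have indepJ: "indep_vars (\<lambda>_. borel) (\<lambda>j \<omega>. Z j (X j \<omega>)) J"
    by (rule indep_vars_compose2[OF indep_vars_subset[OF indep J(2)]]) simp
  have intX: "integrable M (\<lambda>\<omega>. Z j (X j \<omega>))" if "j \<in> J" for j
    using that J by (intro integrable_X int_Z) auto
  have int_prod: "integrable M (\<lambda>\<omega>. \<Prod>j\<in>J. Z j (X j \<omega>))"
    by (rule indep_vars_integrable[OF J(1) indepJ intX])
  have "prob {\<omega> \<in> space M. (\<Sum>j\<in>J. w j * (min (X j \<omega>) B + m)) \<ge> y} \<le>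
        prob {\<omega> \<in> space M. (\<Prod>j\<in>J. Z j (X j \<omega>)) \<ge> exp (s * y)}"
  proof (rule finite_measure_mono)
    show "{\<omega> \<in> space M. (\<Prod>j\<in>J. Z j (X j \<omega>)) \<ge> exp (s * y)} \<in> events"
      using borel_measurable_integrable[OF int_prod] by measurable
    show "{\<omega> \<in> space M. (\<Sum>j\<in>J. w j * (min (X j \<omega>) B + m)) \<ge> y} \<subseteq>
          {\<omega> \<in> space M. (\<Prod>j\<in>J. Z j (X j \<omega>)) \<ge> exp (s * y)}"
    proof safe
      fix \<omega> assume "(\<Sum>j\<in>J. w j * (min (X j \<omega>) B + m)) \<ge> y"
      also have "(\<Sum>j\<in>J. w j * (min (X j \<omega>) B + m)) \<le> (\<Sum>j\<in>J. w j * (max (- K) (min (X j \<omega>) B) + m))"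
        using wn by (intro sum_mono mult_left_mono) auto
      finally have "s * y \<le> s * (\<Sum>j\<in>J. w j * (max (- K) (min (X j \<omega>) B) + m))"
        using s by (intro mult_left_mono) auto
      hence "exp (s * y) \<le> exp (\<Sum>j\<in>J. s * (w j * (max (- K) (min (X j \<omega>) B) + m)))"
        by (simp add: sum_distrib_left)
      thus "exp (s * y) \<le> (\<Prod>j\<in>J. Z j (X j \<omega>))" by (simp add: Z_def exp_sum[OF J(1)])
    qed
  qed
  also have "\<dots> \<le> expectation (\<lambda>\<omega>. \<Prod>j\<in>J. Z j (X j \<omega>)) / exp (s * y)"
    by (rule integral_Markov_inequality_measure[OF int_prod sets.top])
       (auto simp: Z_def intro!: prod_nonneg)
  also have "expectation (\<lambda>\<omega>. \<Prod>j\<in>J. Z j (X j \<omega>)) = (\<Prod>j\<in>J. expectation (\<lambda>\<omega>. Z j (X j \<omega>)))"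
    by (rule indep_vars_lebesgue_integral[OF J(1) indepJ intX])
  also have "\<dots> = (\<Prod>j\<in>J. D.expectation (Z j))"
    using J by (intro prod.cong refl expectation_X) auto
  also have "\<dots> \<le> (\<Prod>j\<in>J. exp (w j * Q))"
    using mgf by (intro prod_mono) (auto simp: Z_def[abs_def] intro!: Bochner_Integration.integral_nonneg)
  also have "\<dots> = exp (Q * (\<Sum>j\<in>J. w j))"
    by (simp add: exp_sum[OF J(1), symmetric] sum_distrib_left mult.commute)
  also have "exp (Q * (\<Sum>j\<in>J. w j)) / exp (s * y) = exp (- s * y + Q * (\<Sum>j\<in>J. w j))"
    by (simp flip: exp_diff)
  finally show ?thesis by (simp add: divide_right_mono)
qed

text \<open>With exponential parameter \<open>s\<close> of order \<open>ln T / T\<close>, Markov's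
  inequality yields a power of \<open>T\<close>. A small truncation level
  \<open>\<epsilon> * T\<close> keeps the factor \<open>exp (b T)\<close> down to a small power of
  \<open>T\<close>, which the tail bound with \<open>q > 1\<close> beats. All constants are uniform
  in the index set and in the weights.\<close>

lemma truncated_sum_tail_bound:
  assumes delta: "\<delta> > 0" and W: "W > 0" and cs: "cs > 0" and Theta: "\<Theta> > 0"
  shows "\<exists>\<epsilon>>0. \<exists>T0. \<forall>T\<ge>T0. \<forall>J w. finite J \<longrightarrow> J \<subseteq> {1..} \<longrightarrow> (\<forall>j\<in>J. 0 \<le> w j \<and> w j \<le> cs) \<longrightarrow>
     (\<Sum>j\<in>J. w j) \<le> W * T \<longrightarrow>
     prob {\<omega> \<in> space M. (\<Sum>j\<in>J. w j * (min (X j \<omega>) (\<epsilon> * T) + m)) \<ge> \<delta> * T} \<le> T powr (- \<Theta>)"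
proof -
  \<comment> \<open>\<eta> and \<xi> are chosen so that the mean error and the second-order term
    each consume at most a quarter of \<delta>.\<close>
  define \<eta> where "\<eta> = \<delta> / (4 * W)"
  have eta: "\<eta> > 0" using delta W by (simp add: \<eta>_def)
  obtain K where K: "K \<ge> 0" "D.expectation (\<lambda>x. max (- K) x) \<le> - m + \<eta>"
    using truncated_mean[OF eta] by blast
  define A where "A = D.expectation (\<lambda>x. \<bar>x\<bar>) + m"
  have A: "A > 0" unfolding A_def using m_pos by (intro add_nonneg_pos) auto
  define \<xi> where "\<xi> = min 1 (\<delta> / (4 * W * A))"
  have xi: "0 < \<xi>" "\<xi> \<le> 1" "\<xi> * A \<le> \<delta> / (4 * W)"
    using delta W A by (auto simp: \<xi>_def min_def field_simps)
  \<comment> \<open>Half of \<delta> survives, so the exponent becomes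
    \<open>- (\<Theta> + 1) * ln T\<close>. The spare \<open>ln T\<close> absorbs the remaining term
    \<open>H T\<close>, since \<open>H T < 1 < ln T\<close>.\<close>
  define \<theta> where "\<theta> = 2 * (\<Theta> + 1) / \<delta>"
  have theta: "\<theta> > 0" "\<theta> * \<delta> / 2 = \<Theta> + 1" using Theta delta by (auto simp: \<theta>_def)
  define r where "r = (q - 1) / 2"
  have r: "r > 0" "q = 1 + 2 * r" using q_gt_1 by (auto simp: r_def field_simps)
  \<comment> \<open>Makes \<open>exp (b T)\<close> equal to \<open>T powr r\<close> times a factor
    tending to 1. Since \<open>q = 1 + 2 * r\<close>, the order of \<open>H T\<close> is then
    \<open>T powr (- r)\<close> up to a power of \<open>ln T\<close>.\<close>
  define \<epsilon> where "\<epsilon> = r / (\<theta> * cs)"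
  have eps: "\<epsilon> > 0" using r theta cs by (simp add: \<epsilon>_def)
  define s where "s T = \<theta> * (ln T / T)" for T
  define b where "b T = s T * cs * (\<epsilon> * T + m)" for T
  define H where "H T = W * T * (exp (b T) * C * (2 * s T / \<xi>) powr q * cs powr (q - 1))" for T
  have lnT: "((\<lambda>T::real. ln T / T) \<longlongrightarrow> 0) at_top" by real_asymp
  have s0: "(s \<longlongrightarrow> 0) at_top" unfolding s_def by (rule tendsto_mult_right_zero[OF lnT])
  have ev1: "\<forall>\<^sub>F T in at_top. s T * (cs * K) < \<xi>"
    using tendsto_mult_left_zero[OF s0, of "cs * K"] xi by (intro order_tendstoD(2)) auto
  have ev2: "\<forall>\<^sub>F T in at_top. s T * (cs * m) < \<xi> / 2"
    using tendsto_mult_left_zero[OF s0, of "cs * m"] xi by (intro order_tendstoD(2)) auto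
  have ev3: "\<forall>\<^sub>F T in at_top. s T * (2 * cs * x1) < \<xi>"
    using tendsto_mult_left_zero[OF s0, of "2 * cs * x1"] xi by (intro order_tendstoD(2)) auto
  have H0: "(H \<longlongrightarrow> 0) at_top"
  proof -
    define L where "L = W * C * (2 * \<theta> / \<xi>) powr q * cs powr (q - 1)"
    have "((\<lambda>T. T powr (1 + r) * (ln T / T) powr (1 + 2 * r)) \<longlongrightarrow> 0) at_top"
      using r by real_asymp
    moreover have "((\<lambda>T. exp (s T * (cs * m))) \<longlongrightarrow> exp 0) at_top"
      by (intro tendsto_exp tendsto_mult_left_zero[OF s0])
    ultimately have "((\<lambda>T. L * (exp (s T * (cs * m)) * (T powr (1 + r) * (ln T / T) powr (1 + 2 * r)))) \<longlongrightarrow> L * (exp 0 * 0)) at_top"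
      by (intro tendsto_mult tendsto_const)
    moreover have "\<forall>\<^sub>F T in at_top. L * (exp (s T * (cs * m)) * (T powr (1 + r) * (ln T / T) powr (1 + 2 * r))) = H T"
      using eventually_gt_at_top[of 1]
    proof eventually_elim
      case (elim T)
      have "b T = r * ln T + s T * (cs * m)"
        using theta(1) cs elim by (simp add: b_def s_def \<epsilon>_def field_simps)
      hence "exp (b T) = T powr r * exp (s T * (cs * m))"
        using elim by (simp add: exp_add powr_def)
      moreover have "(2 * s T / \<xi>) powr q = (2 * \<theta> / \<xi>) powr q * (ln T / T) powr (1 + 2 * r)"
      proof -
        have "2 * s T / \<xi> = (2 * \<theta> / \<xi>) * (ln T / T)"
          by (simp add: s_def mult.commute mult.left_commute)
        moreover have "ln T / T \<ge> 0" "2 * \<theta> / \<xi> \<ge> 0" using elim theta(1) xi(1) by auto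
        ultimately have "(2 * s T / \<xi>) powr q = (2 * \<theta> / \<xi>) powr q * (ln T / T) powr q"
          by (metis powr_mult)
        thus ?thesis unfolding r(2)[symmetric] .
      qed
      moreover have "T powr (1 + r) = T * T powr r" using elim by (simp add: powr_add)
      ultimately show ?case unfolding H_def L_def by (simp only: mult_ac)
    qed
    ultimately show ?thesis using Lim_transform_eventually by fastforce
  qed
  have ev4: "\<forall>\<^sub>F T in at_top. H T < 1" by (rule order_tendstoD(2)[OF H0]) simp
  have "\<forall>\<^sub>F T in at_top. s T * (cs * K) < \<xi> \<and> s T * (cs * m) < \<xi> / 2 \<and> s T * (2 * cs * x1) < \<xi> \<and> H T < 1 \<and> T > exp 1"
    using ev1 ev2 ev3 ev4 eventually_gt_at_top[of "exp 1"] by eventually_elim simp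
  then obtain T0 where T0: "\<And>T. T \<ge> T0 \<Longrightarrow>
      s T * (cs * K) < \<xi> \<and> s T * (cs * m) < \<xi> / 2 \<and> s T * (2 * cs * x1) < \<xi> \<and> H T < 1 \<and> T > exp 1"
    by (auto simp: eventually_at_top_linorder)
  have "prob {\<omega> \<in> space M. (\<Sum>j\<in>J. w j * (min (X j \<omega>) (\<epsilon> * T) + m)) \<ge> \<delta> * T} \<le> T powr (- \<Theta>)"
    if T: "T \<ge> T0" and J: "finite J" "J \<subseteq> {1..}" and w: "\<And>j. j \<in> J \<Longrightarrow> 0 \<le> w j \<and> w j \<le> cs"
      and wsum: "(\<Sum>j\<in>J. w j) \<le> W * T" for T J and w :: "nat \<Rightarrow> real"
  proof -
    have "T > exp 1" using T0[OF T] by simp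
    moreover have "exp 1 > (1::real)" by simp
    ultimately have T1: "T > 1" by linarith
    have "ln T > ln (exp 1)" using \<open>T > exp 1\<close> T1 by (subst ln_less_cancel_iff) auto
    hence lnT1: "ln T > 1" by simp
    have sT: "s T > 0" using theta(1) T1 lnT1 by (simp add: s_def)
    define Q where "Q = s T * \<eta> + \<xi> * s T * A + exp (s T * cs * (\<epsilon> * T + m)) * C * (2 * s T / \<xi>) powr q * cs powr (q - 1)"
    have Q0: "Q \<ge> 0" unfolding Q_def using sT eta xi A C_nonneg
      by (intro add_nonneg_nonneg mult_nonneg_nonneg) auto
    have "prob {\<omega> \<in> space M. (\<Sum>j\<in>J. w j * (min (X j \<omega>) (\<epsilon> * T) + m)) \<ge> \<delta> * T}
        \<le> exp (- s T * (\<delta> * T) + Q * (\<Sum>j\<in>J. w j))"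
    proof (rule chernoff_truncated_sum[OF J sT K(1)])
      show "\<epsilon> * T \<ge> 0" using eps T1 by simp
      show "D.expectation (\<lambda>x. exp (s T * (w j * (max (- K) (min x (\<epsilon> * T)) + m)))) \<le> exp (w j * Q)"
        if "j \<in> J" for j
        unfolding Q_def using w[OF that] T0[OF T] eps T1 m_pos q_gt_1 C_nonneg x1_pos cs sT xi(1,2) K
        by (intro D.truncated_mgf_bound[where ?x1.0 = x1] integrable_D tail_D) (auto simp: A_def mult_ac)
    qed (use w in auto)
    also have "\<dots> \<le> exp (- s T * (\<delta> * T) + Q * (W * T))"
      using wsum Q0 by (simp add: mult_left_mono)
    also have "- s T * (\<delta> * T) + Q * (W * T) \<le> - \<Theta> * ln T"
    proof -
      have "Q * (W * T) = s T * T * (W * \<eta>) + s T * T * (W * (\<xi> * A)) + H T"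
        unfolding Q_def H_def b_def by (simp only: distrib_right distrib_left mult_ac)
      moreover have "W * \<eta> = \<delta> / 4" using W by (simp add: \<eta>_def)
      moreover have "W * (\<xi> * A) \<le> \<delta> / 4"
        using mult_left_mono[OF xi(3), of W] W by simp
      hence "s T * T * (W * (\<xi> * A)) \<le> s T * T * (\<delta> / 4)"
        using sT T1 by (intro mult_left_mono) auto
      ultimately have "Q * (W * T) \<le> s T * T * (\<delta> / 4) + s T * T * (\<delta> / 4) + H T"
        by (simp only:)
      hence "- s T * (\<delta> * T) + Q * (W * T) \<le> - (s T * T) * (\<delta> / 2) + H T"
        by (simp add: field_simps)
      also have "s T * T = \<theta> * ln T" using T1 by (simp add: s_def)
      also have "- (\<theta> * ln T) * (\<delta> / 2) = - (\<theta> * \<delta> / 2) * ln T" by simp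
      also have "- (\<theta> * \<delta> / 2) * ln T + H T \<le> - (\<Theta> + 1) * ln T + ln T"
        unfolding theta(2) using T0[OF T] lnT1 by simp
      finally show ?thesis by (simp add: algebra_simps)
    qed
    hence "exp (- s T * (\<delta> * T) + Q * (W * T)) \<le> T powr (- \<Theta>)"
      using T1 by (simp add: powr_def)
    finally show ?thesis .
  qed
  from this eps show ?thesis
    by (intro exI[of _ \<epsilon>] exI[of _ T0] conjI allI impI) (assumption, simp)
qed

lemma truncation_error:
  assumes "\<eta> > 0"
  shows "\<exists>R>0. D.expectation (\<lambda>x. \<bar>x - (if \<bar>x\<bar> \<le> R then x else 0)\<bar>) \<le> \<eta>"
proof -
  have "(\<lambda>n. D.expectation (\<lambda>x. \<bar>x - (if \<bar>x\<bar> \<le> real (Suc n) then x else 0)\<bar>)) \<longlonglongrightarrow> D.expectation (\<lambda>x. 0)"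
  proof (rule integral_dominated_convergence[where w = "\<lambda>x. \<bar>x\<bar>"])
    show "AE x in D. (\<lambda>n. \<bar>x - (if \<bar>x\<bar> \<le> real (Suc n) then x else 0)\<bar>) \<longlonglongrightarrow> 0"
    proof (rule AE_I2)
      fix x :: real
      have "\<forall>\<^sub>F n in sequentially. 0 = \<bar>x - (if \<bar>x\<bar> \<le> real (Suc n) then x else 0)\<bar>"
        using eventually_ge_at_top[of "nat \<lceil>\<bar>x\<bar>\<rceil>"]
      proof eventually_elim
        case (elim n)
        hence "\<bar>x\<bar> \<le> real (Suc n)" by linarith
        thus ?case by simp
      qed
      thus "(\<lambda>n. \<bar>x - (if \<bar>x\<bar> \<le> real (Suc n) then x else 0)\<bar>) \<longlonglongrightarrow> 0"
        by (rule Lim_transform_eventually[OF tendsto_const])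
    qed
    show "AE x in D. norm (\<bar>x - (if \<bar>x\<bar> \<le> real (Suc n) then x else 0)\<bar>) \<le> \<bar>x\<bar>" for n
      by (rule AE_I2) auto
    show "integrable D (\<lambda>x. \<bar>x\<bar>)" using integrable_D by (rule integrable_abs)
  qed simp_all
  moreover have "D.expectation (\<lambda>x. 0) < \<eta>" using assms by simp
  ultimately have "\<forall>\<^sub>F n in sequentially. D.expectation (\<lambda>x. \<bar>x - (if \<bar>x\<bar> \<le> real (Suc n) then x else 0)\<bar>) < \<eta>"
    by (rule order_tendstoD)
  then obtain n where n: "D.expectation (\<lambda>x. \<bar>x - (if \<bar>x\<bar> \<le> real (Suc n) then x else 0)\<bar>) < \<eta>"
    by (auto simp: eventually_sequentially)
  show ?thesis
    by (rule exI[of _ "real (Suc n)"], intro conjI less_imp_le[OF n]) simp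
qed

text \<open>Innovations are cut at a fixed \<open>R\<close>: the bounded part is handled by
  Hoeffding's inequality and the rest by Markov's inequality, so a first moment suffices. The
  threshold \<open>T0\<close> depends on the weights only through the bounds \<open>cs\<close> and
  \<open>W\<close>.\<close>

lemma weak_law:
  assumes delta: "\<delta> > 0" and W: "W > 0" and cs: "cs > 0" and e: "e > 0"
  shows "\<exists>T0. \<forall>T\<ge>T0. \<forall>J w. finite J \<longrightarrow> J \<subseteq> {1..} \<longrightarrow> (\<forall>j\<in>J. 0 \<le> w j \<and> w j \<le> cs) \<longrightarrow>
     (\<Sum>j\<in>J. w j) \<le> W * T \<longrightarrow>
     prob {\<omega> \<in> space M. (\<Sum>j\<in>J. w j * (X j \<omega> + m)) \<le> - \<delta> * T} \<le> e"
proof -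
  \<comment> \<open>The first entry keeps the bias of the cut means below a third of
    \<open>\<delta> * T\<close>; the second makes Markov's inequality at level
    \<open>\<delta> * T / 3\<close> give at most \<open>e / 2\<close>.\<close>
  define \<eta> where "\<eta> = min (\<delta> / (3 * W)) (e * \<delta> / (6 * W))"
  have eta: "\<eta> > 0" "\<eta> * W \<le> \<delta> / 3" "\<eta> * W \<le> e * \<delta> / 6"
  proof -
    show "\<eta> > 0" using delta W e by (simp add: \<eta>_def)
    have "\<eta> \<le> \<delta> / (3 * W)" "\<eta> \<le> e * \<delta> / (6 * W)" by (auto simp: \<eta>_def)
    thus "\<eta> * W \<le> \<delta> / 3" "\<eta> * W \<le> e * \<delta> / 6" using W by (auto simp: field_simps)
  qed
  define \<tau> where "\<tau> R x = (if \<bar>x\<bar> \<le> R then x else 0)" for R x :: real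
  obtain R where R: "R > 0" "D.expectation (\<lambda>x. \<bar>x - \<tau> R x\<bar>) \<le> \<eta>"
    using truncation_error[OF eta(1)] unfolding \<tau>_def by blast
  have [measurable]: "\<tau> R \<in> borel_measurable borel" unfolding \<tau>_def by measurable
  have tau_R: "\<bar>\<tau> R x\<bar> \<le> R" for x using R(1) by (simp add: \<tau>_def)
  have int_tau: "integrable D (\<tau> R)"
    by (rule D.integrable_const_bound[where B = R]) (use tau_R in auto)
  have int_diff: "integrable D (\<lambda>x. \<bar>x - \<tau> R x\<bar>)"
    using integrable_D int_tau by (intro integrable_abs Bochner_Integration.integrable_diff)
  define a where "a = D.expectation (\<tau> R)"
  have am: "- \<eta> \<le> m + a"
  proof -
    have "- (m + a) = D.expectation (\<lambda>x. x - \<tau> R x)"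
      using integrable_D int_tau by (simp add: mean_D a_def)
    also have "\<dots> \<le> D.expectation (\<lambda>x. \<bar>x - \<tau> R x\<bar>)"
      using integrable_D int_tau int_diff by (intro integral_mono Bochner_Integration.integrable_diff) auto
    finally show ?thesis using R(2) by linarith
  qed
  \<comment> \<open>Hoeffding's exponent \<open>2 * (\<delta> * T / 3)\<^sup>2 / V\<close>, divided
    by \<open>T\<close>, for the largest possible \<open>V\<close>, namely
    \<open>4 * R\<^sup>2 * cs * W * T\<close>.\<close>
  define \<kappa> where "\<kappa> = \<delta>\<^sup>2 / (18 * R\<^sup>2 * cs * W)"
  have kappa: "\<kappa> > 0" using delta R cs W by (simp add: \<kappa>_def)
  have "((\<lambda>T. exp (- \<kappa> * T)) \<longlongrightarrow> 0) at_top" using kappa by real_asymp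
  hence "\<forall>\<^sub>F T in at_top. exp (- \<kappa> * T) < e / 2" using e by (intro order_tendstoD(2)) auto
  then obtain T1 where T1: "\<And>T. T \<ge> T1 \<Longrightarrow> exp (- \<kappa> * T) < e / 2"
    by (auto simp: eventually_at_top_linorder)
  have "prob {\<omega> \<in> space M. (\<Sum>j\<in>J. w j * (X j \<omega> + m)) \<le> - \<delta> * T} \<le> e"
    if T: "T \<ge> max 1 T1" and J: "finite J" "J \<subseteq> {1..}" and w: "\<And>j. j \<in> J \<Longrightarrow> 0 \<le> w j \<and> w j \<le> cs"
      and wsum: "(\<Sum>j\<in>J. w j) \<le> W * T" for T J and w :: "nat \<Rightarrow> real"
  proof (cases "\<forall>j\<in>J. w j = 0")
    \<comment> \<open>Without a nonzero weight the sum \<open>V\<close> of squared ranges is 0, and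
      Hoeffding's inequality could not be applied as below.\<close>
    case True
    hence "(\<Sum>j\<in>J. w j * (X j \<omega> + m)) = 0" for \<omega> by simp
    moreover have "\<not> (0 \<le> - \<delta> * T)" using delta T by (simp add: mult_le_0_iff)
    ultimately have "{\<omega> \<in> space M. (\<Sum>j\<in>J. w j * (X j \<omega> + m)) \<le> - \<delta> * T} = {}" by simp
    thus ?thesis using e by (simp only: measure_empty less_imp_le)
  next
    case False
    have Tpos: "T > 0" using T by simp
    have X_meas: "X j \<in> borel_measurable M" if "j \<in> J" for j
      using X_measurable J that by auto
    define Z where "Z j \<omega> = w j * \<tau> R (X j \<omega>)" for j \<omega>
    have Z_meas: "Z j \<in> borel_measurable M" if "j \<in> J" for j
      unfolding Z_def using X_meas[OF that] by measurable
    have EZ: "expectation (Z j) = w j * a" if "j \<in> J" for j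
    proof -
      have "expectation (\<lambda>\<omega>. \<tau> R (X j \<omega>)) = a"
        using expectation_X[of j "\<tau> R"] that J by (auto simp: a_def)
      thus ?thesis by (simp add: Z_def[abs_def])
    qed
    interpret H: Hoeffding_ineq M J Z "\<lambda>j. - (w j * R)" "\<lambda>j. w j * R" "\<Sum>j\<in>J. expectation (Z j)"
    proof unfold_locales
      show "indep_vars (\<lambda>_. borel) Z J"
        unfolding Z_def by (rule indep_vars_compose2[OF indep_vars_subset[OF indep J(2)]]) measurable
      show "AE x in M. Z j x \<in> {- (w j * R)..w j * R}" if "j \<in> J" for j
      proof (rule AE_I2)
        fix x
        have "\<bar>Z j x\<bar> \<le> w j * R" unfolding Z_def abs_mult using tau_R w[OF that] by (intro mult_mono) auto
        thus "Z j x \<in> {- (w j * R)..w j * R}" by auto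
      qed
    qed (use J in auto)
    define V where "V = (\<Sum>j\<in>J. (w j * R - - (w j * R))\<^sup>2)"
    have Vpos: "V > 0"
    proof -
      obtain j where j: "j \<in> J" "w j \<noteq> 0" using False by blast
      have "0 < (w j * R - - (w j * R))\<^sup>2" using j R(1) by simp
      also have "\<dots> \<le> V" unfolding V_def using j J by (intro member_le_sum) auto
      finally show ?thesis .
    qed
    have Vle: "V \<le> 4 * R\<^sup>2 * cs * W * T"
    proof -
      have "V = (\<Sum>j\<in>J. 4 * R\<^sup>2 * (w j * w j))"
        unfolding V_def by (intro sum.cong) (auto simp: power2_eq_square)
      also have "\<dots> \<le> (\<Sum>j\<in>J. 4 * R\<^sup>2 * (cs * w j))"
        using w by (intro sum_mono mult_left_mono mult_right_mono) auto
      also have "\<dots> = 4 * R\<^sup>2 * cs * (\<Sum>j\<in>J. w j)" by (simp add: sum_distrib_left mult.assoc)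
      also have "\<dots> \<le> 4 * R\<^sup>2 * cs * (W * T)" using wsum cs by (intro mult_left_mono) auto
      finally show ?thesis by (simp add: mult.assoc)
    qed
    define E1 where "E1 = {\<omega> \<in> space M. (\<Sum>j\<in>J. Z j \<omega>) \<le> (\<Sum>j\<in>J. expectation (Z j)) - \<delta> * T / 3}"
    define E2 where "E2 = {\<omega> \<in> space M. (\<Sum>j\<in>J. w j * \<bar>X j \<omega> - \<tau> R (X j \<omega>)\<bar>) \<ge> \<delta> * T / 3}"
    have E1_meas: "E1 \<in> events" unfolding E1_def using Z_meas by measurable
    have int_d: "integrable M (\<lambda>\<omega>. \<bar>X j \<omega> - \<tau> R (X j \<omega>)\<bar>)" if "j \<in> J" for j
      using integrable_X[OF _ _ int_diff, of j] that J by auto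
    have int_s: "integrable M (\<lambda>\<omega>. \<Sum>j\<in>J. w j * \<bar>X j \<omega> - \<tau> R (X j \<omega>)\<bar>)"
      by (intro Bochner_Integration.integrable_sum integrable_mult_right int_d)
    have E2_meas: "E2 \<in> events" unfolding E2_def using borel_measurable_integrable[OF int_s] by measurable
    have p1: "prob E1 \<le> e / 2"
    proof -
      have "prob E1 \<le> exp (-2 * (\<delta> * T / 3)\<^sup>2 / V)"
        unfolding E1_def V_def using Vpos delta Tpos by (intro H.Hoeffding_ineq_le) (auto simp: V_def)
      also have "-2 * (\<delta> * T / 3)\<^sup>2 / V \<le> - \<kappa> * T"
      proof -
        have "\<kappa> * T * V \<le> \<kappa> * T * (4 * R\<^sup>2 * cs * W * T)"
          using kappa Tpos Vle by (intro mult_left_mono) auto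
        also have "\<dots> = 2 * (\<delta> * T / 3)\<^sup>2"
          using R(1) cs W by (simp add: \<kappa>_def power2_eq_square field_simps)
        finally show ?thesis using Vpos by (simp add: field_simps)
      qed
      hence "exp (-2 * (\<delta> * T / 3)\<^sup>2 / V) \<le> exp (- \<kappa> * T)" by simp
      also have "exp (- \<kappa> * T) < e / 2" using T1 T by simp
      finally show ?thesis by simp
    qed
    have p2: "prob E2 \<le> e / 2"
    proof -
      have "prob E2 \<le> expectation (\<lambda>\<omega>. \<Sum>j\<in>J. w j * \<bar>X j \<omega> - \<tau> R (X j \<omega>)\<bar>) / (\<delta> * T / 3)"
        unfolding E2_def using delta Tpos w
        by (intro integral_Markov_inequality_measure[OF int_s sets.top] AE_I2 sum_nonneg mult_nonneg_nonneg) auto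
      also have "expectation (\<lambda>\<omega>. \<Sum>j\<in>J. w j * \<bar>X j \<omega> - \<tau> R (X j \<omega>)\<bar>) =
          (\<Sum>j\<in>J. w j * D.expectation (\<lambda>x. \<bar>x - \<tau> R x\<bar>))"
      proof (subst Bochner_Integration.integral_sum)
        show "(\<Sum>j\<in>J. expectation (\<lambda>\<omega>. w j * \<bar>X j \<omega> - \<tau> R (X j \<omega>)\<bar>)) =
            (\<Sum>j\<in>J. w j * D.expectation (\<lambda>x. \<bar>x - \<tau> R x\<bar>))"
        proof (rule sum.cong[OF refl])
          fix j assume "j \<in> J"
          thus "expectation (\<lambda>\<omega>. w j * \<bar>X j \<omega> - \<tau> R (X j \<omega>)\<bar>) = w j * D.expectation (\<lambda>x. \<bar>x - \<tau> R x\<bar>)"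
            using J expectation_X[of j "\<lambda>x. \<bar>x - \<tau> R x\<bar>"] by auto
        qed
      qed (intro integrable_mult_right int_d)
      also have "\<dots> \<le> (\<Sum>j\<in>J. w j * \<eta>)" using w R(2) by (intro sum_mono mult_left_mono) auto
      also have "\<dots> = \<eta> * (\<Sum>j\<in>J. w j)" by (simp add: sum_distrib_left mult.commute)
      also have "\<dots> \<le> \<eta> * (W * T)" using wsum eta by (intro mult_left_mono) auto
      also have "\<dots> = (\<eta> * W) * T" by simp
      also have "\<dots> \<le> (e * \<delta> / 6) * T" using eta Tpos by (intro mult_right_mono) auto
      finally show ?thesis using delta Tpos by (simp add: divide_right_mono field_simps)
    qed
    have "{\<omega> \<in> space M. (\<Sum>j\<in>J. w j * (X j \<omega> + m)) \<le> - \<delta> * T} \<subseteq> E1 \<union> E2"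
    proof (rule subsetI, rule ccontr)
      fix \<omega> assume o: "\<omega> \<in> {\<omega> \<in> space M. (\<Sum>j\<in>J. w j * (X j \<omega> + m)) \<le> - \<delta> * T}" "\<omega> \<notin> E1 \<union> E2"
      define d where "d j = X j \<omega> - \<tau> R (X j \<omega>)" for j
      have "(\<Sum>j\<in>J. w j * (X j \<omega> + m)) = (\<Sum>j\<in>J. (Z j \<omega> - w j * a) + w j * d j + w j * (m + a))"
        by (intro sum.cong) (auto simp: Z_def d_def algebra_simps)
      also have "\<dots> = ((\<Sum>j\<in>J. Z j \<omega>) - (\<Sum>j\<in>J. expectation (Z j))) + (\<Sum>j\<in>J. w j * d j) + (\<Sum>j\<in>J. w j * (m + a))"
        using EZ by (simp add: sum.distrib sum_subtractf)
      finally have eq: "(\<Sum>j\<in>J. w j * (X j \<omega> + m)) =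
          ((\<Sum>j\<in>J. Z j \<omega>) - (\<Sum>j\<in>J. expectation (Z j))) + (\<Sum>j\<in>J. w j * d j) + (\<Sum>j\<in>J. w j * (m + a))" .
      have 1: "(\<Sum>j\<in>J. Z j \<omega>) - (\<Sum>j\<in>J. expectation (Z j)) > - (\<delta> * T / 3)"
        using o by (auto simp: E1_def)
      have "(\<Sum>j\<in>J. w j * \<bar>d j\<bar>) < \<delta> * T / 3" using o by (auto simp: E2_def d_def)
      moreover have "- (\<Sum>j\<in>J. w j * \<bar>d j\<bar>) \<le> (\<Sum>j\<in>J. w j * d j)"
        unfolding sum_negf[symmetric]
      proof (rule sum_mono)
        fix j assume "j \<in> J"
        hence "w j * (- \<bar>d j\<bar>) \<le> w j * d j" using w by (intro mult_left_mono) auto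
        thus "- (w j * \<bar>d j\<bar>) \<le> w j * d j" by simp
      qed
      ultimately have 2: "(\<Sum>j\<in>J. w j * d j) > - (\<delta> * T / 3)" by linarith
      have "(\<Sum>j\<in>J. w j * (m + a)) \<ge> (\<Sum>j\<in>J. w j * (- \<eta>))"
        using w am by (intro sum_mono mult_left_mono) auto
      hence "(\<Sum>j\<in>J. w j * (m + a)) \<ge> - (\<eta> * (\<Sum>j\<in>J. w j))"
        by (simp add: sum_negf sum_distrib_left mult.commute)
      moreover have "\<eta> * (\<Sum>j\<in>J. w j) \<le> \<eta> * (W * T)" using wsum eta by (intro mult_left_mono) auto
      moreover have "\<eta> * (W * T) \<le> \<delta> / 3 * T"
        using mult_right_mono[OF eta(2), of T] Tpos by (simp add: mult.assoc)
      ultimately have 3: "(\<Sum>j\<in>J. w j * (m + a)) \<ge> - (\<delta> * T / 3)" by simp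
      have "(\<Sum>j\<in>J. w j * (X j \<omega> + m)) > - \<delta> * T" unfolding eq using 1 2 3 by linarith
      thus False using o by simp
    qed
    hence "prob {\<omega> \<in> space M. (\<Sum>j\<in>J. w j * (X j \<omega> + m)) \<le> - \<delta> * T} \<le> prob (E1 \<union> E2)"
      using E1_meas E2_meas by (intro finite_measure_mono) auto
    also have "\<dots> \<le> prob E1 + prob E2" by (rule measure_Un_le[OF E1_meas E2_meas])
    finally show ?thesis using p1 p2 by linarith
  qed
  thus ?thesis by (intro exI[of _ "max 1 T1"] allI impI) simp
qed

end

section \<open>The maximum of the process\<close>

text \<open>Bonferroni's inequality with pair bounds in product form, so that the error is the
  square of a single sum. Events are added one at a time; the overlap of a new one is at most
  \<open>b x\<close> times the old sum, which the growth of the square covers.\<close>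

lemma (in prob_space) union_lower_bound:
  fixes a b :: "'i \<Rightarrow> real"
  assumes "finite I" and "\<And>i. i \<in> I \<Longrightarrow> A i \<in> events"
    and "\<And>i. i \<in> I \<Longrightarrow> a i \<le> prob (A i)" and "\<And>i. i \<in> I \<Longrightarrow> b i \<ge> 0"
    and "\<And>i j. i \<in> I \<Longrightarrow> j \<in> I \<Longrightarrow> i \<noteq> j \<Longrightarrow> prob (A i \<inter> A j) \<le> b i * b j"
  shows "(\<Sum>i\<in>I. a i) - (\<Sum>i\<in>I. b i)\<^sup>2 \<le> prob (\<Union>i\<in>I. A i)"
  using assms
proof (induction I rule: finite_induct)
  case (insert x F)
  define U where "U = (\<Union>i\<in>F. A i)"
  have U: "U \<in> events" unfolding U_def using insert by auto
  have Ax: "A x \<in> events" using insert by auto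
  have "prob (A x \<inter> U) = prob (\<Union>i\<in>F. A x \<inter> A i)" by (simp add: U_def)
  also have "\<dots> \<le> (\<Sum>i\<in>F. prob (A x \<inter> A i))"
    using insert by (intro measure_UNION_le) auto
  also have "\<dots> \<le> (\<Sum>i\<in>F. b x * b i)"
    using insert.hyps insert.prems(4) by (intro sum_mono) auto
  also have "\<dots> = b x * (\<Sum>i\<in>F. b i)" by (simp add: sum_distrib_left)
  finally have int: "prob (A x \<inter> U) \<le> b x * (\<Sum>i\<in>F. b i)" .
  have "prob (A x \<union> U) = prob (A x) + prob U - prob (A x \<inter> U)"
    using measure_Un3[of "A x" M U] Ax U by (simp add: fmeasurable_eq_sets)
  moreover have "(\<Sum>i\<in>F. a i) - (\<Sum>i\<in>F. b i)\<^sup>2 \<le> prob U"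
    unfolding U_def using insert.prems by (intro insert.IH) auto
  moreover have "a x \<le> prob (A x)" using insert.prems by simp
  moreover have "(b x + (\<Sum>i\<in>F. b i))\<^sup>2 \<ge> (\<Sum>i\<in>F. b i)\<^sup>2 + b x * (\<Sum>i\<in>F. b i)"
  proof -
    have "b x \<ge> 0" "(\<Sum>i\<in>F. b i) \<ge> 0" using insert.prems by (auto intro!: sum_nonneg)
    hence "b x * b x \<ge> 0" "b x * (\<Sum>i\<in>F. b i) \<ge> 0" by auto
    thus ?thesis by (simp add: power2_eq_square algebra_simps)
  qed
  ultimately show ?case using int insert.hyps by (simp add: U_def)
qed simp

locale gF_tail = gF_asymptotics c g U h \<alpha> \<gamma> + iid_negative_mean M X D m q C x1
  for c g U h \<alpha> \<gamma> and M :: "'a measure" and X D m q C x1 +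
  assumes D_tail: "\<And>x. measure D {x<..} = h x"
begin

text \<open>The height that a jump has to overcome at time \<open>n\<close>: the target
  \<open>t\<close> plus the accumulated downward drift. It is increasing in
  \<open>n\<close>.\<close>

definition level :: "real \<Rightarrow> nat \<Rightarrow> real" where "level t n = t + m * G n"

definition others :: "nat \<Rightarrow> nat \<Rightarrow> nat set" where "others n k = {1..n} - {k}"

definition exceed :: "real \<Rightarrow> 'a set" where
  "exceed t = {\<omega> \<in> space M. process_max c X \<omega> > ereal t}"

section \<open>Decomposition at a jump, and measurability and probability of the basic
  events\<close>

lemma level_mono: "i \<le> j \<Longrightarrow> level t i \<le> level t j"
  unfolding level_def using G_mono m_pos by (intro add_left_mono mult_left_mono) auto

lemma level_ge: "t \<le> level t n"
  unfolding level_def using G_nonneg[of n] m_pos by simp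

lemma G_eq_sum: "(\<Sum>j\<in>{1..n}. c (n - j)) = G n"
  unfolding G_def by (rule sum.reindex_bij_witness[of _ "\<lambda>i. n - i" "\<lambda>j. n - j"]) auto

lemma process_eq_sum: "process c X n \<omega> = (\<Sum>j\<in>{1..n}. c (n - j) * X j \<omega>)"
  unfolding process_def by (rule sum.reindex_bij_witness[of _ "\<lambda>j. n - j" "\<lambda>i. n - i"]) auto

lemma process_split:
  assumes "k \<in> {1..n}"
  shows "process c X n \<omega> =
    c (n - k) * X k \<omega> + (\<Sum>j\<in>others n k. c (n - j) * (X j \<omega> + m)) - m * (G n - c (n - k))"
proof -
  have "process c X n \<omega> = c (n - k) * X k \<omega> + (\<Sum>j\<in>others n k. c (n - j) * X j \<omega>)"
    unfolding process_eq_sum others_def using assms by (subst sum.remove[of _ k]) auto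
  moreover have "G n = c (n - k) + (\<Sum>j\<in>others n k. c (n - j))"
    unfolding G_eq_sum[symmetric] others_def using assms by (subst sum.remove[of _ k]) auto
  moreover have "(\<Sum>j\<in>others n k. c (n - j) * (X j \<omega> + m)) =
      (\<Sum>j\<in>others n k. c (n - j) * X j \<omega>) + m * (\<Sum>j\<in>others n k. c (n - j))"
    by (simp add: distrib_left sum.distrib sum_distrib_left mult.commute)
  ultimately show ?thesis by (simp add: algebra_simps)
qed

lemma others_props: "finite (others n k)" "others n k \<subseteq> {1..}"
  by (auto simp: others_def)

lemma sum_others_le: "(\<Sum>j\<in>others n k. c (n - j)) \<le> G n"
  unfolding G_eq_sum[symmetric] others_def by (intro sum_mono2) (auto intro: c_nonneg)

lemma sum_others_le_level: "t \<ge> 0 \<Longrightarrow> (\<Sum>j\<in>others n k. c (n - j)) \<le> 1 / m * level t n"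
  using sum_others_le[of n k] m_pos by (simp add: level_def field_simps) (smt (verit) mult_left_mono)

lemma process_measurable: "(\<lambda>\<omega>. process c X n \<omega>) \<in> borel_measurable M"
  unfolding process_eq_sum by (intro borel_measurable_sum borel_measurable_times X_measurable) auto

lemma exceed_eq: "exceed t = (\<Union>n. {\<omega> \<in> space M. process c X n \<omega> > t})"
  unfolding exceed_def process_max_def by (auto simp: less_SUP_iff)

lemma exceed_measurable: "exceed t \<in> events"
  unfolding exceed_eq using process_measurable by measurable

lemma prob_X_greater: "k \<ge> 1 \<Longrightarrow> prob {\<omega> \<in> space M. X k \<omega> > x} = h x"
  using prob_X[of k "{x<..}"] D_tail[of x] by simp

lemma X_greater_measurable: "k \<ge> 1 \<Longrightarrow> {\<omega> \<in> space M. X k \<omega> > x} \<in> events"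
  using X_measurable[of k] by measurable

lemma prob_two_jumps:
  assumes "j \<ge> 1" "k \<ge> 1" "j \<noteq> k"
  shows "prob ({\<omega> \<in> space M. X j \<omega> > x} \<inter> {\<omega> \<in> space M. X k \<omega> > y}) = h x * h y"
proof -
  have "indep_var borel (X j) borel (X k)"
    using indep_vars_sum[of "{k}" j X, OF _ _ indep_vars_subset[OF indep]] assms by simp
  hence "prob ((\<lambda>\<omega>. (X j \<omega>, X k \<omega>)) -` ({x<..} \<times> {y<..}) \<inter> space M) =
      prob (X j -` {x<..} \<inter> space M) * prob (X k -` {y<..} \<inter> space M)"
    by (rule indep_varD) auto
  moreover have "(\<lambda>\<omega>. (X j \<omega>, X k \<omega>)) -` ({x<..} \<times> {y<..}) \<inter> space M =
      {\<omega> \<in> space M. X j \<omega> > x} \<inter> {\<omega> \<in> space M. X k \<omega> > y}" by auto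
  moreover have "X j -` {x<..} \<inter> space M = {\<omega> \<in> space M. X j \<omega> > x}"
    "X k -` {y<..} \<inter> space M = {\<omega> \<in> space M. X k \<omega> > y}" by auto
  ultimately show ?thesis using prob_X_greater assms by simp
qed

lemma jump_partial_sum_le:
  assumes "\<theta> > 0" "t \<ge> 0"
  shows "(\<Sum>k\<in>{1..N}. h (\<theta> * level t k)) \<le> jump_sum m \<theta> t"
proof -
  have "(\<Sum>k\<in>{1..N}. h (\<theta> * level t k)) = (\<Sum>k<N. h (\<theta> * (t + m * G (Suc k))))"
    unfolding level_def by (rule sum.reindex_bij_witness[of _ Suc "\<lambda>k. k - 1"]) auto
  also have "\<dots> \<le> jump_sum m \<theta> t"
    unfolding jump_sum_def
    by (intro sum_le_suminf jump_sum_summable assms m_pos) (auto intro: less_imp_le h_pos)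
  finally show ?thesis .
qed

lemma jump_partial_sum_tendsto:
  assumes "\<theta> > 0" "t \<ge> 0"
  shows "(\<lambda>N. \<Sum>k\<in>{1..N}. h (\<theta> * level t k)) \<longlonglongrightarrow> jump_sum m \<theta> t"
proof -
  have "(\<Sum>k\<in>{1..N}. h (\<theta> * level t k)) = (\<Sum>k<N. h (\<theta> * (t + m * G (Suc k))))" for N
    unfolding level_def by (rule sum.reindex_bij_witness[of _ Suc "\<lambda>k. k - 1"]) auto
  thus ?thesis unfolding jump_sum_def
    using summable_LIMSEQ[OF jump_sum_summable[OF assms(1) m_pos assms(2)]] by simp
qed

text \<open>The sequence index \<open>n\<close> is absorbed by the polynomial growth of \<open>G\<close>, so that the Chernoff
  bounds can be summed over all \<open>n\<close> and all positions of the exceptional jump.\<close>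

lemma level_powr_sum_bound:
  "\<exists>\<Theta>>0. \<exists>L. \<forall>t\<ge>1. \<forall>N. (\<Sum>n\<in>{1..N}. real n * level t n powr (- \<Theta>)) \<le> L * t powr (- (\<alpha> + 2))"
proof -
  define b where "b = \<gamma> / 2"
  have b: "0 < b" "b < \<gamma>" using gamma_pos by (auto simp: b_def)
  obtain \<kappa> where k: "\<kappa> > 0" "\<forall>\<^sub>F x in at_top. \<kappa> * x powr b \<le> G (nat \<lfloor>x\<rfloor>)"
    using G_power_lower_bound[of b] b by auto
  have "\<forall>\<^sub>F n in sequentially. \<kappa> * real n powr b \<le> G n"
    using eventually_compose_filterlim[OF k(2) filterlim_real_sequentially] by simp
  then obtain n1 where n1: "\<And>n. n \<ge> n1 \<Longrightarrow> \<kappa> * real n powr b \<le> G n"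
    by (auto simp: eventually_sequentially)
  define n0 where "n0 = max 1 n1"
  \<comment> \<open>The second entry makes \<open>\<kappa>' * real n powr b \<le> 1\<close> for
    \<open>n < n0\<close>, where the level is bounded below by \<open>t \<ge> 1\<close>
    only.\<close>
  define \<kappa>' where "\<kappa>' = min (m * \<kappa>) (real n0 powr (- b))"
  have k': "\<kappa>' > 0" using m_pos k by (simp add: \<kappa>'_def n0_def)
  have lev: "level t n \<ge> \<kappa>' * real n powr b" if "t \<ge> 1" "n \<ge> 1" for t n
  proof (cases "n \<ge> n0")
    case True
    have "\<kappa>' * real n powr b \<le> m * \<kappa> * real n powr b"
      by (intro mult_right_mono) (auto simp: \<kappa>'_def)
    also have "\<dots> \<le> m * G n"
      using n1[of n] True m_pos by (simp add: n0_def mult.assoc mult_left_mono)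
    finally show ?thesis using that by (simp add: level_def)
  next
    case False
    have "\<kappa>' * real n powr b \<le> real n0 powr (- b) * real n0 powr b"
      using False b by (intro mult_mono powr_mono2) (auto simp: \<kappa>'_def)
    also have "\<dots> = 1" by (simp add: n0_def powr_minus)
    finally show ?thesis using that level_ge[of t n] by linarith
  qed
  \<comment> \<open>The part \<open>\<alpha> + 2\<close> yields the decay in \<open>t\<close>. The
    part \<open>3 / b\<close> turns \<open>real n powr b\<close> into
    \<open>real n powr (- 3)\<close>, which after the factor \<open>real n\<close> leaves a
    convergent series.\<close>
  define \<Theta> where "\<Theta> = (\<alpha> + 2) + 3 / b"
  have Theta: "\<Theta> > 0" using alpha_pos b by (simp add: \<Theta>_def add_pos_pos)
  define S where "S = (\<Sum>n. real n powr (- 2))"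
  have sm: "summable (\<lambda>n. real n powr (- 2))" by (subst summable_real_powr_iff) auto
  define L where "L = \<kappa>' powr (- (3 / b)) * S"
  have "(\<Sum>n\<in>{1..N}. real n * level t n powr (- \<Theta>)) \<le> L * t powr (- (\<alpha> + 2))"
    if t: "t \<ge> 1" for t N
  proof -
    have "(\<Sum>n\<in>{1..N}. real n * level t n powr (- \<Theta>)) \<le>
        (\<Sum>n\<in>{1..N}. t powr (- (\<alpha> + 2)) * \<kappa>' powr (- (3 / b)) * real n powr (- 2))"
    proof (rule sum_mono)
      fix n assume "n \<in> {1..N}"
      hence n: "n \<ge> 1" by simp
      have "level t n powr (- \<Theta>) = level t n powr (- (\<alpha> + 2)) * level t n powr (- (3 / b))"
        by (simp add: \<Theta>_def flip: powr_add)
      also have "\<dots> \<le> t powr (- (\<alpha> + 2)) * (\<kappa>' * real n powr b) powr (- (3 / b))"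
        using lev[OF t n] level_ge[of t n] t n k' alpha_pos b
        by (intro mult_mono powr_mono2') auto
      also have "(\<kappa>' * real n powr b) powr (- (3 / b)) = \<kappa>' powr (- (3 / b)) * (real n powr b) powr (- (3 / b))"
        by (rule powr_mult)
      also have "(real n powr b) powr (- (3 / b)) = real n powr (- 3)"
        using b by (simp add: powr_powr)
      finally have "real n * level t n powr (- \<Theta>) \<le>
          real n * (t powr (- (\<alpha> + 2)) * (\<kappa>' powr (- (3 / b)) * real n powr (- 3)))"
        by (intro mult_left_mono) auto
      also have "\<dots> = t powr (- (\<alpha> + 2)) * \<kappa>' powr (- (3 / b)) * (real n powr 1 * real n powr (- 3))"
        using n by simp
      also have "real n powr 1 * real n powr (- 3) = real n powr (- 2)"
        unfolding powr_add[symmetric] by simp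
      finally show "real n * level t n powr (- \<Theta>) \<le>
          t powr (- (\<alpha> + 2)) * \<kappa>' powr (- (3 / b)) * real n powr (- 2)" .
    qed
    also have "\<dots> = t powr (- (\<alpha> + 2)) * \<kappa>' powr (- (3 / b)) * (\<Sum>n\<in>{1..N}. real n powr (- 2))"
      by (simp add: sum_distrib_left)
    also have "\<dots> \<le> t powr (- (\<alpha> + 2)) * \<kappa>' powr (- (3 / b)) * S"
      unfolding S_def by (intro mult_left_mono sum_le_suminf sm) auto
    finally show ?thesis by (simp add: L_def mult_ac)
  qed
  thus ?thesis using Theta by blast
qed

text \<open>An exceedance at time \<open>n\<close> has three possible causes: two innovations are
  large, the centred sum of the others is large although none of them is, or a single jump carries
  \<open>1 - \<delta>\<close> of the level. They contribute the squared sum, the power of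
  \<open>t\<close> and the main sum.\<close>

lemma prob_exceed_le:
  assumes delta: "0 < \<delta>" "\<delta> < 1"
  shows "\<exists>\<epsilon>>0. \<exists>L. \<forall>\<^sub>F t in at_top.
    prob (exceed t) \<le> jump_sum m ((1 - \<delta>) / c_sup) t + (jump_sum m \<epsilon> t)\<^sup>2 + L * t powr (- (\<alpha> + 2))"
proof -
  obtain \<Theta> L where Theta: "\<Theta> > 0" and L: "\<And>t N. t \<ge> 1 \<Longrightarrow>
      (\<Sum>n\<in>{1..N}. real n * level t n powr (- \<Theta>)) \<le> L * t powr (- (\<alpha> + 2))"
    using level_powr_sum_bound by blast
  \<comment> \<open>A fraction \<delta> of the level is given up in two halves: to the deviation of
    the other innovations, and to the drift \<open>m * c (n - k)\<close> not borne by the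
    jump.\<close>
  define d where "d = \<delta> / 2"
  have d: "d > 0" using delta by (simp add: d_def)
  have W: "1 / m > 0" using m_pos by simp
  obtain \<epsilon> T0 where eps: "\<epsilon> > 0" and T0': "\<forall>T\<ge>T0. \<forall>J w. finite J \<longrightarrow> J \<subseteq> {1..} \<longrightarrow>
      (\<forall>j\<in>J. 0 \<le> w j \<and> w j \<le> c_sup) \<longrightarrow> (\<Sum>j\<in>J. w j) \<le> 1 / m * T \<longrightarrow>
     prob {\<omega> \<in> space M. (\<Sum>j\<in>J. w j * (min (X j \<omega>) (\<epsilon> * T) + m)) \<ge> d * T} \<le> T powr (- \<Theta>)"
    using truncated_sum_tail_bound[OF d W c_sup_pos Theta] by (elim exE conjE) (rule that)
  have T0: "prob {\<omega> \<in> space M. (\<Sum>j\<in>J. w j * (min (X j \<omega>) (\<epsilon> * T) + m)) \<ge> d * T} \<le> T powr (- \<Theta>)"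
    if "T \<ge> T0" "finite J" "J \<subseteq> {1..}" "\<And>j. j \<in> J \<Longrightarrow> 0 \<le> w j \<and> w j \<le> c_sup"
      "(\<Sum>j\<in>J. w j) \<le> 1 / m * T" for T J and w :: "nat \<Rightarrow> real"
    by (rule T0'[rule_format, of T J w]) (use that in auto)
  define \<theta> where "\<theta> = (1 - \<delta>) / c_sup"
  have theta: "\<theta> > 0" using delta c_sup_pos by (simp add: \<theta>_def)
  have "prob (exceed t) \<le> jump_sum m \<theta> t + (jump_sum m \<epsilon> t)\<^sup>2 + L * t powr (- (\<alpha> + 2))"
    if t: "t \<ge> max (max 1 T0) (m * c_sup / d)" for t
  proof -
    have t0: "t \<ge> 1" "t \<ge> T0" "m * c_sup \<le> d * t" using t d by (auto simp: divide_le_eq mult.commute)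
    define E where "E n k = {\<omega> \<in> space M.
        (\<Sum>j\<in>others n k. c (n - j) * (min (X j \<omega>) (\<epsilon> * level t n) + m)) \<ge> d * level t n}" for n k
    \<comment> \<open>The threshold is taken at the time of the innovation, not at the observation
      time \<open>n\<close>; hence the union over pairs does not involve \<open>n\<close>.\<close>
    define B where "B k = {\<omega> \<in> space M. X k \<omega> > \<epsilon> * level t k}" for k
    define H where "H k = {\<omega> \<in> space M. X k \<omega> > \<theta> * level t k}" for k
    define A where "A N = (\<Union>n\<le>N. {\<omega> \<in> space M. process c X n \<omega> > t})" for N
    have E_meas: "E n k \<in> events" for n k
      unfolding E_def using X_measurable others_props(2)[of n k]
      by (intro borel_measurable_le borel_measurable_sum borel_measurable_times borel_measurable_add borel_measurable_min) auto
    have B_meas: "B k \<in> events" and H_meas: "H k \<in> events" if "k \<ge> 1" for k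
      unfolding B_def H_def using X_greater_measurable that by auto
    have A_meas: "A N \<in> events" for N
      unfolding A_def using process_measurable by measurable
    have E_prob: "prob (E n k) \<le> level t n powr (- \<Theta>)" for n k
      unfolding E_def using t0 level_ge[of t n] others_props sum_others_le_level[of t n k]
      by (intro T0) (auto simp: c_nonneg c_le)
    have cover: "A N \<subseteq> (\<Union>n\<in>{1..N}. \<Union>k\<in>{1..n}. E n k) \<union> (\<Union>j\<in>{1..N}. \<Union>k\<in>{1..N} - {j}. B j \<inter> B k) \<union> (\<Union>k\<in>{1..N}. H k)"
      for N
    proof
      fix \<omega> assume "\<omega> \<in> A N"
      then obtain n where n: "n \<le> N" "process c X n \<omega> > t" and o: "\<omega> \<in> space M"
        by (auto simp: A_def)
      \<comment> \<open>At time 0 the process is an empty sum, which cannot exceed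
        \<open>t \<ge> 1\<close>.\<close>
      have n1: "n \<ge> 1" using n t0 by (cases n) (auto simp: process_def)
      show "\<omega> \<in> (\<Union>n\<in>{1..N}. \<Union>k\<in>{1..n}. E n k) \<union> (\<Union>j\<in>{1..N}. \<Union>k\<in>{1..N} - {j}. B j \<inter> B k) \<union> (\<Union>k\<in>{1..N}. H k)"
      proof (rule ccontr)
        assume contra: "\<not> ?thesis"
        have noE: "\<omega> \<notin> E n k" if "k \<in> {1..n}" for k using contra n n1 that by auto
        have noBB: "j = k" if "\<omega> \<in> B j" "\<omega> \<in> B k" "j \<in> {1..n}" "k \<in> {1..n}" for j k
        proof (rule ccontr)
          assume "j \<noteq> k"
          hence "\<omega> \<in> (\<Union>j\<in>{1..N}. \<Union>k\<in>{1..N} - {j}. B j \<inter> B k)"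
            using that n by (intro UN_I[of j] UN_I[of k]) auto
          thus False using contra by blast
        qed
        have noH: "\<omega> \<notin> H k" if "k \<in> {1..n}" for k using contra n that by auto
        \<comment> \<open>The index to be set apart: the only large innovation if there is one,
          otherwise an arbitrary one.\<close>
        obtain k where k: "k \<in> {1..n}" "\<And>j. j \<in> others n k \<Longrightarrow> \<omega> \<notin> B j"
        proof (cases "\<exists>k\<in>{1..n}. \<omega> \<in> B k")
          case True
          then obtain k where "k \<in> {1..n}" "\<omega> \<in> B k" by blast
          thus ?thesis using noBB by (intro that[of k]) (auto simp: others_def)
        next
          case False
          thus ?thesis using n1 by (intro that[of 1]) (auto simp: others_def)
        qed
        have "min (X j \<omega>) (\<epsilon> * level t n) = X j \<omega>" if "j \<in> others n k" for j
        proof -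
          have "X j \<omega> \<le> \<epsilon> * level t j" using k(2)[OF that] o by (auto simp: B_def)
          also have "\<dots> \<le> \<epsilon> * level t n"
            using that eps by (intro mult_left_mono level_mono) (auto simp: others_def)
          finally show ?thesis by simp
        qed
        hence "(\<Sum>j\<in>others n k. c (n - j) * (min (X j \<omega>) (\<epsilon> * level t n) + m)) =
            (\<Sum>j\<in>others n k. c (n - j) * (X j \<omega> + m))" by (intro sum.cong) auto
        hence "(\<Sum>j\<in>others n k. c (n - j) * (X j \<omega> + m)) < d * level t n"
          using noE[OF k(1)] o by (auto simp: E_def)
        moreover have "t < c (n - k) * X k \<omega> + (\<Sum>j\<in>others n k. c (n - j) * (X j \<omega> + m)) - m * (G n - c (n - k))"
          using n(2) process_split[OF k(1)] by simp
        moreover have "m * c (n - k) \<le> d * level t n"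
        proof -
          have "m * c (n - k) \<le> m * c_sup" using m_pos c_le by (intro mult_left_mono) auto
          also have "\<dots> \<le> d * t" using t0 by simp
          also have "\<dots> \<le> d * level t n" using d level_ge by (intro mult_left_mono) auto
          finally show ?thesis .
        qed
        ultimately have "c (n - k) * X k \<omega> > level t n - 2 * (d * level t n)"
          by (simp add: level_def algebra_simps)
        hence "c (n - k) * X k \<omega> > (1 - \<delta>) * level t n" by (simp add: d_def algebra_simps)
        \<comment> \<open>Lowering the level from time \<open>n\<close> to time \<open>k\<close>
          frees the jump event from \<open>n\<close>, so the main term is a sum over jump times
          only.\<close>
        moreover have "(1 - \<delta>) * level t k \<le> (1 - \<delta>) * level t n"
          using delta k by (intro mult_left_mono level_mono) auto
        ultimately have gt: "c (n - k) * X k \<omega> > (1 - \<delta>) * level t k" by linarith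
        have "(1 - \<delta>) * level t k > 0" using delta level_ge[of t k] t0 by (intro mult_pos_pos) auto
        hence "c (n - k) * X k \<omega> > 0" using gt by linarith
        hence "X k \<omega> > 0" using c_nonneg[of "n - k"] by (simp add: zero_less_mult_iff)
        hence "c (n - k) * X k \<omega> \<le> c_sup * X k \<omega>" using c_le by (intro mult_right_mono) auto
        hence "(1 - \<delta>) * level t k < c_sup * X k \<omega>" using gt by linarith
        hence "\<theta> * level t k < X k \<omega>" using c_sup_pos by (simp add: \<theta>_def divide_less_eq mult.commute)
        thus False using noH[OF k(1)] o by (simp add: H_def)
      qed
    qed
    have bound: "prob (A N) \<le> jump_sum m \<theta> t + (jump_sum m \<epsilon> t)\<^sup>2 + L * t powr (- (\<alpha> + 2))" for N
    proof -
      define E' where "E' = (\<Union>n\<in>{1..N}. \<Union>k\<in>{1..n}. E n k)"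
      define B' where "B' = (\<Union>j\<in>{1..N}. \<Union>k\<in>{1..N} - {j}. B j \<inter> B k)"
      define H' where "H' = (\<Union>k\<in>{1..N}. H k)"
      have meas: "E' \<in> events" "B' \<in> events" "H' \<in> events"
        unfolding E'_def B'_def H'_def using E_meas B_meas H_meas by (auto intro!: sets.finite_UN)
      have "prob E' \<le> (\<Sum>n\<in>{1..N}. \<Sum>k\<in>{1..n}. prob (E n k))"
        unfolding E'_def using E_meas
        by (intro order_trans[OF measure_UNION_le] sum_mono measure_UNION_le) auto
      also have "\<dots> \<le> (\<Sum>n\<in>{1..N}. \<Sum>k\<in>{1..n}. level t n powr (- \<Theta>))"
        by (intro sum_mono E_prob)
      also have "\<dots> \<le> L * t powr (- (\<alpha> + 2))" using L[OF t0(1)] by simp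
      finally have 1: "prob E' \<le> L * t powr (- (\<alpha> + 2))" .
      define s where "s = (\<Sum>k\<in>{1..N}. h (\<epsilon> * level t k))"
      have s0: "s \<ge> 0" unfolding s_def by (intro sum_nonneg less_imp_le[OF h_pos])
      have "prob B' \<le> (\<Sum>j\<in>{1..N}. \<Sum>k\<in>{1..N} - {j}. prob (B j \<inter> B k))"
        unfolding B'_def using B_meas
        by (intro order_trans[OF measure_UNION_le] sum_mono measure_UNION_le) (auto intro!: sets.finite_UN)
      also have "\<dots> = (\<Sum>j\<in>{1..N}. \<Sum>k\<in>{1..N} - {j}. h (\<epsilon> * level t j) * h (\<epsilon> * level t k))"
        unfolding B_def by (intro sum.cong refl prob_two_jumps) auto
      also have "\<dots> \<le> (\<Sum>j\<in>{1..N}. \<Sum>k\<in>{1..N}. h (\<epsilon> * level t j) * h (\<epsilon> * level t k))"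
        by (intro sum_mono sum_mono2) (auto intro!: mult_nonneg_nonneg less_imp_le[OF h_pos])
      also have "\<dots> = s\<^sup>2" by (simp add: s_def power2_eq_square sum_product)
      also have "\<dots> \<le> (jump_sum m \<epsilon> t)\<^sup>2"
        using jump_partial_sum_le[OF eps, of t N] t0 s0 by (intro power_mono) (auto simp: s_def)
      finally have 2: "prob B' \<le> (jump_sum m \<epsilon> t)\<^sup>2" .
      have "prob H' \<le> (\<Sum>k\<in>{1..N}. prob (H k))"
        unfolding H'_def using H_meas by (intro measure_UNION_le) auto
      also have "\<dots> = (\<Sum>k\<in>{1..N}. h (\<theta> * level t k))"
        unfolding H_def by (intro sum.cong refl prob_X_greater) auto
      also have "\<dots> \<le> jump_sum m \<theta> t" using theta t0 by (intro jump_partial_sum_le) auto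
      finally have 3: "prob H' \<le> jump_sum m \<theta> t" .
      have "prob (A N) \<le> prob (E' \<union> B' \<union> H')"
        using cover[of N] meas by (intro finite_measure_mono) (auto simp: E'_def B'_def H'_def)
      also have "\<dots> \<le> prob E' + prob B' + prob H'"
        using meas by (intro order_trans[OF measure_Un_le] add_mono measure_Un_le) auto
      finally show ?thesis using 1 2 3 by linarith
    qed
    \<comment> \<open>The bound for finite horizons does not depend on \<open>N\<close>, so
      continuity from below carries it over to the supremum over all times.\<close>
    have "(\<lambda>N. prob (A N)) \<longlonglongrightarrow> prob (\<Union>N. A N)"
      by (rule finite_Lim_measure_incseq) (use A_meas in \<open>force simp: A_def incseq_def\<close>)+
    moreover have "(\<Union>N. A N) = exceed t" by (auto simp: A_def exceed_eq)
    ultimately have "(\<lambda>N. prob (A N)) \<longlonglongrightarrow> prob (exceed t)" by simp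
    thus ?thesis by (rule LIMSEQ_le_const2) (use bound in auto)
  qed
  hence "\<forall>\<^sub>F t in at_top. prob (exceed t) \<le> jump_sum m \<theta> t + (jump_sum m \<epsilon> t)\<^sup>2 + L * t powr (- (\<alpha> + 2))"
    unfolding eventually_at_top_linorder by blast
  thus ?thesis using eps unfolding \<theta>_def by blast
qed

lemma prob_jump_and_others:
  assumes k: "k \<in> {1..n}"
  shows "prob ({\<omega> \<in> space M. X k \<omega> > x} \<inter> {\<omega> \<in> space M. (\<Sum>j\<in>others n k. c (n - j) * (X j \<omega> + m)) > y}) =
     h x * prob {\<omega> \<in> space M. (\<Sum>j\<in>others n k. c (n - j) * (X j \<omega> + m)) > y}"
proof -
  define f where "f j x = (if j = k then x else c (n - j) * (x + m))" for j and x :: real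
  have "indep_vars (\<lambda>_. borel) (\<lambda>j \<omega>. f j (X j \<omega>)) {1..n}"
    by (rule indep_vars_compose2[OF indep_vars_subset[OF indep]]) (auto simp: f_def)
  moreover have "{1..n} = insert k (others n k)" using k by (auto simp: others_def)
  ultimately have "indep_vars (\<lambda>_. borel) (\<lambda>j \<omega>. f j (X j \<omega>)) (insert k (others n k))" by simp
  hence "indep_var borel (\<lambda>\<omega>. f k (X k \<omega>)) borel (\<lambda>\<omega>. \<Sum>j\<in>others n k. f j (X j \<omega>))"
    by (intro indep_vars_sum) (auto simp: others_def)
  moreover have "(\<lambda>\<omega>. f k (X k \<omega>)) = X k" by (simp add: f_def)
  moreover have "(\<Sum>j\<in>others n k. f j (X j \<omega>)) = (\<Sum>j\<in>others n k. c (n - j) * (X j \<omega> + m))" for \<omega>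
    by (intro sum.cong) (auto simp: f_def others_def)
  ultimately have "indep_var borel (X k) borel (\<lambda>\<omega>. \<Sum>j\<in>others n k. c (n - j) * (X j \<omega> + m))"
    (is "indep_var _ _ _ ?R") by simp
  hence "prob ((\<lambda>\<omega>. (X k \<omega>, ?R \<omega>)) -` ({x<..} \<times> {y<..}) \<inter> space M) =
      prob (X k -` {x<..} \<inter> space M) * prob (?R -` {y<..} \<inter> space M)"
    by (rule indep_varD) auto
  moreover have "(\<lambda>\<omega>. (X k \<omega>, ?R \<omega>)) -` ({x<..} \<times> {y<..}) \<inter> space M =
      {\<omega> \<in> space M. X k \<omega> > x} \<inter> {\<omega> \<in> space M. ?R \<omega> > y}" by auto
  moreover have "X k -` {x<..} \<inter> space M = {\<omega> \<in> space M. X k \<omega> > x}"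
    "?R -` {y<..} \<inter> space M = {\<omega> \<in> space M. ?R \<omega> > y}" by auto
  ultimately show ?thesis using prob_X_greater[of k x] k by simp
qed

text \<open>A jump at time \<open>k\<close> is observed at time \<open>k + i\<close>, where it
  carries the coefficient \<open>c i\<close>. The other innovations are independent of it and, by
  the weak law, fall short of their mean by more than a small fraction of the level with probability
  at most \<open>e\<close>. Different \<open>k\<close> overlap only if two jumps occur.\<close>

lemma prob_exceed_ge:
  assumes delta: "0 < \<delta>" and e: "0 < e" "e < 1" and ci: "c i > 0"
  shows "\<forall>\<^sub>F t in at_top. (1 - e) * jump_sum m ((1 + \<delta>) / c i) t - (jump_sum m ((1 + \<delta>) / c i) t)\<^sup>2 \<le> prob (exceed t)"
proof -
  define d where "d = \<delta> / 2"
  have d: "d > 0" using delta by (simp add: d_def)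
  have W: "1 / m > 0" using m_pos by simp
  obtain T0 where T0': "\<forall>T\<ge>T0. \<forall>J w. finite J \<longrightarrow> J \<subseteq> {1..} \<longrightarrow>
      (\<forall>j\<in>J. 0 \<le> w j \<and> w j \<le> c_sup) \<longrightarrow> (\<Sum>j\<in>J. w j) \<le> 1 / m * T \<longrightarrow>
     prob {\<omega> \<in> space M. (\<Sum>j\<in>J. w j * (X j \<omega> + m)) \<le> - d * T} \<le> e"
    using weak_law[OF d W c_sup_pos e(1)] by (elim exE) (rule that)
  have T0: "prob {\<omega> \<in> space M. (\<Sum>j\<in>J. w j * (X j \<omega> + m)) \<le> - d * T} \<le> e"
    if "T \<ge> T0" "finite J" "J \<subseteq> {1..}" "\<And>j. j \<in> J \<Longrightarrow> 0 \<le> w j \<and> w j \<le> c_sup"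
      "(\<Sum>j\<in>J. w j) \<le> 1 / m * T" for T J and w :: "nat \<Rightarrow> real"
    by (rule T0'[rule_format, of T J w]) (use that in auto)
  define \<theta> where "\<theta> = (1 + \<delta>) / c i"
  have theta: "\<theta> > 0" using delta ci by (simp add: \<theta>_def)
  \<comment> \<open>The \<open>i\<close> further steps raise the drift by at most
    \<open>m * (real i * c_sup)\<close>; the factor \<open>1 + d\<close> also covers the effect on
    the allowed deviation. For \<open>t \<ge> K / d\<close> this is at most
    \<open>d * t\<close>.\<close>
  define K where "K = (1 + d) * (m * (real i * c_sup))"
  have "(1 - e) * jump_sum m \<theta> t - (jump_sum m \<theta> t)\<^sup>2 \<le> prob (exceed t)"
    if t: "t \<ge> max (max 1 T0) (K / d)" for t
  proof -
    have t0: "t \<ge> 1" "t \<ge> T0" "K \<le> d * t" using t d by (auto simp: divide_le_eq mult.commute)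
    define R where "R k \<omega> = (\<Sum>j\<in>others (k + i) k. c (k + i - j) * (X j \<omega> + m))" for k \<omega>
    define H where "H k = {\<omega> \<in> space M. X k \<omega> > \<theta> * level t k}" for k
    define Q where "Q k = {\<omega> \<in> space M. R k \<omega> > - d * level t (k + i)}" for k
    have R_meas: "R k \<in> borel_measurable M" for k
      unfolding R_def[abs_def] using X_measurable others_props(2)[of "k + i" k]
      by (intro borel_measurable_sum borel_measurable_times borel_measurable_add) auto
    have Q_meas: "Q k \<in> events" for k unfolding Q_def using R_meas by measurable
    have H_meas: "H k \<in> events" if "k \<ge> 1" for k
      unfolding H_def using X_greater_measurable that by auto
    have Q_prob: "prob (Q k) \<ge> 1 - e" for k
    proof -
      have "prob {\<omega> \<in> space M. R k \<omega> \<le> - d * level t (k + i)} \<le> e"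
        unfolding R_def using t0 level_ge[of t "k + i"] others_props sum_others_le_level[of t "k + i" k]
        by (intro T0) (auto simp: c_nonneg c_le)
      moreover have "{\<omega> \<in> space M. R k \<omega> \<le> - d * level t (k + i)} = space M - Q k"
        by (auto simp: Q_def)
      ultimately show ?thesis using prob_compl[OF Q_meas[of k]] by simp
    qed
    have sub: "H k \<inter> Q k \<subseteq> exceed t" if "k \<ge> 1" for k
    proof
      fix \<omega> assume o: "\<omega> \<in> H k \<inter> Q k"
      define n where "n = k + i"
      have split: "process c X n \<omega> = c i * X k \<omega> + R k \<omega> - m * (G n - c i)"
        using process_split[of k n \<omega>] that by (simp add: n_def R_def)
      have "c i * (\<theta> * level t k) < c i * X k \<omega>"
        using o ci by (intro mult_strict_left_mono) (auto simp: H_def)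
      hence 1: "(1 + \<delta>) * level t k < c i * X k \<omega>" using ci by (simp add: \<theta>_def)
      have 2: "R k \<omega> > - d * level t n" using o by (simp add: Q_def n_def)
      have "G n \<le> G k + real i * c_sup" unfolding n_def
      proof (induction i)
        case (Suc i)
        thus ?case using c_le[of "k + i"] by (simp add: G_Suc algebra_simps)
      qed simp
      hence "m * G n \<le> m * (G k + real i * c_sup)" using m_pos by (intro mult_left_mono) auto
      hence 3: "m * G n \<le> m * G k + m * (real i * c_sup)" by (simp add: distrib_left)
      hence "d * level t n \<le> d * (level t k + m * (real i * c_sup))"
        using d by (intro mult_left_mono) (auto simp: level_def)
      hence 4: "d * level t n \<le> d * level t k + d * (m * (real i * c_sup))" by (simp add: distrib_left)
      have "d * t \<le> d * level t k" using d level_ge by (intro mult_left_mono) auto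
      hence 5: "m * (real i * c_sup) + d * (m * (real i * c_sup)) \<le> d * level t k"
        using t0(3) by (simp add: K_def distrib_right)
      have 6: "m * c i \<ge> 0" using m_pos ci by simp
      have "(1 + \<delta>) * level t k = level t k + (d * level t k + d * level t k)"
        by (simp add: d_def distrib_right)
      moreover have "level t k = t + m * G k" by (simp add: level_def)
      moreover have "- d * level t n = - (d * level t n)" by simp
      moreover have "m * (G n - c i) = m * G n - m * c i" by (simp add: right_diff_distrib)
      ultimately have "process c X n \<omega> > t"
        unfolding split using 1 2 3 4 5 6 by linarith
      thus "\<omega> \<in> exceed t" using o by (auto simp: exceed_eq H_def)
    qed
    have fin: "(1 - e) * (\<Sum>k\<in>{1..N}. h (\<theta> * level t k)) - (\<Sum>k\<in>{1..N}. h (\<theta> * level t k))\<^sup>2 \<le> prob (exceed t)" for N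
    proof -
      have "(\<Sum>k\<in>{1..N}. (1 - e) * h (\<theta> * level t k)) - (\<Sum>k\<in>{1..N}. h (\<theta> * level t k))\<^sup>2 \<le>
          prob (\<Union>k\<in>{1..N}. H k \<inter> Q k)"
      proof (rule union_lower_bound)
        show "(1 - e) * h (\<theta> * level t k) \<le> prob (H k \<inter> Q k)" if "k \<in> {1..N}" for k
        proof -
          have "prob (H k \<inter> Q k) = h (\<theta> * level t k) * prob (Q k)"
            unfolding H_def Q_def R_def using that by (intro prob_jump_and_others) auto
          moreover have "h (\<theta> * level t k) * (1 - e) \<le> h (\<theta> * level t k) * prob (Q k)"
            by (rule mult_left_mono[OF Q_prob less_imp_le[OF h_pos]])
          ultimately show ?thesis by (simp add: mult.commute)
        qed
        show "prob ((H k \<inter> Q k) \<inter> (H j \<inter> Q j)) \<le> h (\<theta> * level t k) * h (\<theta> * level t j)"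
          if "k \<in> {1..N}" "j \<in> {1..N}" "k \<noteq> j" for k j
        proof -
          have "prob ((H k \<inter> Q k) \<inter> (H j \<inter> Q j)) \<le> prob (H k \<inter> H j)"
            using H_meas that by (intro finite_measure_mono) auto
          also have "\<dots> = h (\<theta> * level t k) * h (\<theta> * level t j)"
            unfolding H_def using that by (intro prob_two_jumps) auto
          finally show ?thesis .
        qed
      qed (use H_meas Q_meas in \<open>auto intro: less_imp_le h_pos\<close>)
      also have "\<dots> \<le> prob (exceed t)"
        using sub by (intro finite_measure_mono exceed_measurable UN_least) auto
      finally show ?thesis by (simp add: sum_distrib_left)
    qed
    have "(\<lambda>N. (1 - e) * (\<Sum>k\<in>{1..N}. h (\<theta> * level t k)) - (\<Sum>k\<in>{1..N}. h (\<theta> * level t k))\<^sup>2)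
        \<longlonglongrightarrow> (1 - e) * jump_sum m \<theta> t - (jump_sum m \<theta> t)\<^sup>2"
      using t0 by (intro tendsto_intros jump_partial_sum_tendsto theta) auto
    thus ?thesis by (rule LIMSEQ_le_const2) (use fin in auto)
  qed
  thus ?thesis unfolding \<theta>_def eventually_at_top_linorder by blast
qed

text \<open>The limit of \<open>jump_sum m \<theta> t / (U t * h t)\<close> for
  \<open>\<theta> = 1\<close>; a general \<theta> contributes the factor
  \<open>\<theta> powr (- \<alpha>)\<close>.\<close>

definition jump_const :: real where
  "jump_const = (m / Gamma (1 + \<gamma>)) powr (- (1 / \<gamma>)) / \<gamma> * Beta (1 / \<gamma>) (\<alpha> - 1 / \<gamma>)"

section \<open>Passage to the limit and the theorem\<close>

lemma jump_const_pos: "jump_const > 0"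
proof -
  have "Beta (1 / \<gamma>) (\<alpha> - 1 / \<gamma>) > 0"
    unfolding Beta_def using gamma_pos alpha_gamma' alpha_pos
    by (intro divide_pos_pos mult_pos_pos Gamma_real_pos) auto
  moreover have "m / Gamma (1 + \<gamma>) > 0" using m_pos Gamma_gamma_pos by simp
  hence "(m / Gamma (1 + \<gamma>)) powr (- (1 / \<gamma>)) > 0" by (subst powr_gt_zero) auto
  ultimately show ?thesis unfolding jump_const_def using gamma_pos by (intro mult_pos_pos divide_pos_pos)
qed

lemma jump_sum_ratio:
  assumes "\<theta> > 0"
  shows "((\<lambda>t. jump_sum m \<theta> t / (U t * h t)) \<longlongrightarrow> \<theta> powr (- \<alpha>) * jump_const) at_top"
  unfolding jump_const_def by (rule jump_sum_asymptotics[OF assms m_pos])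

lemma jump_sum_tendsto_0:
  assumes "\<theta> > 0"
  shows "(jump_sum m \<theta> \<longlongrightarrow> 0) at_top"
proof -
  have "((\<lambda>t. jump_sum m \<theta> t / (U t * h t) * (U t * h t)) \<longlongrightarrow> \<theta> powr (- \<alpha>) * jump_const * 0) at_top"
    by (intro tendsto_mult jump_sum_ratio assms U_h_tendsto_0)
  moreover have "\<forall>\<^sub>F t in at_top. U t > 0" using U_at_top unfolding filterlim_at_top_dense by blast
  hence "\<forall>\<^sub>F t in at_top. jump_sum m \<theta> t / (U t * h t) * (U t * h t) = jump_sum m \<theta> t"
  proof eventually_elim
    case (elim t)
    thus ?case using h_pos[of t] by simp
  qed
  ultimately show ?thesis using Lim_transform_eventually by fastforce
qed

text \<open>Division by \<open>U t * h t\<close> turns both bounds into limits that depend on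
  \<delta> only through powers continuous at 0; squares vanish because a jump sum itself tends to 0.
  Letting \<delta> tend to 0 makes the bounds meet.\<close>

lemma prob_exceed_ratio:
  "((\<lambda>t. prob (exceed t) / (U t * h t)) \<longlongrightarrow> c_sup powr \<alpha> * jump_const) at_top"
proof -
  have Upos: "\<forall>\<^sub>F t in at_top. U t > 0" using U_at_top unfolding filterlim_at_top_dense by blast
  show ?thesis
  proof (rule order_tendstoI)
    fix a assume a: "a < c_sup powr \<alpha> * jump_const"
    have lim: "((\<lambda>\<delta>. (1 - \<delta>) * (((1 + \<delta>) / ((1 - \<delta>) * c_sup)) powr (- \<alpha>) * jump_const)) \<longlongrightarrow>
        (1 - 0) * (((1 + 0) / ((1 - 0) * c_sup)) powr (- \<alpha>) * jump_const)) (at_right 0)"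
      using c_sup_pos by (intro tendsto_intros) auto
    have eq: "(1 - 0) * (((1 + 0) / ((1 - 0) * c_sup)) powr (- \<alpha>) * jump_const) = c_sup powr \<alpha> * jump_const"
      using c_sup_pos by (simp add: powr_divide powr_minus)
    have "\<forall>\<^sub>F \<delta> in at_right 0. (1 - \<delta>) * (((1 + \<delta>) / ((1 - \<delta>) * c_sup)) powr (- \<alpha>) * jump_const) > a"
      by (rule order_tendstoD(1)[OF lim[unfolded eq] a])
    moreover have "\<forall>\<^sub>F \<delta> in at_right (0::real). \<delta> \<in> {0<..<1}"
      by (rule eventually_at_right_real) simp
    ultimately have "\<forall>\<^sub>F \<delta> in at_right 0. (1 - \<delta>) * (((1 + \<delta>) / ((1 - \<delta>) * c_sup)) powr (- \<alpha>) * jump_const) > a \<and> \<delta> \<in> {0<..<1}"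
      by (rule eventually_conj)
    then obtain \<delta> where d: "(1 - \<delta>) * (((1 + \<delta>) / ((1 - \<delta>) * c_sup)) powr (- \<alpha>) * jump_const) > a" "0 < \<delta>" "\<delta> < 1"
      using eventually_happens'[OF trivial_limit_at_right_real] by auto
    \<comment> \<open>A coefficient above this value gives
      \<open>\<theta> \<le> (1 + \<delta>) / ((1 - \<delta>) * c_sup)\<close>, so the lower bound
      loses only a factor close to 1. The same \<delta> serves as the failure probability in the
      weak law.\<close>
    define y where "y = (1 - \<delta>) * c_sup"
    have "y < c_sup" using d c_sup_pos by (simp add: y_def)
    hence "\<exists>i\<in>UNIV. y < c i" unfolding c_sup_def using c_bdd by (subst (asm) less_cSUP_iff) auto
    then obtain i where i: "(1 - \<delta>) * c_sup < c i" by (auto simp: y_def)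
    have "(1 - \<delta>) * c_sup > 0" using d c_sup_pos by simp
    hence ci: "c i > 0" using i by linarith
    define \<theta> where "\<theta> = (1 + \<delta>) / c i"
    have theta: "\<theta> > 0" using d ci by (simp add: \<theta>_def)
    have "\<theta> \<le> (1 + \<delta>) / ((1 - \<delta>) * c_sup)"
      unfolding \<theta>_def using i d ci c_sup_pos by (intro divide_left_mono mult_pos_pos) auto
    hence "((1 + \<delta>) / ((1 - \<delta>) * c_sup)) powr (- \<alpha>) \<le> \<theta> powr (- \<alpha>)"
      using theta alpha_pos by (intro powr_mono2') auto
    hence "(1 - \<delta>) * (((1 + \<delta>) / ((1 - \<delta>) * c_sup)) powr (- \<alpha>) * jump_const) \<le> (1 - \<delta>) * (\<theta> powr (- \<alpha>) * jump_const)"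
      using d jump_const_pos by (intro mult_left_mono mult_right_mono) auto
    hence lt: "a < (1 - \<delta>) * (\<theta> powr (- \<alpha>) * jump_const) - \<theta> powr (- \<alpha>) * jump_const * 0" using d by linarith
    have "((\<lambda>t. (1 - \<delta>) * (jump_sum m \<theta> t / (U t * h t)) - jump_sum m \<theta> t / (U t * h t) * jump_sum m \<theta> t) \<longlongrightarrow>
        (1 - \<delta>) * (\<theta> powr (- \<alpha>) * jump_const) - \<theta> powr (- \<alpha>) * jump_const * 0) at_top"
      by (intro tendsto_intros jump_sum_ratio jump_sum_tendsto_0 theta)
    from order_tendstoD(1)[OF this lt]
    have ev: "\<forall>\<^sub>F t in at_top. a < (1 - \<delta>) * (jump_sum m \<theta> t / (U t * h t)) - jump_sum m \<theta> t / (U t * h t) * jump_sum m \<theta> t" .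
    have "\<forall>\<^sub>F t in at_top. (1 - \<delta>) * jump_sum m \<theta> t - (jump_sum m \<theta> t)\<^sup>2 \<le> prob (exceed t)"
      unfolding \<theta>_def by (rule prob_exceed_ge[where i = i]) (use d ci in auto)
    thus "\<forall>\<^sub>F t in at_top. a < prob (exceed t) / (U t * h t)"
      using ev Upos
    proof eventually_elim
      case (elim t)
      have "((1 - \<delta>) * jump_sum m \<theta> t - (jump_sum m \<theta> t)\<^sup>2) / (U t * h t) \<le> prob (exceed t) / (U t * h t)"
        using elim h_pos[of t] by (intro divide_right_mono) auto
      moreover have "((1 - \<delta>) * jump_sum m \<theta> t - (jump_sum m \<theta> t)\<^sup>2) / (U t * h t) =
          (1 - \<delta>) * (jump_sum m \<theta> t / (U t * h t)) - jump_sum m \<theta> t / (U t * h t) * jump_sum m \<theta> t"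
        by (simp add: diff_divide_distrib power2_eq_square)
      ultimately show ?case using elim by linarith
    qed
  next
    fix a assume a: "a > c_sup powr \<alpha> * jump_const"
    have lim: "((\<lambda>\<delta>. ((1 - \<delta>) / c_sup) powr (- \<alpha>) * jump_const) \<longlongrightarrow>
        ((1 - 0) / c_sup) powr (- \<alpha>) * jump_const) (at_right 0)"
      using c_sup_pos by (intro tendsto_intros) auto
    have eq: "((1 - 0) / c_sup) powr (- \<alpha>) * jump_const = c_sup powr \<alpha> * jump_const"
      using c_sup_pos by (simp add: powr_divide powr_minus)
    have "\<forall>\<^sub>F \<delta> in at_right 0. ((1 - \<delta>) / c_sup) powr (- \<alpha>) * jump_const < a"
      by (rule order_tendstoD(2)[OF lim[unfolded eq] a])
    moreover have "\<forall>\<^sub>F \<delta> in at_right (0::real). \<delta> \<in> {0<..<1}"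
      by (rule eventually_at_right_real) simp
    ultimately have "\<forall>\<^sub>F \<delta> in at_right 0. ((1 - \<delta>) / c_sup) powr (- \<alpha>) * jump_const < a \<and> \<delta> \<in> {0<..<1}"
      by (rule eventually_conj)
    then obtain \<delta> where d: "((1 - \<delta>) / c_sup) powr (- \<alpha>) * jump_const < a" "0 < \<delta>" "\<delta> < 1"
      using eventually_happens'[OF trivial_limit_at_right_real] by auto
    define \<theta> where "\<theta> = (1 - \<delta>) / c_sup"
    have theta: "\<theta> > 0" using d c_sup_pos by (simp add: \<theta>_def)
    obtain \<epsilon> L where eps: "\<epsilon> > 0" and bound: "\<forall>\<^sub>F t in at_top.
        prob (exceed t) \<le> jump_sum m \<theta> t + (jump_sum m \<epsilon> t)\<^sup>2 + L * t powr (- (\<alpha> + 2))"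
      using prob_exceed_le[OF d(2,3), folded \<theta>_def] by (elim exE conjE) (rule that)
    have rem: "((\<lambda>t. t powr (- (\<alpha> + 2)) / (U t * h t)) \<longlongrightarrow> 0) at_top"
    proof -
      obtain \<kappa> where k: "\<kappa> > 0" "\<forall>\<^sub>F t in at_top. \<kappa> * t powr (- (\<alpha> + 1)) \<le> U t * h t"
        using U_h_lower_bound by blast
      have ratio_le: "p / u \<le> 1 / \<kappa> * r" if "\<kappa> * p \<le> u * r" "u > 0" for p u r
        using that k(1) by (simp add: field_simps)
      have "\<forall>\<^sub>F t in at_top. norm (t powr (- (\<alpha> + 2)) / (U t * h t)) \<le> 1 / \<kappa> * t powr (- 1)"
        using k(2) Upos eventually_gt_at_top[of 0]
      proof eventually_elim
        case (elim t)
        have Uh: "U t * h t > 0" using elim h_pos[of t] by simp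
        have "\<kappa> * t powr (- (\<alpha> + 1)) * t powr (- 1) \<le> U t * h t * t powr (- 1)"
          using elim by (intro mult_right_mono) auto
        moreover have "t powr (- (\<alpha> + 1)) * t powr (- 1) = t powr (- (\<alpha> + 2))"
          unfolding powr_add[symmetric] by (rule arg_cong[where f = "\<lambda>x. t powr x"]) simp
        ultimately have "\<kappa> * t powr (- (\<alpha> + 2)) \<le> U t * h t * t powr (- 1)"
          by (simp only: mult.assoc)
        hence "t powr (- (\<alpha> + 2)) / (U t * h t) \<le> 1 / \<kappa> * t powr (- 1)"
          using Uh by (rule ratio_le)
        thus ?case using Uh by simp
      qed
      moreover have "((\<lambda>t. 1 / \<kappa> * t powr (- 1)) \<longlongrightarrow> 1 / \<kappa> * 0) at_top"
        by (intro tendsto_intros tendsto_neg_powr filterlim_ident) auto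
      hence "((\<lambda>t. 1 / \<kappa> * t powr (- 1)) \<longlongrightarrow> 0) at_top" by simp
      ultimately show ?thesis by (rule Lim_null_comparison)
    qed
    have lt: "\<theta> powr (- \<alpha>) * jump_const + \<epsilon> powr (- \<alpha>) * jump_const * 0 + L * 0 < a"
      using d by (simp add: \<theta>_def)
    have "((\<lambda>t. jump_sum m \<theta> t / (U t * h t) + jump_sum m \<epsilon> t / (U t * h t) * jump_sum m \<epsilon> t +
          L * (t powr (- (\<alpha> + 2)) / (U t * h t))) \<longlongrightarrow>
        \<theta> powr (- \<alpha>) * jump_const + \<epsilon> powr (- \<alpha>) * jump_const * 0 + L * 0) at_top"
      by (intro tendsto_intros jump_sum_ratio jump_sum_tendsto_0 theta eps rem)
    from order_tendstoD(2)[OF this lt]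
    have ev: "\<forall>\<^sub>F t in at_top. jump_sum m \<theta> t / (U t * h t) + jump_sum m \<epsilon> t / (U t * h t) * jump_sum m \<epsilon> t +
          L * (t powr (- (\<alpha> + 2)) / (U t * h t)) < a" .
    show "\<forall>\<^sub>F t in at_top. prob (exceed t) / (U t * h t) < a"
      using bound ev Upos
    proof eventually_elim
      case (elim t)
      have "prob (exceed t) / (U t * h t) \<le>
          (jump_sum m \<theta> t + (jump_sum m \<epsilon> t)\<^sup>2 + L * t powr (- (\<alpha> + 2))) / (U t * h t)"
        using elim h_pos[of t] by (intro divide_right_mono) auto
      also have "\<dots> = jump_sum m \<theta> t / (U t * h t) + jump_sum m \<epsilon> t / (U t * h t) * jump_sum m \<epsilon> t +
          L * (t powr (- (\<alpha> + 2)) / (U t * h t))"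
        by (simp add: add_divide_distrib power2_eq_square)
      finally show ?case using elim by linarith
    qed
  qed
qed

end

theorem theorem2p1p1:
  fixes P :: "'a measure"
    and g F U :: "real \<Rightarrow> real"
    and c :: "nat \<Rightarrow> real"
    and X :: "nat \<Rightarrow> 'a \<Rightarrow> real"
    and \<alpha> \<gamma> \<mu> :: real
  assumes "gF_process P g c F X"
    and "\<And>n. c n \<ge> 0"
    and "regularly_varying_seq c (\<gamma> - 1)"
    and "\<not> summable c"
    and "c \<longlonglongrightarrow> 0"
    and "\<gamma> = 1 \<longrightarrow> (\<exists>h. monoseq h \<and> c \<sim>[sequentially] h)"
    and "distribution_function F"
    and "has_mean F \<mu>"
    and "\<mu> < 0"
    and "regularly_varying (tail F) (- \<alpha>)"
    and "\<alpha> > 0"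
    and "1 / \<alpha> < \<gamma>"
    and "\<gamma> < 1"
    and "inverse_growth g \<gamma> U"
  shows "(\<lambda>t. measure P {\<omega> \<in> space P. process_max c X \<omega> > ereal t}) \<sim>[at_top]
    (\<lambda>t. (SUP i. c i) powr \<alpha> / \<gamma> * Beta (1 / \<gamma>) (\<alpha> - 1 / \<gamma>) *
          (Gamma (1 + \<gamma>) / (- \<mu>)) powr (1 / \<gamma>) * U t * tail F t)"
proof -
  have P: "prob_space P" and g_sums: "\<And>x. x \<in> {-1<..<1} \<Longrightarrow> (\<lambda>n. c n * x ^ n) sums g x"
    and indep: "prob_space.indep_vars P (\<lambda>_. borel) X {1..}"
    and cdf_X: "\<And>n. n \<ge> 1 \<Longrightarrow> cdf (distr P borel (X n)) = F"
    using assms(1) by (auto simp: gF_process_def)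
  interpret P: prob_space P by (rule P)
  have F_mono: "F x \<le> F y" if "x \<le> y" for x y
    using assms(7) that by (auto simp: distribution_function_def mono_def)
  have anti: "antimono (tail F)"
    by (auto simp: tail_def antimono_def F_mono)
  interpret A: gF_asymptotics c g U "tail F" \<alpha> \<gamma>
    by unfold_locales (use assms g_sums anti in auto)
  \<comment> \<open>The mean is stated for the Stieltjes measure of \<open>F\<close>, the process
    through distribution functions. Uniqueness of a law with given distribution function identifies
    the two.\<close>
  define D where "D = interval_measure F"
  have D: "real_distribution D" unfolding D_def
    using assms(7) by (intro real_distribution_interval_measure) (auto simp: distribution_function_def mono_def)
  interpret D: real_distribution D by (rule D)
  have cdf_D: "cdf D = F" unfolding D_def
    using assms(7) by (intro cdf_interval_measure) (auto simp: distribution_function_def mono_def)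
  have distr_X: "distr P borel (X n) = D" if "n \<ge> 1" for n
  proof (rule cdf_unique)
    have "X n \<in> borel_measurable P" using indep that unfolding P.indep_vars_def2 by auto
    thus "real_distribution (distr P borel (X n))" by (rule P.real_distribution_distr)
  qed (use D cdf_X[OF that] cdf_D in auto)
  have D_tail: "measure D {x<..} = tail F x" for x
  proof -
    have "measure D {x<..} = measure D (space D - {..x})"
      by (rule arg_cong[where f = "measure D"]) auto
    also have "\<dots> = 1 - measure D {..x}" by (rule D.prob_compl) simp
    also have "measure D {..x} = F x" using cdf_D by (simp add: cdf_def2[symmetric])
    finally show ?thesis by (simp add: tail_def)
  qed
  have mean: "has_bochner_integral D (\<lambda>x. x) \<mu>" using assms(8) by (simp add: has_mean_def D_def)
  \<comment> \<open>The midpoint of 1 and \<alpha>; that \<alpha> exceeds 1 follows from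
    \<open>1 / \<alpha> < \<gamma> < 1\<close>.\<close>
  define q where "q = (1 + \<alpha>) / 2"
  have "\<alpha> > 1"
  proof -
    have "1 / \<alpha> < 1" using assms(12,13) by linarith
    thus ?thesis using assms(11) by simp
  qed
  hence q: "q > 1" "0 \<le> q" "q < \<alpha>" by (auto simp: q_def)
  obtain C where C: "C > 0" "\<forall>\<^sub>F x in at_top. tail F x \<le> C * x powr (- q)"
    using A.h_power_upper_bound[OF q(2,3)] by blast
  then obtain x0 where x0: "\<And>x. x \<ge> x0 \<Longrightarrow> tail F x \<le> C * x powr (- q)"
    by (auto simp: eventually_at_top_linorder)
  interpret T: gF_tail c g U "tail F" \<alpha> \<gamma> P X D "- \<mu>" q C "max 1 x0"
  proof unfold_locales
    show "\<And>x. max 1 x0 \<le> x \<Longrightarrow> measure D {x<..} \<le> C * x powr - q"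
      using x0 by (simp add: D_tail)
    show "(\<integral>x. x \<partial>D) = - (- \<mu>)" using mean by (simp add: has_bochner_integral_iff)
    show "integrable D (\<lambda>x. x)" using mean by (simp add: has_bochner_integral_iff)
  qed (use indep distr_X assms(9) q C D_tail in auto)
  define K where "K = A.c_sup powr \<alpha> * T.jump_const"
  have K: "K > 0" unfolding K_def using A.c_sup_pos T.jump_const_pos by (intro mult_pos_pos) auto
  have const: "(SUP i. c i) powr \<alpha> / \<gamma> * Beta (1 / \<gamma>) (\<alpha> - 1 / \<gamma>) *
          (Gamma (1 + \<gamma>) / (- \<mu>)) powr (1 / \<gamma>) = K"
  proof -
    have "(- \<mu> / Gamma (1 + \<gamma>)) powr (- (1 / \<gamma>)) = inverse (- \<mu> / Gamma (1 + \<gamma>)) powr (1 / \<gamma>)"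
      using assms(9) A.Gamma_gamma_pos by (simp only: powr_minus inverse_powr)
    also have "inverse (- \<mu> / Gamma (1 + \<gamma>)) = Gamma (1 + \<gamma>) / (- \<mu>)" by (rule inverse_divide)
    finally show ?thesis
      unfolding K_def T.jump_const_def A.c_sup_def by simp
  qed
  have "((\<lambda>t. P.prob (T.exceed t) / (U t * tail F t)) \<longlongrightarrow> K) at_top"
    unfolding K_def by (rule T.prob_exceed_ratio)
  from tendsto_divide[OF this tendsto_const[of K]]
  have "((\<lambda>t. P.prob (T.exceed t) / (U t * tail F t) / K) \<longlongrightarrow> K / K) at_top"
    using K by simp
  hence "((\<lambda>t. P.prob (T.exceed t) / (K * (U t * tail F t))) \<longlongrightarrow> 1) at_top"
    using K by (simp add: mult.commute)
  hence "(\<lambda>t. P.prob (T.exceed t)) \<sim>[at_top] (\<lambda>t. K * (U t * tail F t))"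
    by (rule asymp_equivI')
  thus ?thesis unfolding const T.exceed_def by (simp add: mult.assoc)
qed

end
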